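(* Let $\mathcal{F}_4^{\mathrm{bin}}$ be the set of integral binary quartic forms $f=f_0x^4+f_1x^3y+f_2x^2y^2+f_3xy^3+f_4y^4$ with nonzero discriminant, with coefficient height $H_c(f)=\max_i|f_i|$ and with $\psi(f)$ the pair $(R,C)$ described below. Then $(\mathcal{F}_4^{\mathrm{bin}},H_c,\psi)$ corresponds to $(1/6,1/6,1/6,1/6,1/3)$.
   Context: By Bhargava's parametrization, pairs $(A,B)$ of integral ternary quadratic forms correspond to pairs $(R,C)$ of a quartic ring and a cubic resolvent ring. $\psi(f)$ is the pair attached to $A(x,y,z)=f_0x^2+f_1xy+f_2y^2+f_3yz+f_4z^2$, $B(x,y,z)=y^2+xz$ (a variant of Wood's construction; $R$ is the Birch–Merriman ring of $f$). For a nondegenerate rank $n$ ring with homomorphisms $\sigma_i$ to $\mathbb{C}$, $|x|=\sqrt{\frac1n\sum|\sigma_i(x)|^2}$, $\lambda_i$ is the smallest $r$ with $i+1$ linearly independent elements of length $\le r$; $\Delta=|\mathrm{Disc}(R)|$. For $p=(p_1,p_2,p_3,q_1,q_2)$, $(R,C)$ is $(\varepsilon,X)$-close to $p$ if $\max_{i\le3}|\log_\Delta\lambda_i(R)-p_i|\le\varepsilon/\log X$ and $\max_{i\le2}|\log_\Delta\lambda_i(C)-q_i|\le\varepsilon/\log X$. $\mathcal{F}_4(p,\varepsilon,X)$: isomorphism classes of pairs $(R,C)$ ($R$ nondegenerate quartic, $C$ a cubic resolvent) with $\Delta\le X$ that are $(\varepsilon,X)$-close to $p$. $(\mathcal{F},H,\psi)$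 corresponds to $p$ if $\lim_{\varepsilon\to\infty}\liminf_{X\to\infty}\frac{\#\{f:H(f)\le X,\ \psi(f)\ (\varepsilon,X)\text{-close to }p\}}{\#\{f:H(f)\le X\}}=1$ and there is $M$ with $\liminf_X\frac{\#\{(R,C)\in\mathcal{F}_4(p,\varepsilon,X):(R,C)\in\psi(\mathcal{F})\}}{\#\mathcal{F}_4(p,\varepsilon,X)}>0$ for all $\varepsilon>M$. *)

theory Defs
  imports
    "HOL-Analysis.Analysis"
    "HOL-Algebra.Algebraic_Closure_Type"
begin

section \<open>Rings of rank n\<close>

definition int_comb :: "('a, 'm) ring_scheme \<Rightarrow> ('n::finite \<Rightarrow> 'a) \<Rightarrow> int ^ 'n \<Rightarrow> 'a" where
  "int_comb R b c = (\<Oplus>\<^bsub>R\<^esub>i\<in>UNIV. [c $ i] \<cdot>\<^bsub>R\<^esub> b i)"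

definition is_int_basis :: "('a, 'm) ring_scheme \<Rightarrow> ('n::finite \<Rightarrow> 'a) \<Rightarrow> bool" where
  "is_int_basis R b \<longleftrightarrow>
     range b \<subseteq> carrier R \<and> bij_betw (int_comb R b) UNIV (carrier R)"

text \<open>Throughout, the rank is passed as a finite index type: \<open>TYPE(4)\<close> for quartic rings
  and \<open>TYPE(3)\<close> for cubic rings.\<close>

definition rank_ring :: "'n::finite itself \<Rightarrow> ('a, 'm) ring_scheme \<Rightarrow> bool" where
  "rank_ring _ R \<longleftrightarrow> cring R \<and> (\<exists>b :: 'n \<Rightarrow> 'a. is_int_basis R b)"

definition coords :: "('a, 'm) ring_scheme \<Rightarrow> ('n::finite \<Rightarrow> 'a) \<Rightarrow> 'a \<Rightarrow> int ^ 'n" where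
  "coords R b = the_inv_into UNIV (int_comb R b)"

text \<open>The trace of multiplication by \<open>x\<close>.\<close>

definition trace_wrt :: "('a, 'm) ring_scheme \<Rightarrow> ('n::finite \<Rightarrow> 'a) \<Rightarrow> 'a \<Rightarrow> int" where
  "trace_wrt R b x = (\<Sum>i\<in>UNIV. coords R b (x \<otimes>\<^bsub>R\<^esub> b i) $ i)"

definition disc_wrt :: "('a, 'm) ring_scheme \<Rightarrow> ('n::finite \<Rightarrow> 'a) \<Rightarrow> int" where
  "disc_wrt R b = det (\<chi> i j. trace_wrt R b (b i \<otimes>\<^bsub>R\<^esub> b j))"

text \<open>The value of \<open>disc_wrt R b\<close> is the same for all \<open>\<int>\<close>-bases \<open>b\<close> of \<open>R\<close>.\<close>

definition ring_disc :: "'n::finite itself \<Rightarrow> ('a, 'm) ring_scheme \<Rightarrow> int" where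
  "ring_disc _ R = (THE d. \<exists>b :: 'n \<Rightarrow> 'a. is_int_basis R b \<and> d = disc_wrt R b)"

definition nondegenerate :: "'n::finite itself \<Rightarrow> ('a, 'm) ring_scheme \<Rightarrow> bool" where
  "nondegenerate n R \<longleftrightarrow> ring_disc n R \<noteq> 0"

section \<open>Length and successive minima\<close>

text \<open>Homomorphisms are made extensional so that each one is counted once.  A nondegenerate
  ring of rank n has exactly n of them.\<close>

definition complex_homs :: "('a, 'm) ring_scheme \<Rightarrow> ('a \<Rightarrow> complex) set" where
  "complex_homs R = ring_hom R (ring_of_type_algebra :: complex ring) \<inter> extensional (carrier R)"

definition ring_length :: "'n::finite itself \<Rightarrow> ('a, 'm) ring_scheme \<Rightarrow> 'a \<Rightarrow> real" where
  "ring_length _ R x = sqrt (1 / real CARD('n) * (\<Sum>\<sigma>\<in>complex_homs R. (cmod (\<sigma> x))\<^sup>2))"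

definition int_independent :: "('a, 'm) ring_scheme \<Rightarrow> nat set \<Rightarrow> (nat \<Rightarrow> 'a) \<Rightarrow> bool" where
  "int_independent R I v \<longleftrightarrow>
     (\<forall>c :: nat \<Rightarrow> int. (\<Oplus>\<^bsub>R\<^esub>j\<in>I. [c j] \<cdot>\<^bsub>R\<^esub> v j) = \<zero>\<^bsub>R\<^esub> \<longrightarrow> (\<forall>j\<in>I. c j = 0))"

definition succ_min :: "'n::finite itself \<Rightarrow> ('a, 'm) ring_scheme \<Rightarrow> nat \<Rightarrow> real" where
  "succ_min n R i =
     (LEAST r. \<exists>v :: nat \<Rightarrow> 'a. v \<in> {..i} \<rightarrow> carrier R \<and> int_independent R {..i} v \<and>
                  (\<forall>j\<in>{..i}. ring_length n R (v j) \<le> r))"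

section \<open>Cubic resolvents and isomorphism classes of pairs\<close>

text \<open>Let \<open>R\<close> be a nondegenerate quartic ring and write \<open>x\<^sub>0, \<dots>, x\<^sub>3\<close> for the conjugates of
  \<open>x\<close> in \<open>R\<close>.  Bhargava's resolvent map is \<open>x \<mapsto> x\<^sub>0 x\<^sub>1 + x\<^sub>2 x\<^sub>3\<close>, with conjugates
  \<open>x\<^sub>0 x\<^sub>2 + x\<^sub>1 x\<^sub>3\<close> and \<open>x\<^sub>0 x\<^sub>3 + x\<^sub>1 x\<^sub>2\<close>; its values generate the cubic invariant ring of \<open>R\<close>.
  A cubic resolvent ring of \<open>R\<close> is a cubic ring that contains the cubic invariant ring and has
  the same discriminant as \<open>R\<close>.  The containment is recorded by the resolvent map
  \<open>\<phi>\<close> from \<open>R\<close> to \<open>C\<close>.\<close>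

definition is_resolvent_map ::
  "('a, 'm) ring_scheme \<Rightarrow> ('b, 'k) ring_scheme \<Rightarrow> ('a \<Rightarrow> 'b) \<Rightarrow> bool" where
  "is_resolvent_map R C \<phi> \<longleftrightarrow>
     \<phi> \<in> carrier R \<rightarrow> carrier C \<and>
     (\<exists>\<sigma> \<tau>. bij_betw \<sigma> {..<4::nat} (complex_homs R) \<and> bij_betw \<tau> {..<3::nat} (complex_homs C) \<and>
        (\<forall>x\<in>carrier R.
           \<tau> 0 (\<phi> x) = \<sigma> 0 x * \<sigma> 1 x + \<sigma> 2 x * \<sigma> 3 x \<and>
           \<tau> 1 (\<phi> x) = \<sigma> 0 x * \<sigma> 2 x + \<sigma> 1 x * \<sigma> 3 x \<and>
           \<tau> 2 (\<phi> x) = \<sigma> 0 x * \<sigma> 3 x + \<sigma> 1 x * \<sigma> 2 x))"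

definition is_cubic_resolvent ::
  "('a, 'm) ring_scheme \<Rightarrow> ('b, 'k) ring_scheme \<Rightarrow> ('a \<Rightarrow> 'b) \<Rightarrow> bool" where
  "is_cubic_resolvent R C \<phi> \<longleftrightarrow>
     rank_ring TYPE(3) C \<and> ring_disc TYPE(3) C = ring_disc TYPE(4) R \<and> is_resolvent_map R C \<phi>"

text \<open>Rings of finite rank are countable, so up to isomorphism nothing is lost by taking the
  underlying sets of \<open>R\<close> and \<open>C\<close> inside the following two countably infinite types; the ring
  operations need not be the componentwise ones.\<close>

type_synonym resolvent_pair = "(int ^ 4) ring \<times> (int ^ 3) ring \<times> (int ^ 4 \<Rightarrow> int ^ 3)"

definition resolvent_pairs :: "resolvent_pair set" where
  "resolvent_pairs =
     {(R, C, \<phi>). rank_ring TYPE(4) R \<and> nondegenerate TYPE(4) R \<and> is_cubic_resolvent R C \<phi>}"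

definition pair_iso :: "(resolvent_pair \<times> resolvent_pair) set" where
  "pair_iso =
     {((R, C, \<phi>), (R', C', \<phi>')).
        (R, C, \<phi>) \<in> resolvent_pairs \<and> (R', C', \<phi>') \<in> resolvent_pairs \<and>
        (\<exists>\<alpha>\<in>ring_iso R R'. \<exists>\<beta>\<in>ring_iso C C'. \<forall>x\<in>carrier R. \<beta> (\<phi> x) = \<phi>' (\<alpha> x))}"

section \<open>Bhargava's parametrization\<close>

text \<open>A pair \<open>(R, C)\<close> corresponds to the pair \<open>(A, B)\<close> of integral ternary quadratic forms if
  \<open>(A, B)\<close> is the matrix of the quadratic map \<open>R/\<int> \<rightarrow> C/\<int>\<close> induced by \<open>\<phi>\<close> with respect to
  suitable \<open>\<int>\<close>-bases.  If \<open>(A, B)\<close> has nonzero discriminant, the pairs corresponding to it form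
  a single isomorphism class, and if it has discriminant zero there are none, since only
  nondegenerate rings are considered.\<close>

type_synonym ternary_form = "int \<Rightarrow> int \<Rightarrow> int \<Rightarrow> int"

definition represented_by ::
  "('a, 'm) ring_scheme \<Rightarrow> ('b, 'k) ring_scheme \<Rightarrow> ('a \<Rightarrow> 'b) \<Rightarrow>
     ternary_form \<Rightarrow> ternary_form \<Rightarrow> bool" where
  "represented_by R C \<phi> A B \<longleftrightarrow>
     (\<exists>(b :: 4 \<Rightarrow> 'a) (c :: 3 \<Rightarrow> 'b).
        is_int_basis R b \<and> b 0 = \<one>\<^bsub>R\<^esub> \<and> is_int_basis C c \<and> c 0 = \<one>\<^bsub>C\<^esub> \<and>
        (\<forall>x y z. \<exists>k :: int.
           \<phi> ([x] \<cdot>\<^bsub>R\<^esub> b 1 \<oplus>\<^bsub>R\<^esub> [y] \<cdot>\<^bsub>R\<^esub> b 2 \<oplus>\<^bsub>R\<^esub> [z] \<cdot>\<^bsub>R\<^esub> b 3) =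
             [k] \<cdot>\<^bsub>C\<^esub> \<one>\<^bsub>C\<^esub> \<oplus>\<^bsub>C\<^esub> [A x y z] \<cdot>\<^bsub>C\<^esub> c 1 \<oplus>\<^bsub>C\<^esub> [B x y z] \<cdot>\<^bsub>C\<^esub> c 2))"

definition bhargava_class :: "ternary_form \<Rightarrow> ternary_form \<Rightarrow> resolvent_pair set" where
  "bhargava_class A B = {(R, C, \<phi>) \<in> resolvent_pairs. represented_by R C \<phi> A B}"

section \<open>Families corresponding to a point\<close>

type_synonym point = "real \<times> real \<times> real \<times> real \<times> real"

fun close :: "point \<Rightarrow> real \<Rightarrow> real \<Rightarrow> resolvent_pair \<Rightarrow> bool" where
  "close (p1, p2, p3, q1, q2) \<epsilon> T (R, C, \<phi>) \<longleftrightarrow>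
     (let \<Delta> = real_of_int \<bar>ring_disc TYPE(4) R\<bar> in
        Max {\<bar>log \<Delta> (succ_min TYPE(4) R 1) - p1\<bar>,
             \<bar>log \<Delta> (succ_min TYPE(4) R 2) - p2\<bar>,
             \<bar>log \<Delta> (succ_min TYPE(4) R 3) - p3\<bar>} \<le> \<epsilon> / ln T \<and>
        Max {\<bar>log \<Delta> (succ_min TYPE(3) C 1) - q1\<bar>,
             \<bar>log \<Delta> (succ_min TYPE(3) C 2) - q2\<bar>} \<le> \<epsilon> / ln T)"

definition F4 :: "point \<Rightarrow> real \<Rightarrow> real \<Rightarrow> resolvent_pair set set" where
  "F4 p \<epsilon> T =
     {(R, C, \<phi>) \<in> resolvent_pairs.
        real_of_int \<bar>ring_disc TYPE(4) R\<bar> \<le> T \<and> close p \<epsilon> T (R, C, \<phi>)} // pair_iso"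

text \<open>The map \<open>\<psi>\<close> takes values in isomorphism classes of pairs, and closeness is
  invariant under isomorphism.\<close>

definition corresponds_to ::
  "'f set \<Rightarrow> ('f \<Rightarrow> real) \<Rightarrow> ('f \<Rightarrow> resolvent_pair set) \<Rightarrow> point \<Rightarrow> bool" where
  "corresponds_to F H \<psi> p \<longleftrightarrow>
     ((\<lambda>\<epsilon>. Liminf at_top (\<lambda>T::real. ereal
          (real (card {f \<in> F. H f \<le> T \<and> (\<exists>P\<in>\<psi> f. close p \<epsilon> T P)}) /
           real (card {f \<in> F. H f \<le> T})))) \<longlongrightarrow> 1) at_top \<and>
     (\<exists>M. \<forall>\<epsilon>>M. Liminf at_top (\<lambda>T::real. ereal
          (real (card {K \<in> F4 p \<epsilon> T. K \<in> \<psi> ` F}) / real (card (F4 p \<epsilon> T)))) > 0)"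

section \<open>Binary quartic forms\<close>

text \<open>The tuple \<open>(f\<^sub>0, f\<^sub>1, f\<^sub>2, f\<^sub>3, f\<^sub>4)\<close> stands for
  \<open>f\<^sub>0 x\<^sup>4 + f\<^sub>1 x\<^sup>3 y + f\<^sub>2 x\<^sup>2 y\<^sup>2 + f\<^sub>3 x y\<^sup>3 + f\<^sub>4 y\<^sup>4\<close>.\<close>

type_synonym binary_quartic = "int \<times> int \<times> int \<times> int \<times> int"

fun quartic_disc :: "'a::comm_ring_1 \<times> 'a \<times> 'a \<times> 'a \<times> 'a \<Rightarrow> 'a" where
  "quartic_disc (a, b, c, d, e) =
     256 * a^3 * e^3 - 192 * a^2 * b * d * e^2 - 128 * a^2 * c^2 * e^2 + 144 * a^2 * c * d^2 * e
     - 27 * a^2 * d^4 + 144 * a * b^2 * c * e^2 - 6 * a * b^2 * d^2 * e - 80 * a * b * c^2 * d * e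
     + 18 * a * b * c * d^3 + 16 * a * c^4 * e - 4 * a * c^3 * d^2 - 27 * b^4 * e^2
     + 18 * b^3 * c * d * e - 4 * b^3 * d^3 - 4 * b^2 * c^3 * e + b^2 * c^2 * d^2"

lemma quartic_disc_invariants:
  fixes a b c d e :: "'a::comm_ring_1"
  shows "27 * quartic_disc (a, b, c, d, e) =
    4 * (12 * a * e - 3 * b * d + c^2)^3
    - (72 * a * c * e + 9 * b * c * d - 27 * a * d^2 - 27 * e * b^2 - 2 * c^3)^2"
  by (simp add: power2_eq_square power3_eq_cube power4_eq_xxxx algebra_simps)

text \<open>The discriminant of \<open>(r\<^sub>1 x + s\<^sub>1 y) \<cdots> (r\<^sub>4 x + s\<^sub>4 y)\<close>.\<close>

lemma quartic_disc_factors: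
  fixes r1 r2 r3 r4 s1 s2 s3 s4 :: complex
  assumes a: "a = r1 * r2 * r3 * r4"
    and b: "b = s1 * r2 * r3 * r4 + r1 * s2 * r3 * r4 + r1 * r2 * s3 * r4 + r1 * r2 * r3 * s4"
    and c: "c = s1 * s2 * r3 * r4 + s1 * r2 * s3 * r4 + s1 * r2 * r3 * s4
              + r1 * s2 * s3 * r4 + r1 * s2 * r3 * s4 + r1 * r2 * s3 * s4"
    and d: "d = r1 * s2 * s3 * s4 + s1 * r2 * s3 * s4 + s1 * s2 * r3 * s4 + s1 * s2 * s3 * r4"
    and e: "e = s1 * s2 * s3 * s4"
  shows "quartic_disc (a, b, c, d, e) =
     ((r1 * s2 - r2 * s1) * (r1 * s3 - r3 * s1) * (r1 * s4 - r4 * s1)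
       * (r2 * s3 - r3 * s2) * (r2 * s4 - r4 * s2) * (r3 * s4 - r4 * s3))\<^sup>2"
proof -
  define u v w where "u = (r1 * s2 - r2 * s1) * (r3 * s4 - r4 * s3)"
    and "v = (r1 * s3 - r3 * s1) * (r4 * s2 - r2 * s4)"
    and "w = (r1 * s4 - r4 * s1) * (r2 * s3 - r3 * s2)"
  note uvw = u_def v_def w_def
  have "u + v + w = 0"
    unfolding uvw by Groebner_Basis.algebra
  then have sum: "w = - (u + v)"
    by (simp add: add_eq_0_iff)
  have I: "12 * a * e - 3 * b * d + c^2 = - (u * v + v * w + w * u)"
    unfolding uvw a b c d e by Groebner_Basis.algebra
  have J: "72 * a * c * e + 9 * b * c * d - 27 * a * d^2 - 27 * e * b^2 - 2 * c^3
      = (u - v) * (v - w) * (w - u)"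
    unfolding uvw a b c d e by Groebner_Basis.algebra
  have "27 * quartic_disc (a, b, c, d, e) = 27 * (u * v * w)\<^sup>2"
    unfolding quartic_disc_invariants I J sum by Groebner_Basis.algebra
  moreover have "(u * v * w)\<^sup>2 =
     ((r1 * s2 - r2 * s1) * (r1 * s3 - r3 * s1) * (r1 * s4 - r4 * s1)
       * (r2 * s3 - r3 * s2) * (r2 * s4 - r4 * s2) * (r3 * s4 - r4 * s3))\<^sup>2"
    unfolding uvw by (simp add: power_mult_distrib power2_commute[of "r4 * s2"])
  ultimately show ?thesis
    by (simp del: quartic_disc.simps)
qed

definition F4_bin :: "binary_quartic set" where
  "F4_bin = {f. quartic_disc f \<noteq> 0}"

fun coeff_height :: "binary_quartic \<Rightarrow> real" where
  "coeff_height (f0, f1, f2, f3, f4) =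
     real_of_int (Max {\<bar>f0\<bar>, \<bar>f1\<bar>, \<bar>f2\<bar>, \<bar>f3\<bar>, \<bar>f4\<bar>})"

fun form_A :: "binary_quartic \<Rightarrow> ternary_form" where
  "form_A (f0, f1, f2, f3, f4) x y z =
     f0 * x^2 + f1 * x * y + f2 * y^2 + f3 * y * z + f4 * z^2"

definition form_B :: ternary_form where
  "form_B x y z = y^2 + x * z"

text \<open>The conic \<open>y\<^sup>2 + x z = 0\<close> is parametrized by \<open>(s\<^sup>2, s t, - t\<^sup>2)\<close>, and \<open>form_A f\<close>
  restricts on it to the binary quartic form \<open>(f\<^sub>0, f\<^sub>1, f\<^sub>2, - f\<^sub>3, f\<^sub>4)\<close>.  The discriminant of
  the pair \<open>(form_A f, form_B)\<close> is therefore that of the form with \<open>f\<^sub>3\<close> negated.  For those \<open>f\<close>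
  in \<open>F4_bin\<close> for which it vanishes, the attached rings are degenerate, so they have no
  successive minima, and \<open>quartic_psi f\<close> is empty.\<close>

definition quartic_psi :: "binary_quartic \<Rightarrow> resolvent_pair set" where
  "quartic_psi f = bhargava_class (form_A f) form_B"

end

theory Submission
  imports Defs
begin

text \<open>The pair attached to a form \<open>f\<close> is explicit: \<open>R\<close> has the Birch--Merriman basis, and \<open>C\<close> has
  the basis \<open>1, u, u\<^sup>2 - f\<^sub>2 u\<close> for a root \<open>u\<close> of the cubic resolvent.  If \<open>f\<close> has height \<open>Y\<close>, then
  the conjugates of these basis elements are \<open>O(Y)\<close> in \<open>R\<close> and \<open>O(1), O(Y), O(Y\<^sup>2)\<close> in \<open>C\<close>.  The
  determinant of the embeddings is the square root of the discriminant, so Cramer's rule and the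
  trivial bound for determinants show that the successive minima have exactly these sizes as soon
  as the discriminant is at least \<open>\<delta> Y\<^sup>6\<close>.  For fixed \<open>f\<^sub>1, \<dots>, f\<^sub>4\<close> the discriminant is a cubic
  polynomial in \<open>f\<^sub>0\<close> with leading coefficient \<open>256 f\<^sub>4\<^sup>3\<close>, so this fails only for a small
  proportion of forms.

  For the second condition, an isomorphism class is determined by \<open>(A, B)\<close>: the identity
  \<open>1 \<and> x \<and> y \<and> xy = \<plusminus> 1 \<and> \<phi>(x) \<and> \<phi>(y)\<close> gives the structure constants of \<open>R\<close> up to translation of
  the basis by integers, and associativity gives the rest.  A class close to the point has bases
  adapted to the successive minima, in which \<open>B\<close> has bounded coefficients and \<open>A\<close> has coefficients
  \<open>O(T\<^bsup>1/6\<^esup>)\<close>; adding a multiple of \<open>B\<close> to \<open>A\<close> makes one of the six coefficients of \<open>A\<close> bounded as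
  well, so there are \<open>O(T\<^bsup>5/6\<^esup>)\<close> classes.  Conversely, there are at least \<open>k T\<^bsup>5/6\<^esup>\<close> forms of
  height \<open>Y\<close> a small multiple of \<open>T\<^bsup>1/6\<^esup>\<close>, and a bounded number of them fall into one class, because
  an isomorphism between two such pairs has bounded matrix entries and determines one form from
  the other.\<close>

text \<open>The tolerance \<epsilon> / ln T, multiplied by ln \<Delta>, which is of order at most ln
  T, is a bounded additive error in the logarithm of a successive minimum. Sizes are therefore
  needed only up to constant factors, and bounds as crude as n! for determinants suffice.

  All ring theory passes through complex homomorphisms. A full set of them is linearly independent
  by Dedekind's theorem, so the matrix of embeddings is invertible: identities in the rings become
  identities between complex numbers, and an element that is too short must have vanishing
  coordinates.

  A sign runs through the proof. The quartic ring with parameters a, b, c, d, e is represented by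
  the form A of (a, b, c, -d, e). Hence the discriminant that governs \<open>quartic_psi f\<close>
  is that of \<open>flip f\<close>, while membership in \<open>F4_bin\<close> concerns f itself.
  When classes are counted, both forms have to be kept out of the exceptional set.\<close>

no_notation fps_nth (infixl \<open>$\<close> 75)

section \<open>Integer matrices and lattices\<close>

lemma of_int_det:
  "of_int (det A) = det (\<chi> i j. (of_int (A $ i $ j) :: 'b::comm_ring_1))"
  for A :: "int ^ 'n ^ 'n::finite"
  by (simp add: det_def)

text \<open>Each of the n! Leibniz products takes exactly one entry from every column. Bounding
  columns separately matters because the basis elements have sizes of different order.\<close>

lemma norm_det_le:
  fixes A :: "complex ^ 'n ^ 'n::finite"
  assumes "\<And>i j. cmod (A $ i $ j) \<le> M j"
  shows "cmod (det A) \<le> fact CARD('n) * (\<Prod>j\<in>UNIV. M j)"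
proof -
  let ?P = "{p. p permutes (UNIV :: 'n set)}"
  have "cmod (of_int (sign p) * (\<Prod>i\<in>UNIV. A $ i $ p i)) \<le> (\<Prod>j\<in>UNIV. M j)" if "p \<in> ?P" for p
  proof -
    have "cmod (of_int (sign p) * (\<Prod>i\<in>UNIV. A $ i $ p i)) = (\<Prod>i\<in>UNIV. cmod (A $ i $ p i))"
      by (simp add: norm_mult prod_norm sign_def)
    also have "\<dots> \<le> (\<Prod>i\<in>UNIV. M (p i))"
      by (intro prod_mono) (simp add: assms)
    also have "\<dots> = (\<Prod>j\<in>UNIV. M j)"
      using that prod.permute[of p UNIV M] by (simp add: o_def)
    finally show ?thesis .
  qed
  then have "cmod (det A) \<le> (\<Sum>p\<in>?P. (\<Prod>j\<in>UNIV. M j))"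
    unfolding det_def by (intro sum_norm_le) auto
  then show ?thesis
    by (simp add: card_permutations)
qed

text \<open>In the types \<open>4\<close> and \<open>3\<close> the numerals 4 and 3 denote 0.
  Library facts enumerate the indices from 1, but here index 0 is reserved for the identity of the
  ring, so the expansions are restated with 0 in front.\<close>

lemma four_eq_0: "(4::4) = 0" and three_eq_0: "(3::3) = 0"
  by simp_all

lemma UNIV_4_0: "UNIV = {0, 1, 2, 3 :: 4}"
  unfolding UNIV_4 four_eq_0 by blast

lemma UNIV_3_0: "UNIV = {0, 1, 2 :: 3}"
  unfolding UNIV_3 three_eq_0 by blast

lemma sum_4_0: "(\<Sum>i\<in>UNIV. f i) = f 0 + f 1 + f 2 + f (3::4)"
  unfolding sum_4 four_eq_0 by (simp add: ac_simps)

lemma sum_3_0: "(\<Sum>i\<in>UNIV. f i) = f 0 + f 1 + f (2::3)"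
  unfolding sum_3 three_eq_0 by (simp add: ac_simps)

lemma all_4_0: "(\<forall>i::4. P i) \<longleftrightarrow> P 0 \<and> P 1 \<and> P 2 \<and> P 3"
  using forall_4[of P] unfolding four_eq_0 by blast

lemma all_3_0: "(\<forall>i::3. P i) \<longleftrightarrow> P 0 \<and> P 1 \<and> P 2"
  using forall_3[of P] unfolding three_eq_0 by blast

lemma det_3_0:
  "det (A::'a::comm_ring_1^3^3) =
    A$0$0 * A$1$1 * A$2$2 + A$0$1 * A$1$2 * A$2$0 + A$0$2 * A$1$0 * A$2$1
    - A$0$0 * A$1$2 * A$2$1 - A$0$1 * A$1$0 * A$2$2 - A$0$2 * A$1$1 * A$2$0"
  unfolding det_3 three_eq_0 by (simp add: algebra_simps)

text \<open>The Laplace expansion by the 2x2 minors of the first two rows and the complementary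
  minors of the last two.\<close>

definition det4 :: "'a \<times> 'a \<times> 'a \<times> 'a \<Rightarrow> 'a \<times> 'a \<times> 'a \<times> 'a \<Rightarrow> 'a \<times> 'a \<times> 'a \<times> 'a \<Rightarrow>
    'a \<times> 'a \<times> 'a \<times> 'a \<Rightarrow> 'a::comm_ring_1" where
  "det4 = (\<lambda>(a0,a1,a2,a3) (b0,b1,b2,b3) (c0,c1,c2,c3) (d0,d1,d2,d3).
     (a0*b1 - a1*b0) * (c2*d3 - c3*d2) - (a0*b2 - a2*b0) * (c1*d3 - c3*d1)
   + (a0*b3 - a3*b0) * (c1*d2 - c2*d1) + (a1*b2 - a2*b1) * (c0*d3 - c3*d0)
   - (a1*b3 - a3*b1) * (c0*d2 - c2*d0) + (a2*b3 - a3*b2) * (c0*d1 - c1*d0))"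

lemma det_4_0:
  fixes A :: "'a::comm_ring_1^4^4"
  shows "det A = det4 (A$0$0, A$0$1, A$0$2, A$0$3) (A$1$0, A$1$1, A$1$2, A$1$3)
                      (A$2$0, A$2$1, A$2$2, A$2$3) (A$3$0, A$3$1, A$3$2, A$3$3)"
proof -
  have f: "finite {1::4, 2, 3}" "0 \<notin> {1::4, 2, 3}" "finite {2::4, 3}" "1 \<notin> {2::4, 3}"
    "finite {3::4}" "2 \<notin> {3::4}"
    by auto
  show ?thesis
    unfolding det_def UNIV_4_0
    unfolding sum_over_permutations_insert[OF f(1,2)]
    unfolding sum_over_permutations_insert[OF f(3,4)]
    unfolding sum_over_permutations_insert[OF f(5,6)]
    unfolding permutes_sing
    by (simp add: det4_def sign_swap_id permutation_swap_id permutation_compose sign_compose sign_id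
        transpose_def algebra_simps)
qed

text \<open>A kernel vector exists over the rationals; multiplying it by the product
  \<open>d\<close> of all denominators makes it integral.\<close>

lemma int_kernel:
  fixes A :: "int ^ 'n ^ 'n::finite"
  assumes "det A = 0"
  shows "\<exists>x. x \<noteq> 0 \<and> A *v x = 0"
proof -
  define B :: "rat ^ 'n ^ 'n" where "B = (\<chi> i j. of_int (A $ i $ j))"
  have "det B = 0"
    using assms of_int_det[of A, where ?'b = rat] by (simp add: B_def)
  then obtain x where x: "x \<noteq> 0" "B *v x = 0"
    using invertible_det_nz[of B] matrix_left_invertible_ker[of B] invertible_left_inverse[of B] by auto
  define d where "d = (\<Prod>i\<in>UNIV. snd (quotient_of (x $ i)))"
  define n where "n i = (\<Prod>j\<in>UNIV - {i}. snd (quotient_of (x $ j))) * fst (quotient_of (x $ i))" for i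
  have d: "d > 0"
    unfolding d_def by (intro prod_pos) (simp add: quotient_of_denom_pos')
  have n: "of_int (n i) = of_int d * x $ i" for i
  proof -
    have "d = snd (quotient_of (x $ i)) * (\<Prod>j\<in>UNIV - {i}. snd (quotient_of (x $ j)))"
      unfolding d_def by (subst prod.remove[of _ i]) auto
    moreover have "x $ i = of_int (fst (quotient_of (x $ i))) / of_int (snd (quotient_of (x $ i)))"
      by (simp add: quotient_of_div)
    moreover have "snd (quotient_of (x $ i)) > 0"
      by (simp add: quotient_of_denom_pos')
    ultimately show ?thesis
      by (simp add: n_def field_simps)
  qed
  let ?y = "\<chi> i. n i"
  have "of_int ((A *v ?y) $ i) = (0::rat)" for i
  proof -
    have "of_int ((A *v ?y) $ i) = of_int d * (B *v x) $ i"
      by (simp add: matrix_vector_mult_def B_def n sum_distrib_left algebra_simps)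
    then show ?thesis by (simp add: x)
  qed
  then have "A *v ?y = 0"
    by (simp add: vec_eq_iff)
  moreover have "?y \<noteq> 0"
  proof
    assume "?y = 0"
    then have "n i = 0" for i by (simp add: vec_eq_iff)
    then have "x $ i = 0" for i using n[of i] d by simp
    then show False using x by (simp add: vec_eq_iff)
  qed
  ultimately show ?thesis by blast
qed

lemma finite_bounded_int_vec: "finite {x :: int ^ 'n::finite. \<forall>i. \<bar>x $ i\<bar> \<le> K}"
proof (rule finite_subset)
  show "{x :: int ^ 'n. \<forall>i. \<bar>x $ i\<bar> \<le> K} \<subseteq> (\<lambda>f. \<chi> i. f i) ` (UNIV \<rightarrow>\<^sub>E {-K..K})"
  proof
    fix x :: "int ^ 'n" assume "x \<in> {x. \<forall>i. \<bar>x $ i\<bar> \<le> K}"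
    then have "x = (\<chi> i. (($) x) i)" "($) x \<in> UNIV \<rightarrow>\<^sub>E {-K..K}"
      by (auto simp: vec_eq_iff abs_le_iff minus_le_iff)
    then show "x \<in> (\<lambda>f. \<chi> i. f i) ` (UNIV \<rightarrow>\<^sub>E {-K..K})" by blast
  qed
qed (intro finite_imageI finite_PiE, auto)

text \<open>The functionals \<open>t i\<close> are the coordinates with respect to the \<open>v i\<close>, scaled by the common
  denominator \<open>D\<close>.  The vectors \<open>b j\<close> form a basis adapted to the flag spanned by the \<open>v i\<close>.\<close>

lemma adapted_basis:
  fixes v :: "nat \<Rightarrow> int ^ 'n::finite" and t :: "nat \<Rightarrow> int ^ 'n \<Rightarrow> int" and D :: int
  assumes D: "D > 0"
    and add: "\<And>i x y. t i (x + y) = t i x + t i y"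
    and scale: "\<And>i m x. t i (m *s x) = m * t i x"
    and dual: "\<And>i j. i \<le> m \<Longrightarrow> j \<le> m \<Longrightarrow> t i (v j) = (if i = j then D else 0)"
    and prim: "\<And>x. (\<forall>i. 1 \<le> i \<and> i \<le> m \<longrightarrow> t i x = 0) \<Longrightarrow> \<exists>c. x = c *s v 0"
    and k: "k \<le> m"
  shows "\<exists>b. b 0 = v 0 \<and> (\<forall>j\<le>k. t j (b j) \<noteq> 0 \<and> (\<forall>i\<le>m. j < i \<longrightarrow> t i (b j) = 0) \<and> (\<forall>i\<le>m. \<bar>t i (b j)\<bar> \<le> D)) \<and>
     (\<forall>x. (\<forall>i\<le>m. k < i \<longrightarrow> t i x = 0) \<longrightarrow> (\<exists>c. x = (\<Sum>j\<le>k. c j *s b j)))"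
  using k
proof (induction k)
  case 0
  have "\<exists>c. x = (\<Sum>j\<le>0::nat. c j *s v 0)" if "\<forall>i\<le>m. 0 < i \<longrightarrow> t i x = 0" for x
    using prim[of x] that by auto
  then show ?case
    using D dual by (intro exI[of _ "\<lambda>_. v 0"]) auto
next
  case (Suc k)
  then obtain b where b: "b 0 = v 0"
    "\<And>j. j \<le> k \<Longrightarrow> t j (b j) \<noteq> 0 \<and> (\<forall>i\<le>m. j < i \<longrightarrow> t i (b j) = 0) \<and> (\<forall>i\<le>m. \<bar>t i (b j)\<bar> \<le> D)"
    "\<And>x. (\<forall>i\<le>m. k < i \<longrightarrow> t i x = 0) \<Longrightarrow> \<exists>c. x = (\<Sum>j\<le>k. c j *s b j)"
    by (metis Suc_leD)
  let ?L = "{x. \<forall>i\<le>m. Suc k < i \<longrightarrow> t i x = 0}"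
  let ?s = "t (Suc k)"
  have sum: "t i (sum f A) = (\<Sum>a\<in>A. t i (f a))" if "finite A" for i and f :: "nat \<Rightarrow> _" and A
    using that scale[of i 0 0] by (induction A rule: finite_induct) (auto simp: add)
  have diff: "t i (x - y) = t i x - t i y" for i x y
    using add[of i "x - y" y] by simp
  \<comment> \<open>The smallest positive value of the functional of index \<open>Suc k\<close> on
    the sublattice where all later functionals vanish. A vector attaining it is the next basis
    vector; \<open>N\<close> is at most \<open>D\<close> because \<open>v (Suc k)\<close> has value
    \<open>D\<close>.\<close>
  define N where "N = (LEAST n. n > 0 \<and> (\<exists>x\<in>?L. ?s x = int n))"
  have ex: "nat D > 0 \<and> (\<exists>x\<in>?L. ?s x = int (nat D))"
    using D Suc.prems dual[of _ "Suc k"] by (intro conjI bexI[of _ "v (Suc k)"]) auto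
  then have N: "N > 0 \<and> (\<exists>x\<in>?L. ?s x = int N)" "N \<le> nat D"
    unfolding N_def by (rule LeastI) (rule Least_le, rule ex)
  from N(1) obtain z where z: "z \<in> ?L" "?s z = int N" by blast
  have Npos: "N > 0" using N(1) by blast
  have Nmin: "N \<le> n" if "n > 0" "x \<in> ?L" "?s x = int n" for n x
    unfolding N_def using that by (intro Least_le) auto
  \<comment> \<open>Subtracting multiples of the earlier \<open>v i\<close> brings the lower
    coordinates into the range from 0 to \<open>D\<close> and leaves the others unchanged, since
    \<open>t i (v i)\<close> is \<open>D\<close>.\<close>
  define w where "w = z - (\<Sum>i\<le>k. (t i z div D) *s v i)"
  have tw: "t i w = (if i \<le> k then t i z mod D else t i z)" if "i \<le> m" for i
  proof -
    have "(\<Sum>a\<le>k. (t a z div D) * t i (v a)) = (\<Sum>a\<le>k. if i = a then (t a z div D) * D else 0)"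
      using Suc.prems that by (intro sum.cong) (auto simp: dual)
    also have "\<dots> = (if i \<le> k then (t i z div D) * D else 0)"
      by simp
    finally show ?thesis
      by (simp add: w_def diff sum scale minus_div_mult_eq_mod)
  qed
  have wL: "w \<in> ?L" using z tw by auto
  have sw: "?s w = int N" using z tw[of "Suc k"] Suc.prems by simp
  have "\<exists>c. x = (\<Sum>j\<le>Suc k. c j *s (b(Suc k := w)) j)" if x: "x \<in> ?L" for x
  proof -
    let ?q = "?s x div int N"
    let ?y = "x - ?q *s w"
    have sy: "?s ?y = ?s x mod int N"
      by (simp add: diff scale sw minus_div_mult_eq_mod)
    have yL: "?y \<in> ?L" using x wL by (auto simp: diff scale)
    \<comment> \<open>Division with remainder by \<open>N\<close>: a nonzero remainder would
      contradict its minimality, so \<open>?y\<close> falls under the induction hypothesis.\<close>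
    have "?s ?y = 0"
    proof (rule ccontr)
      assume "?s ?y \<noteq> 0"
      moreover have "?s ?y \<ge> 0" using sy Npos by simp
      ultimately have "nat (?s ?y) > 0" "?s ?y = int (nat (?s ?y))" by simp_all
      from Nmin[OF this(1) yL this(2)] have "int N \<le> ?s x mod int N" using sy Npos by simp
      then show False using Npos by (smt (verit) pos_mod_bound of_nat_0_less_iff)
    qed
    then have "\<forall>i\<le>m. k < i \<longrightarrow> t i ?y = 0"
      using yL by (metis (mono_tags, lifting) Suc_lessI mem_Collect_eq)
    then obtain c where c: "?y = (\<Sum>j\<le>k. c j *s b j)" using b(3) by blast
    have "x = (\<Sum>j\<le>k. c j *s b j) + ?q *s w" using c by (simp add: algebra_simps)
    also have "\<dots> = (\<Sum>j\<le>Suc k. (c(Suc k := ?q)) j *s (b(Suc k := w)) j)"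
    proof -
      have "(\<Sum>j\<le>k. (c(Suc k := ?q)) j *s (b(Suc k := w)) j) = (\<Sum>j\<le>k. c j *s b j)"
        by (intro sum.cong) auto
      then show ?thesis by simp
    qed
    finally show ?thesis by blast
  qed
  moreover have "\<bar>t i w\<bar> \<le> D" if "i \<le> m" for i
  proof (cases "i \<le> k")
    case True
    then show ?thesis using tw[OF that] D by (simp add: order_less_imp_le)
  next
    case False
    then show ?thesis
    proof (cases "i = Suc k")
      case True
      then show ?thesis using sw N(2) D by auto
    next
      case F: False
      then have "t i w = 0" using wL False that by auto
      then show ?thesis using D by simp
    qed
  qed
  ultimately show ?case
    using b wL sw Npos Suc.prems
    by (intro exI[of _ "b(Suc k := w)"]) (auto simp: le_Suc_eq)
qed

section \<open>Complex embeddings of a ring of finite rank\<close>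

lemma complex_homs_ring_hom: "h \<in> complex_homs R \<Longrightarrow> h \<in> ring_hom R (ring_of_type_algebra :: complex ring)"
  by (simp add: complex_homs_def)

lemma complex_homs_mult:
  "h \<in> complex_homs R \<Longrightarrow> x \<in> carrier R \<Longrightarrow> y \<in> carrier R \<Longrightarrow> h (x \<otimes>\<^bsub>R\<^esub> y) = h x * h y"
  using ring_hom_mult[OF complex_homs_ring_hom] by (fastforce simp: ring_of_type_algebra_def)

lemma complex_homs_add:
  "h \<in> complex_homs R \<Longrightarrow> x \<in> carrier R \<Longrightarrow> y \<in> carrier R \<Longrightarrow> h (x \<oplus>\<^bsub>R\<^esub> y) = h x + h y"
  using ring_hom_add[OF complex_homs_ring_hom] by (fastforce simp: ring_of_type_algebra_def)

lemma complex_homs_one: "h \<in> complex_homs R \<Longrightarrow> h \<one>\<^bsub>R\<^esub> = 1"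
  using ring_hom_one[OF complex_homs_ring_hom] by (fastforce simp: ring_of_type_algebra_def)

lemma complex_homsI:
  assumes "h \<in> extensional (carrier R)"
    and "\<And>x y. x \<in> carrier R \<Longrightarrow> y \<in> carrier R \<Longrightarrow> h (x \<otimes>\<^bsub>R\<^esub> y) = h x * h y"
    and "\<And>x y. x \<in> carrier R \<Longrightarrow> y \<in> carrier R \<Longrightarrow> h (x \<oplus>\<^bsub>R\<^esub> y) = h x + h y"
    and "h \<one>\<^bsub>R\<^esub> = 1"
  shows "h \<in> complex_homs R"
  using assms by (auto simp: complex_homs_def ring_hom_def ring_of_type_algebra_def)

context cring
begin

lemma complex_homs_zero: "h \<in> complex_homs R \<Longrightarrow> h \<zero> = 0"
  using complex_homs_add[of h R \<zero> \<zero>] by simp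

lemma complex_homs_int_pow:
  assumes h: "h \<in> complex_homs R" and x: "x \<in> carrier R"
  shows "h ([(k::int)] \<cdot> x) = of_int k * h x"
proof (induction k rule: int_induct[where k = 0])
  case base
  have "[(0::int)] \<cdot> x = \<zero>"
    by (simp add: add_pow_def int_pow_def)
  then show ?case using h by (simp add: complex_homs_zero)
next
  case (step1 i)
  have "[(i + 1)] \<cdot> x = [i] \<cdot> x \<oplus> x"
    using add.int_pow_mult[OF x, of i 1] x by simp
  then show ?case
    using step1 complex_homs_add[OF h, of "[i] \<cdot> x" x] x by (simp add: algebra_simps)
next
  case (step2 i)
  have "[i] \<cdot> x = [(i - 1)] \<cdot> x \<oplus> x"
    using add.int_pow_mult[OF x, of "i - 1" 1] x by simp
  then show ?case
    using step2 complex_homs_add[OF h, of "[(i - 1)] \<cdot> x" x] x by (simp add: algebra_simps)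
qed

lemma complex_homs_finsum:
  assumes h: "h \<in> complex_homs R" and "finite A" "g \<in> A \<rightarrow> carrier R"
  shows "h (\<Oplus>i\<in>A. g i) = (\<Sum>i\<in>A. h (g i))"
  using assms(2,3)
proof (induction A rule: finite_induct)
  case empty
  then show ?case using h by (simp add: complex_homs_zero)
next
  case (insert a A)
  then have "h (\<Oplus>i\<in>insert a A. g i) = h (g a \<oplus> (\<Oplus>i\<in>A. g i))"
    by (subst finsum_insert) auto
  also have "\<dots> = h (g a) + h (\<Oplus>i\<in>A. g i)"
    using insert by (intro complex_homs_add[OF h] finsum_closed) auto
  finally show ?case using insert by auto
qed

text \<open>Dedekind's independence of characters. Subtracting \<open>k y\<close> times the relation
  at x from the relation at the product of x and y removes \<open>k\<close> and leaves the
  coefficients \<open>a h * (h y - k y)\<close>. Since \<open>h\<close> and \<open>k\<close> differ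
  at some y, the induction hypothesis gives \<open>a h = 0\<close>; evaluation at 1 then gives
  \<open>a k = 0\<close>.\<close>

lemma complex_homs_independent:
  assumes "finite H" "H \<subseteq> complex_homs R" "\<And>x. x \<in> carrier R \<Longrightarrow> (\<Sum>h\<in>H. a h * h x) = 0"
  shows "\<forall>h\<in>H. a h = 0"
  using assms
proof (induction H arbitrary: a rule: finite_induct)
  case empty
  then show ?case by simp
next
  case (insert k H)
  have "\<forall>h\<in>H. a h * (h y - k y) = 0" if y: "y \<in> carrier R" for y
  proof (rule insert.IH)
    show "H \<subseteq> complex_homs R" using insert by auto
    fix x assume x: "x \<in> carrier R"
    have "a k * k x + (\<Sum>h\<in>H. a h * h x) = 0"
      using insert.prems(2)[OF x] insert.hyps by simp
    then have 1: "k y * (a k * k x + (\<Sum>h\<in>H. a h * h x)) = 0" by simp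
    have 2: "a k * (k x * k y) + (\<Sum>h\<in>H. a h * (h x * h y)) = 0"
    proof -
      have "a k * k (x \<otimes> y) + (\<Sum>h\<in>H. a h * h (x \<otimes> y)) = 0"
        using insert.prems(2)[of "x \<otimes> y"] insert.hyps x y by simp
      moreover have "(\<Sum>h\<in>H. a h * h (x \<otimes> y)) = (\<Sum>h\<in>H. a h * (h x * h y))"
        using insert.prems(1) x y by (intro sum.cong) (auto simp: complex_homs_mult)
      ultimately show ?thesis
        using insert.prems(1) x y by (simp add: complex_homs_mult)
    qed
    have "(\<Sum>h\<in>H. a h * (h y - k y) * h x) = (\<Sum>h\<in>H. a h * (h x * h y)) - k y * (\<Sum>h\<in>H. a h * h x)"
      by (simp add: sum_distrib_left algebra_simps flip: sum_subtractf)
    also have "\<dots> = 0"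
      using 1 2 by (simp add: algebra_simps) (metis add_left_imp_eq)
    finally show "(\<Sum>h\<in>H. a h * (h y - k y) * h x) = 0" .
  qed
  then have *: "a h * (h y - k y) = 0" if "h \<in> H" "y \<in> carrier R" for h y
    using that by blast
  have "a h = 0" if h: "h \<in> H" for h
  proof (rule ccontr)
    assume "a h \<noteq> 0"
    then have "h y = k y" if "y \<in> carrier R" for y using *[OF h that] by simp
    moreover have "h \<in> extensional (carrier R)" "k \<in> extensional (carrier R)"
      using insert.prems(1) h by (auto simp: complex_homs_def)
    ultimately have "h = k" by (rule extensionalityI[rotated 2])
    then show False using h insert.hyps by simp
  qed
  moreover have "a k * k \<one> = 0"
    using insert.prems(2)[of \<one>] insert.hyps calculation by simp
  ultimately show ?case
    using insert.prems(1) by (simp add: complex_homs_one)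
qed

end

section \<open>The matrix of embeddings and the discriminant\<close>

lemma det_nz_inj:
  fixes A :: "complex ^ 'n ^ 'n::finite"
  assumes "det A \<noteq> 0" "A *v x = A *v y"
  shows "x = y"
proof -
  obtain B where "B ** A = mat 1"
    using assms(1) invertible_det_nz invertible_left_inverse by blast
  then show ?thesis
    using arg_cong[OF assms(2), of "\<lambda>v. B *v v"] by (simp add: matrix_vector_mul_assoc)
qed

lemma det_nz_surj:
  fixes A :: "complex ^ 'n ^ 'n::finite"
  assumes "det A \<noteq> 0"
  obtains x where "A *v x = y"
proof -
  obtain B where "A ** B = mat 1"
    using assms(1) invertible_det_nz invertible_right_inverse by blast
  then have "A *v (B *v y) = y" by (simp add: matrix_vector_mul_assoc)
  then show ?thesis using that by blast
qed

locale based_ring = cring R for R :: "('a, 'm) ring_scheme" (structure) +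
  fixes b :: "'n::finite \<Rightarrow> 'a"
  assumes basis: "is_int_basis R b"
begin

lemma basis_closed [simp, intro]: "b i \<in> carrier R"
  using basis by (auto simp: is_int_basis_def)

lemma int_comb_closed [simp, intro]: "int_comb R b c \<in> carrier R"
  by (auto simp: int_comb_def intro!: finsum_closed)

lemma int_comb_coords [simp]: "x \<in> carrier R \<Longrightarrow> int_comb R b (coords R b x) = x"
  using basis unfolding is_int_basis_def coords_def
  by (metis bij_betw_def f_the_inv_into_f)

lemma coords_int_comb [simp]: "coords R b (int_comb R b c) = c"
  using basis unfolding is_int_basis_def coords_def
  by (metis UNIV_I bij_betw_def the_inv_into_f_f)

lemma int_comb_inject: "int_comb R b c = int_comb R b d \<longleftrightarrow> c = d"
  by (metis coords_int_comb)

lemma hom_int_comb: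
  "h \<in> complex_homs R \<Longrightarrow> h (int_comb R b c) = (\<Sum>j\<in>UNIV. of_int (c $ j) * h (b j))"
  unfolding int_comb_def by (subst complex_homs_finsum) (auto simp: complex_homs_int_pow)

lemma hom_coords:
  "h \<in> complex_homs R \<Longrightarrow> x \<in> carrier R \<Longrightarrow> h x = (\<Sum>j\<in>UNIV. of_int (coords R b x $ j) * h (b j))"
  by (metis hom_int_comb int_comb_coords)

end

definition emb_matrix :: "('n \<Rightarrow> 'a) \<Rightarrow> ('n \<Rightarrow> 'a \<Rightarrow> complex) \<Rightarrow> complex ^ 'n ^ 'n" where
  "emb_matrix b \<sigma> = (\<chi> i j. \<sigma> i (b j))"

definition cvec :: "int ^ 'n \<Rightarrow> complex ^ 'n" where
  "cvec x = (\<chi> i. of_int (x $ i))"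

definition cmat :: "int ^ 'n ^ 'm \<Rightarrow> complex ^ 'n ^ 'm" where
  "cmat A = (\<chi> i j. of_int (A $ i $ j))"

lemma cvec_inject [simp]: "cvec x = cvec y \<longleftrightarrow> x = y"
  by (simp add: cvec_def vec_eq_iff)

lemma det_cmat: "det (cmat A) = of_int (det A)"
  by (simp add: cmat_def of_int_det)

text \<open>Nondegeneracy is carried as the existence of exactly as many homomorphisms as the rank.
  Indexing them by the index type of the basis makes the matrix of embeddings square.\<close>

locale emb_ring = based_ring R b for R :: "('a, 'm) ring_scheme" (structure) and b :: "'n::finite \<Rightarrow> 'a" +
  fixes \<sigma> :: "'n \<Rightarrow> 'a \<Rightarrow> complex"
  assumes homs: "bij_betw \<sigma> UNIV (complex_homs R)"
begin

lemma sigma_hom [simp, intro]: "\<sigma> i \<in> complex_homs R"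
  using homs by (auto simp: bij_betw_def)

lemmas sigma_mult = complex_homs_mult[OF sigma_hom]
lemmas sigma_add = complex_homs_add[OF sigma_hom]
lemmas sigma_one = complex_homs_one[OF sigma_hom]
lemmas sigma_int_pow = complex_homs_int_pow[OF sigma_hom]
lemmas sigma_int_comb = hom_int_comb[OF sigma_hom]
lemmas sigma_coords = hom_coords[OF sigma_hom]

abbreviation S :: "complex ^ 'n ^ 'n" where "S \<equiv> emb_matrix b \<sigma>"

lemma S_cvec: "(S *v cvec c) $ i = \<sigma> i (int_comb R b c)"
  by (simp add: matrix_vector_mult_def emb_matrix_def cvec_def sigma_int_comb mult.commute)

lemma inj_sigma: "inj \<sigma>"
  using homs by (simp add: bij_betw_def)

text \<open>A vector in the left kernel is a linear relation between the homomorphisms on the basis,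
  hence on the whole ring, against Dedekind independence.\<close>

lemma det_S: "det S \<noteq> 0"
proof
  assume "det S = 0"
  then have "det (transpose S) = 0" by (simp add: det_transpose)
  then obtain a where a: "a \<noteq> 0" "transpose S *v a = 0"
    using invertible_det_nz[of "transpose S"] matrix_left_invertible_ker[of "transpose S"]
      invertible_left_inverse[of "transpose S"] by auto
  have *: "(\<Sum>i\<in>UNIV. a $ i * \<sigma> i (b j)) = 0" for j
    using a(2) by (simp add: vec_eq_iff matrix_vector_mult_def transpose_def emb_matrix_def mult.commute)
  have "(\<Sum>h\<in>complex_homs R. a $ (inv_into UNIV \<sigma> h) * h x) = 0" if x: "x \<in> carrier R" for x
  proof -
    have "(\<Sum>h\<in>complex_homs R. a $ (inv_into UNIV \<sigma> h) * h x) = (\<Sum>i\<in>UNIV. a $ i * \<sigma> i x)"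
      by (subst sum.reindex_bij_betw[OF homs, symmetric]) (simp add: inj_sigma)
    also have "\<dots> = (\<Sum>i\<in>UNIV. \<Sum>j\<in>UNIV. of_int (coords R b x $ j) * (a $ i * \<sigma> i (b j)))"
      by (simp add: sigma_coords[OF x] sum_distrib_left algebra_simps)
    also have "\<dots> = (\<Sum>j\<in>UNIV. of_int (coords R b x $ j) * (\<Sum>i\<in>UNIV. a $ i * \<sigma> i (b j)))"
      by (subst sum.swap) (simp add: sum_distrib_left)
    finally show ?thesis by (simp add: *)
  qed
  moreover have "finite (complex_homs R)"
    using bij_betw_finite[OF homs] by simp
  ultimately have "\<forall>h\<in>complex_homs R. a $ (inv_into UNIV \<sigma> h) = 0"
    by (intro complex_homs_independent) auto
  then have "a $ i = 0" for i
    using sigma_hom[of i] inv_f_f[OF inj_sigma, of i] by fastforce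
  then show False using a(1) by (simp add: vec_eq_iff)
qed

text \<open>This is the standard way in which identities in the ring are proved below: they are
  checked in every embedding.\<close>

lemma sigma_eqI:
  assumes "x \<in> carrier R" "y \<in> carrier R" "\<And>i. \<sigma> i x = \<sigma> i y"
  shows "x = y"
proof -
  have "S *v cvec (coords R b x) = S *v cvec (coords R b y)"
    using assms by (simp add: vec_eq_iff S_cvec)
  then show ?thesis
    using det_nz_inj[OF det_S] assms by (metis cvec_inject int_comb_coords)
qed

text \<open>The coefficients \<open>z j\<close> are only assumed complex; invertibility of the
  matrix of embeddings forces them to be the integral coordinates.\<close>

lemma coords_unique:
  assumes "x \<in> carrier R" "\<And>i. \<sigma> i x = (\<Sum>j\<in>UNIV. z j * \<sigma> i (b j))"
  shows "z j = of_int (coords R b x $ j)"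
proof -
  have "S *v (\<chi> j. z j) = S *v cvec (coords R b x)"
    unfolding vec_eq_iff S_cvec using assms
    by (simp add: matrix_vector_mult_def emb_matrix_def mult.commute)
  from det_nz_inj[OF det_S this] show ?thesis
    by (simp add: vec_eq_iff cvec_def)
qed

lemma lin_indep:
  assumes "\<And>i. (\<Sum>j\<in>UNIV. z j * \<sigma> i (b j)) = (\<Sum>j\<in>UNIV. w j * \<sigma> i (b j))"
  shows "z j = w j"
proof -
  have "S *v (\<chi> j. z j) = S *v (\<chi> j. w j)"
    unfolding vec_eq_iff using assms
    by (simp add: matrix_vector_mult_def emb_matrix_def mult.commute)
  from det_nz_inj[OF det_S this] show ?thesis
    by (simp add: vec_eq_iff)
qed

text \<open>The matrix of embeddings conjugates the matrix of multiplication by x into the diagonal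
  matrix of the conjugates of x, and traces are invariant under conjugation.\<close>

lemma trace_wrt_eq:
  assumes x: "x \<in> carrier R"
  shows "of_int (trace_wrt R b x) = (\<Sum>i\<in>UNIV. \<sigma> i x)"
proof -
  define M :: "complex ^ 'n ^ 'n" where "M = (\<chi> j k. of_int (coords R b (x \<otimes> b k) $ j))"
  define D :: "complex ^ 'n ^ 'n" where "D = (\<chi> i j. if i = j then \<sigma> i x else 0)"
  have "S ** M = D ** S"
  proof -
    have "(S ** M) $ i $ k = \<sigma> i (x \<otimes> b k)" for i k
      using sigma_coords[of "x \<otimes> b k" i] x
      by (simp add: M_def matrix_matrix_mult_def emb_matrix_def mult.commute)
    moreover have "(D ** S) $ i $ k = \<sigma> i (x \<otimes> b k)" for i k
      using x by (simp add: D_def matrix_matrix_mult_def emb_matrix_def sigma_mult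
          if_distrib[of "\<lambda>a. a * _"] cong: if_cong)
    ultimately show ?thesis by (simp add: vec_eq_iff)
  qed
  moreover obtain B where B: "B ** S = mat 1" "S ** B = mat 1"
    using det_S invertible_det_nz unfolding invertible_def by blast
  ultimately have "M = B ** (D ** S)"
    by (metis matrix_mul_assoc matrix_mul_lid)
  then have "trace M = trace (D ** S ** B)"
    using trace_mul_sym[of B "D ** S"] by simp
  also have "\<dots> = trace D"
    unfolding matrix_mul_assoc[symmetric] B matrix_mul_rid ..
  finally show ?thesis
    by (simp add: trace_wrt_def trace_def M_def D_def)
qed

lemma disc_wrt_eq: "of_int (disc_wrt R b) = (det S)\<^sup>2"
proof -
  have "of_int (disc_wrt R b) = det (\<chi> i j. \<Sum>k\<in>UNIV. \<sigma> k (b i) * \<sigma> k (b j))"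
    unfolding disc_wrt_def of_int_det by (simp add: trace_wrt_eq sigma_mult)
  also have "(\<chi> i j. \<Sum>k\<in>UNIV. \<sigma> k (b i) * \<sigma> k (b j)) = transpose S ** S"
    by (simp add: transpose_def matrix_matrix_mult_def emb_matrix_def)
  finally show ?thesis
    by (simp add: det_mul det_transpose power2_eq_square)
qed

lemma change_basis:
  assumes "is_int_basis R b'"
  shows "emb_ring R b' \<sigma>"
  by (intro emb_ring.intro based_ring.intro emb_ring_axioms.intro based_ring_axioms.intro assms homs is_cring)

lemma emb_matrix_change:
  assumes "\<And>j. b' j \<in> carrier R"
  shows "emb_matrix b' \<sigma> = S ** cmat (\<chi> i j. coords R b (b' j) $ i)"
proof -
  have "emb_matrix b' \<sigma> $ i $ j = (S ** cmat (\<chi> i j. coords R b (b' j) $ i)) $ i $ j" for i j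
    using sigma_coords[OF assms[of j], of i]
    by (simp add: emb_matrix_def cmat_def matrix_matrix_mult_def mult.commute)
  then show ?thesis by (simp add: vec_eq_iff)
qed

text \<open>The two change-of-basis determinants are integers with product 1.\<close>

lemma det_emb_matrix_basis:
  assumes "is_int_basis R b'"
  shows "det (emb_matrix b' \<sigma>) = det S \<or> det (emb_matrix b' \<sigma>) = - det S"
proof -
  interpret B: emb_ring R b' \<sigma> by (rule change_basis[OF assms])
  obtain u :: int where u: "det (emb_matrix b' \<sigma>) = det S * of_int u"
    using emb_matrix_change[of b'] by (auto simp: det_mul det_cmat)
  obtain w :: int where w: "det S = det (emb_matrix b' \<sigma>) * of_int w"
    using B.emb_matrix_change[of b] by (auto simp: det_mul det_cmat)
  have "of_int (u * w) = (1::complex)"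
    using u w det_S by (simp add: mult.commute)
  then have "u * w = 1" by (metis of_int_eq_1_iff)
  then have "u = 1 \<or> u = - 1" by (metis zmult_eq_1_iff)
  then show ?thesis using u by auto
qed

lemma ring_disc_eq: "ring_disc TYPE('n) R = disc_wrt R b"
proof -
  have "disc_wrt R b' = disc_wrt R b" if "is_int_basis R b'" for b' :: "'n \<Rightarrow> 'a"
  proof -
    interpret B: emb_ring R b' \<sigma> by (rule change_basis[OF that])
    have "of_int (disc_wrt R b') = (of_int (disc_wrt R b) :: complex)"
      using det_emb_matrix_basis[OF that] by (auto simp: B.disc_wrt_eq disc_wrt_eq)
    then show ?thesis by simp
  qed
  then show ?thesis
    unfolding ring_disc_def using basis by (intro the_equality) (blast, metis)
qed

lemma ring_disc_det: "of_int (ring_disc TYPE('n) R) = (det S)\<^sup>2"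
  by (simp add: ring_disc_eq disc_wrt_eq)

lemma nondegenerate: "nondegenerate TYPE('n) R"
  using ring_disc_det det_S by (auto simp: nondegenerate_def)

lemma abs_ring_disc: "real_of_int \<bar>ring_disc TYPE('n) R\<bar> = (cmod (det S))\<^sup>2"
  unfolding norm_power[symmetric] ring_disc_det[symmetric] by simp

lemma det_replace_column:
  assumes "x \<in> carrier R"
  shows "det (\<chi> i k. if k = j then \<sigma> i x else \<sigma> i (b k)) = of_int (coords R b x $ j) * det S"
proof -
  have "(\<chi> i k. if k = j then \<sigma> i x else \<sigma> i (b k)) =
    (\<chi> i k. if k = j then (S *v cvec (coords R b x)) $ i else S $ i $ k)"
    using assms unfolding S_cvec vec_eq_iff by (auto simp: emb_matrix_def)
  then show ?thesis
    using cramer_lemma[of j S "cvec (coords R b x)"] by (simp add: cvec_def)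
qed

text \<open>Cramer's rule: coordinate j times \<open>det S\<close> is the determinant whose column j
  holds the embeddings of x. Its size is governed by m and by the bounds for the other columns, so a
  coordinate must vanish once the right-hand side drops below \<open>cmod (det S)\<close>.\<close>

lemma coords_bound:
  assumes x: "x \<in> carrier R" and M: "\<And>i k. cmod (\<sigma> i (b k)) \<le> M k" and m: "\<And>i. cmod (\<sigma> i x) \<le> m"
  shows "real_of_int \<bar>coords R b x $ j\<bar> * cmod (det S) \<le> fact CARD('n) * (m * (\<Prod>k\<in>UNIV - {j}. M k))"
proof -
  have "real_of_int \<bar>coords R b x $ j\<bar> * cmod (det S) =
      cmod (det (\<chi> i k. if k = j then \<sigma> i x else \<sigma> i (b k)))"
    unfolding det_replace_column[OF x] by (simp add: norm_mult)
  also have "\<dots> \<le> fact CARD('n) * (\<Prod>k\<in>UNIV. if k = j then m else M k)"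
    by (rule norm_det_le) (simp add: M m)
  also have "(\<Prod>k\<in>UNIV. if k = j then m else M k) = m * (\<Prod>k\<in>UNIV - {j}. M k)"
    by (subst prod.remove[of _ j]) (auto intro!: arg_cong[where f = "(*) m"] prod.cong)
  finally show ?thesis .
qed

text \<open>Expressing the unit vectors through the generators gives an integral right inverse of
  their matrix. Hence its determinant is nonzero and n generators are independent.\<close>

lemma int_basis_of_generating:
  fixes \<beta> :: "'n \<Rightarrow> int ^ 'n"
  assumes "\<And>x. \<exists>c. x = (\<Sum>j\<in>UNIV. c j *s \<beta> j)"
  shows "is_int_basis R (\<lambda>j. int_comb R b (\<beta> j))"
proof -
  let ?b = "\<lambda>j::'n. int_comb R b (\<beta> j)"
  have sig: "\<sigma> i (int_comb R ?b c) = \<sigma> i (int_comb R b (\<Sum>j\<in>UNIV. (c $ j) *s \<beta> j))" for i c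
  proof -
    have "\<sigma> i (int_comb R ?b c) = (\<Sum>j\<in>UNIV. of_int (c $ j) * \<sigma> i (?b j))"
      unfolding int_comb_def[of R ?b]
      by (subst complex_homs_finsum[OF sigma_hom]) (auto simp: sigma_int_pow)
    also have "\<dots> = (\<Sum>j\<in>UNIV. \<Sum>k\<in>UNIV. of_int (c $ j) * (of_int (\<beta> j $ k) * \<sigma> i (b k)))"
      by (simp add: sigma_int_comb sum_distrib_left)
    also have "\<dots> = (\<Sum>k\<in>UNIV. \<Sum>j\<in>UNIV. of_int (c $ j) * (of_int (\<beta> j $ k) * \<sigma> i (b k)))"
      by (rule sum.swap)
    finally show ?thesis
      by (simp add: sigma_int_comb sum_distrib_right mult.assoc)
  qed
  have cl: "int_comb R ?b c \<in> carrier R" for c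
    unfolding int_comb_def[of R ?b] by (intro finsum_closed) auto
  have eq: "int_comb R ?b c = int_comb R b (\<Sum>j\<in>UNIV. (c $ j) *s \<beta> j)" for c
    by (intro sigma_eqI sig cl int_comb_closed)
  define B where "B = (\<chi> i j. \<beta> j $ i)"
  have mv: "B *v c = (\<Sum>j\<in>UNIV. (c $ j) *s \<beta> j)" for c
    by (simp add: vec_eq_iff B_def matrix_vector_mult_def mult.commute)
  have "\<forall>i. \<exists>c. axis i 1 = (\<Sum>j\<in>UNIV. c j *s \<beta> j)"
    using assms by blast
  then obtain C where C: "\<And>i. axis i 1 = (\<Sum>j\<in>UNIV. C i j *s \<beta> j)"
    unfolding choice_iff by blast
  have "B ** (\<chi> j i. C i j) = mat 1"
  proof -
    have "(B ** (\<chi> j i. C i j)) $ k $ i = mat 1 $ k $ i" for k i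
      using arg_cong[OF C[of i], of "\<lambda>v. v $ k"]
      by (simp add: B_def matrix_matrix_mult_def mat_def axis_def mult.commute)
    then show ?thesis by (simp add: vec_eq_iff)
  qed
  then have "det B * det (\<chi> j i. C i j) = 1"
    by (metis det_mul det_I)
  then have "det B \<noteq> 0" by auto
  have "inj (\<lambda>c. B *v c)"
  proof (rule injI)
    fix c d assume "B *v c = B *v d"
    then have "cmat B *v cvec c = cmat B *v cvec d"
    proof -
      have "(cmat B *v cvec c) = cvec (B *v c)" for c
        by (simp add: vec_eq_iff cmat_def cvec_def matrix_vector_mult_def)
      then show ?thesis using \<open>B *v c = B *v d\<close> by simp
    qed
    moreover have "det (cmat B) \<noteq> 0" using \<open>det B \<noteq> 0\<close> by (simp add: det_cmat)
    ultimately show "c = d" using det_nz_inj by (metis cvec_inject)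
  qed
  moreover have "surj (\<lambda>c. B *v c)"
  proof (rule surjI)
    fix x
    show "B *v (\<chi> j. (SOME c. x = (\<Sum>j\<in>UNIV. c j *s \<beta> j)) j) = x"
      using someI_ex[OF assms[of x]] by (simp add: mv)
  qed
  ultimately have "bij_betw (\<lambda>c. B *v c) UNIV UNIV"
    by (simp add: bij_def)
  moreover have "bij_betw (int_comb R b) UNIV (carrier R)"
    using basis by (simp add: is_int_basis_def)
  ultimately have "bij_betw (int_comb R b \<circ> (\<lambda>c. B *v c)) UNIV (carrier R)"
    by (rule bij_betw_trans)
  moreover have "int_comb R b \<circ> (\<lambda>c. B *v c) = int_comb R ?b"
    by (auto simp: eq mv)
  ultimately show ?thesis
    by (auto simp: is_int_basis_def)
qed

end

text \<open>There are no further homomorphisms: any other \<open>h\<close> agrees on the basis with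
  a linear combination of the \<sigma> i, as their matrix is invertible, and so violates Dedekind
  independence.\<close>

lemma (in based_ring) emb_ringI:
  fixes \<sigma> :: "'n \<Rightarrow> 'a \<Rightarrow> complex"
  assumes "\<And>i. \<sigma> i \<in> complex_homs R" and det: "det (emb_matrix b \<sigma>) \<noteq> 0"
  shows "emb_ring R b \<sigma>"
proof (intro emb_ring.intro emb_ring_axioms.intro based_ring_axioms)
  have inj: "inj \<sigma>"
  proof (rule injI)
    fix i j assume eq: "\<sigma> i = \<sigma> j"
    show "i = j"
    proof (rule ccontr)
      assume "i \<noteq> j"
      then have "det (emb_matrix b \<sigma>) = 0"
        by (rule det_identical_rows) (simp add: row_def emb_matrix_def eq)
      then show False using det by simp
    qed
  qed
  have "h \<in> range \<sigma>" if h: "h \<in> complex_homs R" for h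
  proof (rule ccontr)
    assume nh: "h \<notin> range \<sigma>"
    obtain a where a: "transpose (emb_matrix b \<sigma>) *v a = (\<chi> j. h (b j))"
      by (rule det_nz_surj[of "transpose (emb_matrix b \<sigma>)" "\<chi> j. h (b j)"]) (simp add: det_transpose det)
    have hb: "h (b j) = (\<Sum>i\<in>UNIV. a $ i * \<sigma> i (b j))" for j
      using arg_cong[OF a, of "\<lambda>v. v $ j"]
      by (simp add: matrix_vector_mult_def transpose_def emb_matrix_def mult.commute)
    define c where "c k = (if k = h then 1 else - a $ (inv_into UNIV \<sigma> k))" for k
    have "(\<Sum>k\<in>insert h (range \<sigma>). c k * k x) = 0" if x: "x \<in> carrier R" for x
    proof -
      have "(\<Sum>k\<in>insert h (range \<sigma>). c k * k x) = h x + (\<Sum>k\<in>range \<sigma>. c k * k x)"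
        using nh by (subst sum.insert) (auto simp: c_def)
      also have "(\<Sum>k\<in>range \<sigma>. c k * k x) = (\<Sum>k\<in>range \<sigma>. - a $ (inv_into UNIV \<sigma> k) * k x)"
        using nh by (intro sum.cong) (auto simp: c_def)
      also have "\<dots> = (\<Sum>i\<in>UNIV. - a $ i * \<sigma> i x)"
        by (subst sum.reindex[OF inj]) (simp add: inv_f_f[OF inj])
      also have "\<dots> = - (\<Sum>i\<in>UNIV. \<Sum>j\<in>UNIV. of_int (coords R b x $ j) * (a $ i * \<sigma> i (b j)))"
        using assms(1) by (simp add: hom_coords[OF _ x] sum_distrib_left sum_negf algebra_simps)
      also have "\<dots> = - (\<Sum>j\<in>UNIV. of_int (coords R b x $ j) * h (b j))"
        by (subst sum.swap) (simp add: hb sum_distrib_left)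
      also have "\<dots> = - h x"
        using hom_coords[OF h x] by simp
      finally show ?thesis by simp
    qed
    then have "\<forall>k\<in>insert h (range \<sigma>). c k = 0"
      using assms(1) h by (intro complex_homs_independent) auto
    then show False by (simp add: c_def)
  qed
  then show "bij_betw \<sigma> UNIV (complex_homs R)"
    using inj assms(1) by (auto simp: bij_betw_def)
qed

section \<open>Successive minima\<close>

context emb_ring
begin

lemma ring_length_eq:
  "ring_length TYPE('n) R x = sqrt (1 / real CARD('n) * (\<Sum>i\<in>UNIV. (cmod (\<sigma> i x))\<^sup>2))"
  unfolding ring_length_def by (subst sum.reindex_bij_betw[OF homs, symmetric]) simp

lemma ring_length_nonneg: "ring_length TYPE('n) R x \<ge> 0"
  unfolding ring_length_eq by (intro real_sqrt_ge_zero mult_nonneg_nonneg sum_nonneg) auto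

lemma ring_length_le:
  assumes "\<And>i. cmod (\<sigma> i x) \<le> M"
  shows "ring_length TYPE('n) R x \<le> M"
proof -
  have M: "M \<ge> 0" using assms[of undefined] norm_ge_zero order_trans by blast
  have "(\<Sum>i\<in>(UNIV::'n set). (cmod (\<sigma> i x))\<^sup>2) \<le> (\<Sum>i\<in>(UNIV::'n set). M\<^sup>2)"
    by (intro sum_mono power_mono assms) auto
  then have "1 / real CARD('n) * (\<Sum>i\<in>UNIV. (cmod (\<sigma> i x))\<^sup>2) \<le> M\<^sup>2"
    by (simp add: field_simps)
  then show ?thesis
    unfolding ring_length_eq using M by (intro real_le_lsqrt) auto
qed

lemma cmod_le_ring_length: "cmod (\<sigma> i x) \<le> sqrt (real CARD('n)) * ring_length TYPE('n) R x"
proof -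
  have "(cmod (\<sigma> i x))\<^sup>2 \<le> (\<Sum>i\<in>UNIV. (cmod (\<sigma> i x))\<^sup>2)"
    by (rule member_le_sum) auto
  then have "cmod (\<sigma> i x) \<le> sqrt (\<Sum>i\<in>UNIV. (cmod (\<sigma> i x))\<^sup>2)"
    by (rule real_le_rsqrt)
  also have "\<dots> = sqrt (real CARD('n)) * ring_length TYPE('n) R x"
    unfolding ring_length_eq by (simp add: real_sqrt_mult[symmetric])
  finally show ?thesis .
qed

text \<open>The inverse of the matrix of embeddings turns a bound on the length into a bound on the
  integral coordinates.\<close>

lemma finite_ring_length_le: "finite {x \<in> carrier R. ring_length TYPE('n) R x \<le> r}"
proof -
  obtain B where B: "B ** S = mat 1"
    using det_S invertible_det_nz invertible_left_inverse by blast
  define K where "K = (\<Sum>j\<in>UNIV. \<Sum>i\<in>UNIV. cmod (B $ j $ i)) * (sqrt (real CARD('n)) * r)"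
  have bd: "\<bar>coords R b x $ j\<bar> \<le> \<lceil>K\<rceil>" if x: "x \<in> carrier R" "ring_length TYPE('n) R x \<le> r" for x j
  proof -
    have r: "r \<ge> 0" using x(2) ring_length_nonneg order_trans by blast
    have "cvec (coords R b x) = B *v (S *v cvec (coords R b x))"
      by (simp add: matrix_vector_mul_assoc B)
    from arg_cong[OF this, of "\<lambda>v. v $ j"]
    have "of_int (coords R b x $ j) = (B *v (S *v cvec (coords R b x))) $ j"
      unfolding cvec_def by (simp only: vec_lambda_beta)
    also have "\<dots> = (\<Sum>i\<in>UNIV. B $ j $ i * \<sigma> i x)"
      using x(1) S_cvec[of "coords R b x"] by (simp add: matrix_vector_mult_def[of B])
    finally have e: "of_int (coords R b x $ j) = (\<Sum>i\<in>UNIV. B $ j $ i * \<sigma> i x)" .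
    have "cmod (\<sigma> i x) \<le> sqrt (real CARD('n)) * r" for i
      by (rule order_trans[OF cmod_le_ring_length mult_left_mono[OF x(2)]]) simp
    then have "cmod (of_int (coords R b x $ j)) \<le> (\<Sum>i\<in>UNIV. cmod (B $ j $ i) * (sqrt (real CARD('n)) * r))"
      unfolding e by (intro sum_norm_le) (simp add: norm_mult mult_left_mono)
    also have "\<dots> \<le> K"
      unfolding K_def sum_distrib_right[symmetric] using r
      by (intro mult_right_mono member_le_sum sum_nonneg) auto
    finally have "real_of_int \<bar>coords R b x $ j\<bar> \<le> K"
      by simp
    then show ?thesis
      using le_of_int_ceiling[of K] by linarith
  qed
  have "{x \<in> carrier R. ring_length TYPE('n) R x \<le> r} \<subseteq> int_comb R b ` {c. \<forall>i. \<bar>c $ i\<bar> \<le> \<lceil>K\<rceil>}"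
  proof
    fix x assume "x \<in> {x \<in> carrier R. ring_length TYPE('n) R x \<le> r}"
    then have "x = int_comb R b (coords R b x)" "coords R b x \<in> {c. \<forall>i. \<bar>c $ i\<bar> \<le> \<lceil>K\<rceil>}"
      using bd by auto
    then show "x \<in> int_comb R b ` {c. \<forall>i. \<bar>c $ i\<bar> \<le> \<lceil>K\<rceil>}" by blast
  qed
  then show ?thesis
    using finite_bounded_int_vec finite_surj by blast
qed

lemma int_independent_iff:
  assumes "finite I" "\<And>j. j \<in> I \<Longrightarrow> v j \<in> carrier R"
  shows "int_independent R I v \<longleftrightarrow>
    (\<forall>c. (\<Sum>j\<in>I. c j *s coords R b (v j)) = 0 \<longrightarrow> (\<forall>j\<in>I. c j = 0))"
proof -
  have fc: "(\<Oplus>j\<in>I. [c j] \<cdot> v j) \<in> carrier R" for c :: "nat \<Rightarrow> int"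
    using assms by (intro finsum_closed) auto
  have "\<sigma> i (\<Oplus>j\<in>I. [c j] \<cdot> v j) = \<sigma> i (int_comb R b (\<Sum>j\<in>I. c j *s coords R b (v j)))" for i and c :: "nat \<Rightarrow> int"
  proof -
    have "\<sigma> i (\<Oplus>j\<in>I. [c j] \<cdot> v j) = (\<Sum>j\<in>I. of_int (c j) * \<sigma> i (v j))"
      using assms by (subst complex_homs_finsum[OF sigma_hom]) (auto simp: sigma_int_pow)
    also have "\<dots> = (\<Sum>j\<in>I. \<Sum>k\<in>UNIV. of_int (c j) * (of_int (coords R b (v j) $ k) * \<sigma> i (b k)))"
      using assms by (simp add: sigma_coords[of "v _"] sum_distrib_left)
    also have "\<dots> = (\<Sum>k\<in>UNIV. \<Sum>j\<in>I. of_int (c j) * (of_int (coords R b (v j) $ k) * \<sigma> i (b k)))"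
      by (rule sum.swap)
    finally show ?thesis
      by (simp add: sigma_int_comb sum_distrib_right mult.assoc)
  qed
  then have eq: "(\<Oplus>j\<in>I. [c j] \<cdot> v j) = int_comb R b (\<Sum>j\<in>I. c j *s coords R b (v j))" for c :: "nat \<Rightarrow> int"
    by (intro sigma_eqI fc int_comb_closed) 
  have "int_comb R b 0 = \<zero>"
    by (intro sigma_eqI) (auto simp: sigma_int_comb complex_homs_zero)
  then have "int_comb R b x = \<zero> \<longleftrightarrow> x = 0" for x
    by (metis int_comb_inject)
  then show ?thesis
    unfolding int_independent_def eq by simp
qed

definition sm_witness :: "nat \<Rightarrow> (nat \<Rightarrow> 'a) \<Rightarrow> real \<Rightarrow> bool" where
  "sm_witness i v r \<longleftrightarrow> v \<in> {..i} \<rightarrow> carrier R \<and> int_independent R {..i} v \<and>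
     (\<forall>j\<in>{..i}. ring_length TYPE('n) R (v j) \<le> r)"

text \<open>The \<open>LEAST\<close> in \<open>succ_min\<close> ranges over the reals, so it is
  meaningful only if the minimum is attained. Witnesses below a given bound restrict to a finite set
  \<open>W\<close> of tuples, on which the maximal length \<open>m\<close> has a minimum.\<close>

lemma sm_witness_minimal:
  assumes "sm_witness i v r"
  shows "\<exists>r0. (\<exists>v. sm_witness i v r0) \<and> (\<forall>r v. sm_witness i v r \<longrightarrow> r0 \<le> r)"
proof -
  define F where "F = {x \<in> carrier R. ring_length TYPE('n) R x \<le> r}"
  define m where "m v = Max ((\<lambda>j. ring_length TYPE('n) R (v j)) ` {..i})" for v
  define W where "W = {w \<in> {..i} \<rightarrow>\<^sub>E F. int_independent R {..i} w}"
  have finW: "finite W"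
  proof -
    have "finite F" unfolding F_def by (rule finite_ring_length_le)
    then have "finite ({..i} \<rightarrow>\<^sub>E F)" by (intro finite_PiE) auto
    then show ?thesis unfolding W_def by simp
  qed
  have restr: "restrict w {..i} \<in> W \<and> m (restrict w {..i}) \<le> s" if "sm_witness i w s" "s \<le> r" for w s
  proof -
    have "int_independent R {..i} (restrict w {..i})"
    proof -
      have w: "\<And>j. j \<in> {..i} \<Longrightarrow> w j \<in> carrier R" "int_independent R {..i} w"
        using that(1) by (auto simp: sm_witness_def)
      have "(\<Sum>j\<in>{..i}. c j *s coords R b (restrict w {..i} j)) = (\<Sum>j\<in>{..i}. c j *s coords R b (w j))" for c
        by (intro sum.cong) auto
      then show ?thesis
        using w int_independent_iff[of "{..i}" w] int_independent_iff[of "{..i}" "restrict w {..i}"] by simp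
    qed
    then show ?thesis
      using that by (auto simp: W_def F_def m_def sm_witness_def Pi_iff extensional_def
          intro: order_trans)
  qed
  have wit: "sm_witness i w (m w)" if "w \<in> W" for w
    using that by (auto simp: W_def F_def m_def sm_witness_def Pi_iff PiE_iff intro!: Max_ge)
  have ne: "W \<noteq> {}" using restr[OF assms] by auto
  then obtain w0 where w0: "w0 \<in> W" "\<And>w. w \<in> W \<Longrightarrow> m w0 \<le> m w"
    using ex_min_if_finite[of "m ` W"] finW
    by (metis (no_types, lifting) arg_min_if_finite(1) arg_min_least)
  have "m w0 \<le> s" if "sm_witness i w s" for w s
  proof (cases "s \<le> r")
    case True
    then show ?thesis using restr[OF that] w0(2) order_trans by blast
  next
    case False
    then show ?thesis using restr[OF assms] w0(2) by (meson dual_order.trans linear order_refl)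
  qed
  then show ?thesis using wit[OF w0(1)] by blast
qed

lemma coords_basis: "coords R b (b j) = axis j 1"
  by (rule vec_eq_iff[THEN iffD2], rule allI, rule of_int_eq_iff[where 'a = complex, THEN iffD1],
      rule coords_unique[symmetric])
    (auto simp: axis_def if_distrib[of of_int] if_distrib[of "\<lambda>a. a * _"] cong: if_cong)

lemma basis_independent:
  assumes "inj_on e {..i}"
  shows "int_independent R {..i} (\<lambda>j. b (e j))"
proof (subst int_independent_iff, simp, simp, intro allI impI ballI)
  fix c :: "nat \<Rightarrow> int" and j
  assume 0: "(\<Sum>j\<in>{..i}. c j *s coords R b (b (e j))) = 0" and j: "j \<in> {..i}"
  have "0 = (\<Sum>k\<le>i. c k * axis (e k) 1 $ e j)"
    using arg_cong[OF 0, of "\<lambda>v. v $ e j"] by (simp add: coords_basis)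
  also have "\<dots> = (\<Sum>k\<le>i. if k = j then c k else 0)"
    using assms j by (intro sum.cong) (auto simp: axis_def inj_on_def)
  finally show "c j = 0" using j by simp
qed

lemma basis_witness:
  assumes "i < CARD('n)"
  shows "\<exists>v r. sm_witness i v r"
proof -
  obtain e where e: "bij_betw e {0..<CARD('n)} (UNIV::'n set)"
    using ex_bij_betw_nat_finite[of "UNIV::'n set"] by auto
  have "inj_on e {..i}"
    using e assms by (auto simp: bij_betw_def intro: inj_on_subset)
  then have "sm_witness i (\<lambda>j. b (e j)) (Max ((\<lambda>j. ring_length TYPE('n) R (b (e j))) ` {..i}))"
    using basis_independent by (auto simp: sm_witness_def)
  then show ?thesis by blast
qed

lemma succ_min_le:
  assumes "sm_witness i v r"
  shows "succ_min TYPE('n) R i \<le> r"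
proof -
  obtain r0 where r0: "\<exists>v. sm_witness i v r0" "\<forall>r v. sm_witness i v r \<longrightarrow> r0 \<le> r"
    using sm_witness_minimal[OF assms] by blast
  have "succ_min TYPE('n) R i = r0"
    unfolding succ_min_def using r0 unfolding sm_witness_def by (intro Least_equality) blast+
  then show ?thesis using r0 assms by blast
qed

lemma succ_min_witness:
  assumes "i < CARD('n)"
  shows "\<exists>v. sm_witness i v (succ_min TYPE('n) R i)"
proof -
  obtain r0 where r0: "\<exists>v. sm_witness i v r0" "\<forall>r v. sm_witness i v r \<longrightarrow> r0 \<le> r"
    using sm_witness_minimal basis_witness[OF assms] by blast
  have "succ_min TYPE('n) R i = r0"
    unfolding succ_min_def using r0 unfolding sm_witness_def by (intro Least_equality) blast+
  then show ?thesis using r0 by blast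
qed

lemma sm_witness_independent:
  assumes "sm_witness i v r" "(\<Sum>j\<in>{..i}. c j *s coords R b (v j)) = 0" "j \<le> i"
  shows "c j = 0"
proof -
  have "\<And>j. j \<in> {..i} \<Longrightarrow> v j \<in> carrier R" "int_independent R {..i} v"
    using assms(1) by (auto simp: sm_witness_def)
  then show ?thesis
    using assms(2,3) int_independent_iff[of "{..i}" v] by auto
qed

text \<open>For a family of full size, an integral kernel vector of the coordinate matrix would be
  an integral relation between its members.\<close>

lemma sm_witness_det:
  fixes e :: "'n \<Rightarrow> nat"
  assumes "bij_betw e UNIV {..i}" "sm_witness i v r"
  shows "det (\<chi> k c. coords R b (v (e c)) $ k) \<noteq> 0"
proof
  assume "det (\<chi> k c. coords R b (v (e c)) $ k) = 0"
  then obtain x where x: "x \<noteq> 0" "(\<chi> k c. coords R b (v (e c)) $ k) *v x = 0"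
    using int_kernel by blast
  let ?c = "\<lambda>j. x $ (inv_into UNIV e j)"
  have "(\<Sum>j\<in>{..i}. ?c j *s coords R b (v j)) = (\<Sum>k\<in>UNIV. x $ k *s coords R b (v (e k)))"
    using assms(1) by (subst sum.reindex_bij_betw[OF assms(1), symmetric]) (simp add: bij_betw_def)
  also have "\<dots> = 0"
    using x(2) by (simp add: vec_eq_iff matrix_vector_mult_def mult.commute)
  finally have "\<forall>j\<in>{..i}. ?c j = 0"
    using sm_witness_independent[OF assms(2)] by auto
  then have "x $ k = 0" for k
    using assms(1) by (auto simp: bij_betw_def dest!: bspec[of _ _ "e k"])
  then show False using x(1) by (simp add: vec_eq_iff)
qed

text \<open>Two integral multiples of one vector are dependent, so the first two members cannot both
  be multiples of \<open>u\<close>. With \<open>u\<close> the coordinates of 1 this yields a member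
  outside \<int>.\<close>

lemma sm_witness_nonscalar:
  assumes "sm_witness i v r" "i \<ge> 1"
  shows "\<exists>j\<le>i. j \<le> 1 \<and> (\<forall>k. coords R b (v j) \<noteq> k *s u)"
proof (rule ccontr)
  assume "\<not> ?thesis"
  then have "\<exists>k. coords R b (v 0) = k *s u" "\<exists>k. coords R b (v 1) = k *s u"
    using assms(2) by blast+
  then obtain k0 k1 where k: "coords R b (v 0) = k0 *s u" "coords R b (v 1) = k1 *s u"
    by blast
  have ind: "\<forall>j\<in>{..i}. c j = 0" if "(\<Sum>j\<in>{..i}. c j *s coords R b (v j)) = 0" for c
    using sm_witness_independent[OF assms(1) that] by auto
  have split: "(\<Sum>j\<in>{..i}. c j *s coords R b (v j)) = c 0 *s coords R b (v 0) + c 1 *s coords R b (v 1)"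
    if "\<And>j. j > 1 \<Longrightarrow> c j = 0" for c
  proof -
    have "(\<Sum>j\<in>{..i}. c j *s coords R b (v j)) = (\<Sum>j\<in>{0,1}. c j *s coords R b (v j))"
      using assms(2) that by (intro sum.mono_neutral_right) (auto simp: vec_eq_iff)
    then show ?thesis by simp
  qed
  have "k1 = 0 \<and> - k0 = 0"
  proof -
    have "\<forall>j\<in>{..i}. (\<lambda>j::nat. if j = 0 then k1 else if j = 1 then - k0 else 0) j = 0"
      by (rule ind, subst split) (auto simp: k[unfolded One_nat_def] vec_eq_iff)
    from bspec[OF this, of 0] bspec[OF this, of 1] show ?thesis
      using assms(2) by simp
  qed
  then have "\<forall>j\<in>{..i}. (\<lambda>j::nat. if j = 0 then 1 else 0 :: int) j = 0"
    by (intro ind, subst split) (auto simp: k vec_eq_iff)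
  from bspec[OF this, of 0] show False by simp
qed

end

section \<open>The resolvent map in coordinates\<close>

lemma exhaust_4_0: "i = 0 \<or> i = 1 \<or> i = 2 \<or> i = (3::4)"
  using UNIV_4_0 by blast

lemma exhaust_3_0: "i = 0 \<or> i = 1 \<or> i = (2::3)"
  using UNIV_3_0 by blast

definition pair_sum :: "(4 \<Rightarrow> complex) \<Rightarrow> 3 \<Rightarrow> complex" where
  "pair_sum s j = (if j = 0 then s 0 * s 1 + s 2 * s 3
     else if j = 1 then s 0 * s 2 + s 1 * s 3 else s 0 * s 3 + s 1 * s 2)"

text \<open>Replacing x by l + x or l - x changes the resolvent value by an amount independent of
  the pairing j, that is, by a scalar.\<close>

lemma pair_sum_shift:
  "t\<^sup>2 = 1 \<Longrightarrow> pair_sum (\<lambda>i. t * s i + l) j = pair_sum s j + t * l * (s 0 + s 1 + s 2 + s 3) + 2 * l\<^sup>2"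
  by (simp add: pair_sum_def power2_eq_square algebra_simps)
     (simp add: mult.assoc[symmetric])

lemma ne_4_0 [simp]: "(0::4) \<noteq> 1" "(0::4) \<noteq> 2" "(0::4) \<noteq> 3" "(1::4) \<noteq> 0" "(1::4) \<noteq> 2" "(1::4) \<noteq> 3"
    "(2::4) \<noteq> 0" "(2::4) \<noteq> 1" "(2::4) \<noteq> 3" "(3::4) \<noteq> 0" "(3::4) \<noteq> 1" "(3::4) \<noteq> 2"
  by simp_all

lemma ne_3_0 [simp]: "(0::3) \<noteq> 1" "(0::3) \<noteq> 2" "(1::3) \<noteq> 0" "(1::3) \<noteq> 2" "(2::3) \<noteq> 0" "(2::3) \<noteq> 1"
  by simp_all

text \<open>The homomorphism from S_4 to S_3 given by the action on the three pairings of four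
  indices: a transposition and its complementary one fix one pairing and exchange the other
  two.\<close>

lemma pair_sum_transpose:
  "\<exists>\<rho>. inj \<rho> \<and> (\<forall>s j. pair_sum (s \<circ> Transposition.transpose u v) j = pair_sum s (\<rho> j))"
proof -
  have *: "\<exists>\<rho>. inj \<rho> \<and> (\<forall>s j. pair_sum (s \<circ> Transposition.transpose u v) j = pair_sum s (\<rho> j))"
    if "\<forall>s. pair_sum (s \<circ> Transposition.transpose u v) 0 = pair_sum s (Transposition.transpose x y 0) \<and>
      pair_sum (s \<circ> Transposition.transpose u v) 1 = pair_sum s (Transposition.transpose x y 1) \<and>
      pair_sum (s \<circ> Transposition.transpose u v) 2 = pair_sum s (Transposition.transpose x y 2)" for x y
    using that by (intro exI[of _ "Transposition.transpose x y"]) (simp add: all_3_0)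
  note d = pair_sum_def Transposition.transpose_def mult.commute add.commute
  have "u = v \<or> (u = 0 \<and> v = 1 \<or> u = 1 \<and> v = 0 \<or> u = 2 \<and> v = 3 \<or> u = 3 \<and> v = 2) \<or>
    (u = 0 \<and> v = 2 \<or> u = 2 \<and> v = 0 \<or> u = 1 \<and> v = 3 \<or> u = 3 \<and> v = 1) \<or>
    (u = 0 \<and> v = 3 \<or> u = 3 \<and> v = 0 \<or> u = 1 \<and> v = 2 \<or> u = 2 \<and> v = 1)"
    using exhaust_4_0[of u] exhaust_4_0[of v] by (elim disjE) simp_all
  then show ?thesis
  proof (elim disjE)
    assume "u = v"
    then show ?thesis by (intro *[of 0 0]) simp
  qed ((rule *[of 1 2], simp add: d; fail) | (rule *[of 0 2], simp add: d; fail) | (rule *[of 0 1], simp add: d; fail))+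
qed

lemma pair_sum_permute:
  fixes \<pi> :: "4 \<Rightarrow> 4"
  assumes "inj \<pi>"
  shows "\<exists>\<rho>. inj \<rho> \<and> (\<forall>s j. pair_sum (s \<circ> \<pi>) j = pair_sum s (\<rho> j))"
proof -
  have "\<pi> permutes UNIV"
    using assms by (intro bij_imp_permutes) (simp_all add: bij_def finite_UNIV_inj_surj)
  then show ?thesis
  proof (induction \<pi> rule: permutes_induct[OF _ finite, consumes 1, case_names id swap])
    case id
    then show ?case by (intro exI[of _ id]) auto
  next
    case (swap u v p)
    then obtain \<rho> where \<rho>: "inj \<rho>" "\<And>s j. pair_sum (s \<circ> p) j = pair_sum s (\<rho> j)" by blast
    obtain \<rho>' where \<rho>': "inj \<rho>'" "\<And>s j. pair_sum (s \<circ> Transposition.transpose u v) j = pair_sum s (\<rho>' j)"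
      using pair_sum_transpose by blast
    show ?case
    proof (intro exI[of _ "\<rho>' \<circ> \<rho>"] conjI allI)
      show "inj (\<rho>' \<circ> \<rho>)" using \<rho>'(1) \<rho>(1) by (rule inj_compose)
      fix s j
      have "pair_sum (s \<circ> (Transposition.transpose u v \<circ> p)) j = pair_sum (s \<circ> Transposition.transpose u v) (\<rho> j)"
        unfolding comp_assoc[symmetric] by (rule \<rho>(2))
      also have "\<dots> = pair_sum s (\<rho>' (\<rho> j))" by (rule \<rho>'(2))
      finally show "pair_sum (s \<circ> (Transposition.transpose u v \<circ> p)) j = pair_sum s ((\<rho>' \<circ> \<rho>) j)"
        by simp
    qed
  qed
qed

text \<open>This identity expresses Bhargava's relation \<open>1 \<and> x \<and> y \<and> xy = \<plusminus> 1 \<and> \<phi>(x) \<and> \<phi>(y)\<close>.\<close>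

lemma resolvent_det_identity:
  "det4 (1, x0, y0, x0 * y0) (1, x1, y1, x1 * y1) (1, x2, y2, x2 * y2) (1, x3, y3, x3 * y3) =
   - (((x0 * x2 + x1 * x3) * (y0 * y3 + y1 * y2) - (x0 * x3 + x1 * x2) * (y0 * y2 + y1 * y3))
     - ((x0 * x1 + x2 * x3) * (y0 * y3 + y1 * y2) - (x0 * x3 + x1 * x2) * (y0 * y1 + y2 * y3))
     + ((x0 * x1 + x2 * x3) * (y0 * y2 + y1 * y3) - (x0 * x2 + x1 * x3) * (y0 * y1 + y2 * y3)))"
  for x0 :: "'a::comm_ring_1"
  unfolding det4_def by (simp add: algebra_simps)

text \<open>\<open>prod_det p X Y\<close> is \<open>det(X, Y, XY)\<close>, where the product is the one with structure constants
  \<open>p\<close> and the coordinate of \<open>1\<close> is dropped.\<close>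

definition prod_coord :: "(4 \<Rightarrow> 4 \<Rightarrow> 4 \<Rightarrow> int) \<Rightarrow> int \<Rightarrow> int \<Rightarrow> int \<Rightarrow> int \<Rightarrow> int \<Rightarrow> int \<Rightarrow> 4 \<Rightarrow> int" where
  "prod_coord p x1 x2 x3 y1 y2 y3 k =
     x1 * (y1 * p 1 1 k + y2 * p 1 2 k + y3 * p 1 3 k)
   + x2 * (y1 * p 2 1 k + y2 * p 2 2 k + y3 * p 2 3 k)
   + x3 * (y1 * p 3 1 k + y2 * p 3 2 k + y3 * p 3 3 k)"

definition prod_det :: "(4 \<Rightarrow> 4 \<Rightarrow> 4 \<Rightarrow> int) \<Rightarrow> int \<Rightarrow> int \<Rightarrow> int \<Rightarrow> int \<Rightarrow> int \<Rightarrow> int \<Rightarrow> int" where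
  "prod_det p x1 x2 x3 y1 y2 y3 =
     (x2 * y3 - x3 * y2) * prod_coord p x1 x2 x3 y1 y2 y3 1
   - (x1 * y3 - x3 * y1) * prod_coord p x1 x2 x3 y1 y2 y3 2
   + (x1 * y2 - x2 * y1) * prod_coord p x1 x2 x3 y1 y2 y3 3"

lemma prod_det_diff:
  "prod_det (\<lambda>i j k. p i j k - t * q i j k) x1 x2 x3 y1 y2 y3 =
   prod_det p x1 x2 x3 y1 y2 y3 - t * prod_det q x1 x2 x3 y1 y2 y3"
proof -
  have e: "prod_coord (\<lambda>i j k. p i j k - t * q i j k) x1 x2 x3 y1 y2 y3 k =
    prod_coord p x1 x2 x3 y1 y2 y3 k - t * prod_coord q x1 x2 x3 y1 y2 y3 k" for k
    unfolding prod_coord_def by (simp add: algebra_simps)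
  then show ?thesis
    unfolding prod_det_def e by (simp add: algebra_simps)
qed

text \<open>If det(X, Y, XY) vanishes identically, then XY = l(X) Y + l(Y) X modulo scalars for a
  linear functional l. This is exactly the change in the structure constants caused by translating
  the basis by integers. Evaluation at vectors with entries 0 and 1 isolates the individual
  constants.\<close>

lemma prod_det_kernel:
  assumes sym: "\<And>i j k. q i j k = q j i k"
    and zero: "\<And>x1 x2 x3 y1 y2 y3. prod_det q x1 x2 x3 y1 y2 y3 = 0"
  shows "\<exists>l. \<forall>i j k. i \<noteq> 0 \<longrightarrow> j \<noteq> 0 \<longrightarrow> k \<noteq> 0 \<longrightarrow>
    q i j k = (if j = k then l i else 0) + (if i = k then l j else 0)"
proof -
  note d = prod_det_def prod_coord_def
  have s: "q 2 1 k = q 1 2 k" "q 3 1 k = q 1 3 k" "q 3 2 k = q 2 3 k" for k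
    using sym by simp_all
  have 1: "q 1 2 3 = 0" "q 1 3 2 = 0" "q 2 3 1 = 0"
    using zero[of 1 0 0 0 1 0] zero[of 1 0 0 0 0 1] zero[of 0 1 0 0 0 1] by (simp_all add: d s)
  have 2: "q 1 3 3 = q 1 2 2" "q 2 3 3 = q 1 2 1" "q 2 3 2 = q 1 3 1"
    using zero[of 1 0 0 0 1 1] zero[of 0 1 0 1 0 1] zero[of 0 0 1 1 1 0] by (simp_all add: d s 1)
  have 3: "q 1 1 2 = 0" "q 1 1 3 = 0" "q 2 2 1 = 0" "q 2 2 3 = 0" "q 3 3 1 = 0" "q 3 3 2 = 0"
    using zero[of 1 0 1 1 0 0] zero[of 1 1 0 1 0 0] zero[of 0 1 1 0 1 0] zero[of 1 1 0 0 1 0]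
      zero[of 0 1 1 0 0 1] zero[of 1 0 1 0 0 1] by (simp_all add: d s 1)
  have 4: "q 1 1 1 = 2 * q 1 2 2" "q 2 2 2 = 2 * q 1 2 1" "q 3 3 3 = 2 * q 1 3 1"
    using zero[of 1 1 0 1 0 1] zero[of 1 1 0 0 1 1] zero[of 1 0 1 0 1 1] by (simp_all add: d s 1 2 3)
  define l :: "4 \<Rightarrow> int" where "l i = (if i = 1 then q 1 2 2 else if i = 2 then q 1 2 1 else q 1 3 1)" for i
  have "\<forall>i j k. i \<noteq> 0 \<longrightarrow> j \<noteq> 0 \<longrightarrow> k \<noteq> 0 \<longrightarrow>
    q i j k = (if j = k then l i else 0)
     + (if i = k then l j else 0)" (is "\<forall>i j k. _ \<longrightarrow> _ \<longrightarrow> _ \<longrightarrow> ?Q i j k")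
  proof (intro allI impI)
    fix i j k :: 4 assume "i \<noteq> 0" "j \<noteq> 0" "k \<noteq> 0"
    then have "i = 1 \<or> i = 2 \<or> i = 3" "j = 1 \<or> j = 2 \<or> j = 3" "k = 1 \<or> k = 2 \<or> k = 3"
      using exhaust_4_0 by blast+
    then show "?Q i j k"
      by (elim disjE; hypsubst) (simp_all add: l_def s 1 2 3 4)
  qed
  then show ?thesis by (rule exI[of _ l])
qed

text \<open>The homomorphisms are numbered so that \<phi> is literally \<open>pair_sum\<close>. As
  the discriminants are the squares of the two determinants, their equality appears as
  \<open>det_eq\<close>.\<close>

locale res_pair = R: emb_ring R b \<sigma> + C: emb_ring C c \<tau>
  for R :: "('a, 'm) ring_scheme" and b :: "4 \<Rightarrow> 'a" and \<sigma>
  and C :: "('b, 'k) ring_scheme" and c :: "3 \<Rightarrow> 'b" and \<tau> +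
  fixes \<phi> :: "'a \<Rightarrow> 'b"
  assumes phi_closed: "x \<in> carrier R \<Longrightarrow> \<phi> x \<in> carrier C"
    and phi: "x \<in> carrier R \<Longrightarrow> \<tau> j (\<phi> x) = pair_sum (\<lambda>i. \<sigma> i x) j"
    and det_eq: "det C.S = det R.S \<or> det C.S = - det R.S"
    and b0: "b 0 = \<one>\<^bsub>R\<^esub>" and c0: "c 0 = \<one>\<^bsub>C\<^esub>"
begin

definition p :: "4 \<Rightarrow> 4 \<Rightarrow> 4 \<Rightarrow> int" where
  "p i j k = coords R b (b i \<otimes>\<^bsub>R\<^esub> b j) $ k"

lemma p_sym: "p i j k = p j i k"
  unfolding p_def by (simp add: R.m_comm)

lemma sigma_b0 [simp]: "\<sigma> i (b 0) = 1"
  by (simp add: b0 R.sigma_one)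

lemma tau_c0 [simp]: "\<tau> i (c 0) = 1"
  by (simp add: c0 C.sigma_one)

lemma sigma_prod:
  "\<sigma> i (b j) * \<sigma> i (b k) = of_int (p j k 0) + of_int (p j k 1) * \<sigma> i (b 1)
     + of_int (p j k 2) * \<sigma> i (b 2) + of_int (p j k 3) * \<sigma> i (b 3)"
  using R.sigma_coords[of "b j \<otimes>\<^bsub>R\<^esub> b k" i] by (simp add: R.sigma_mult p_def sum_4_0)

lemma lin_indep_R:
  assumes "\<And>i. z0 + z1 * \<sigma> i (b 1) + z2 * \<sigma> i (b 2) + z3 * \<sigma> i (b 3) = 0"
  shows "z0 = 0 \<and> z1 = 0 \<and> z2 = 0 \<and> z3 = 0"
proof -
  define z where "z = (\<lambda>j::4. if j = 0 then z0 else if j = 1 then z1 else if j = 2 then z2 else z3)"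
  have "z j = (\<lambda>_. 0) j" for j
    by (rule R.lin_indep) (use assms in \<open>simp add: z_def sum_4_0\<close>)
  then have "z 0 = 0" "z 1 = 0" "z 2 = 0" "z 3 = 0" by auto
  then show ?thesis by (simp add: z_def)
qed

lemma lin_indep_C:
  assumes "\<And>i. z0 + z1 * \<tau> i (c 1) + z2 * \<tau> i (c 2) = 0"
  shows "z0 = 0 \<and> z1 = 0 \<and> z2 = 0"
proof -
  define z where "z = (\<lambda>j::3. if j = 0 then z0 else if j = 1 then z1 else z2)"
  have "z j = (\<lambda>_. 0) j" for j
    by (rule C.lin_indep) (use assms in \<open>simp add: z_def sum_3_0\<close>)
  then have "z 0 = 0" "z 1 = 0" "z 2 = 0" by auto
  then show ?thesis by (simp add: z_def)
qed

definition lc :: "int \<Rightarrow> int \<Rightarrow> int \<Rightarrow> 'a" where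
  "lc x y z = [x] \<cdot>\<^bsub>R\<^esub> b 1 \<oplus>\<^bsub>R\<^esub> [y] \<cdot>\<^bsub>R\<^esub> b 2 \<oplus>\<^bsub>R\<^esub> [z] \<cdot>\<^bsub>R\<^esub> b 3"

lemma lc_closed [simp]: "lc x y z \<in> carrier R"
  unfolding lc_def by (intro R.a_closed R.add.int_pow_closed) auto

lemma sigma_lc: "\<sigma> i (lc x y z) = of_int x * \<sigma> i (b 1) + of_int y * \<sigma> i (b 2) + of_int z * \<sigma> i (b 3)"
  unfolding lc_def by (simp add: R.sigma_add R.sigma_int_pow)

end

locale rep_pair = res_pair R b \<sigma> C c \<tau> \<phi>
  for R :: "('a, 'm) ring_scheme" and b :: "4 \<Rightarrow> 'a" and \<sigma>
  and C :: "('b, 'k) ring_scheme" and c :: "3 \<Rightarrow> 'b" and \<tau> and \<phi> +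
  fixes A B :: ternary_form
  assumes rep: "\<exists>k::int. \<phi> (lc x y z) =
     [k] \<cdot>\<^bsub>C\<^esub> \<one>\<^bsub>C\<^esub> \<oplus>\<^bsub>C\<^esub> [(A x y z)] \<cdot>\<^bsub>C\<^esub> c 1 \<oplus>\<^bsub>C\<^esub> [(B x y z)] \<cdot>\<^bsub>C\<^esub> c 2"
begin

lemma tau_phi_lc:
  "\<exists>k::int. \<forall>j. \<tau> j (\<phi> (lc x y z)) = of_int k + of_int (A x y z) * \<tau> j (c 1) + of_int (B x y z) * \<tau> j (c 2)"
proof -
  obtain k :: int where k: "\<phi> (lc x y z) =
     [k] \<cdot>\<^bsub>C\<^esub> \<one>\<^bsub>C\<^esub> \<oplus>\<^bsub>C\<^esub> [(A x y z)] \<cdot>\<^bsub>C\<^esub> c 1 \<oplus>\<^bsub>C\<^esub> [(B x y z)] \<cdot>\<^bsub>C\<^esub> c 2"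
    using rep by blast
  show ?thesis
    unfolding k by (intro exI[of _ k]) (simp add: C.sigma_add C.sigma_int_pow C.sigma_one)
qed

text \<open>\<open>N\<close> has the columns 1, x, y, xy and \<open>T\<close> the columns 1,
  \<phi>(x), \<phi>(y), read in the embeddings. Each is a matrix of embeddings times an integral
  matrix. \<open>resolvent_det_identity\<close> relates the two determinants, and those of the
  embedding matrices cancel up to sign.\<close>

lemma prod_det_eq:
  "\<exists>s. (s = 1 \<or> s = - 1) \<and> (\<forall>x1 x2 x3 y1 y2 y3.
     s * prod_det p x1 x2 x3 y1 y2 y3 = A x1 x2 x3 * B y1 y2 y3 - A y1 y2 y3 * B x1 x2 x3)"
proof -
  \<comment> \<open>The sign is opposite to that of the quotient of the two determinants because of
    the minus sign in \<open>resolvent_det_identity\<close>.\<close>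
  define s :: int where "s = (if det C.S = - det R.S then 1 else -1)"
  have s: "det C.S = - (of_int s * det R.S)"
    using det_eq by (auto simp: s_def)
  have "s * prod_det p x1 x2 x3 y1 y2 y3 = A x1 x2 x3 * B y1 y2 y3 - A y1 y2 y3 * B x1 x2 x3"
    for x1 x2 x3 y1 y2 y3
  proof -
    let ?x = "\<lambda>i. \<sigma> i (lc x1 x2 x3)" and ?y = "\<lambda>i. \<sigma> i (lc y1 y2 y3)"
    let ?P = "\<lambda>k. prod_coord p x1 x2 x3 y1 y2 y3 k"
    define N :: "complex ^ 4 ^ 4" where
      "N = (\<chi> i j. if j = 0 then 1 else if j = 1 then ?x i else if j = 2 then ?y i else ?x i * ?y i)"
    define M :: "int ^ 4 ^ 4" where
      "M = (\<chi> i j. if j = 0 then (if i = 0 then 1 else 0)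
        else if j = 1 then (if i = 0 then 0 else if i = 1 then x1 else if i = 2 then x2 else x3)
        else if j = 2 then (if i = 0 then 0 else if i = 1 then y1 else if i = 2 then y2 else y3)
        else ?P i)"
    have xy: "?x i * ?y i = of_int (?P 0) + of_int (?P 1) * \<sigma> i (b 1) + of_int (?P 2) * \<sigma> i (b 2) + of_int (?P 3) * \<sigma> i (b 3)" for i
    proof -
      have "?x i * ?y i =
        of_int x1 * (of_int y1 * (\<sigma> i (b 1) * \<sigma> i (b 1)) + of_int y2 * (\<sigma> i (b 1) * \<sigma> i (b 2)) + of_int y3 * (\<sigma> i (b 1) * \<sigma> i (b 3)))
      + of_int x2 * (of_int y1 * (\<sigma> i (b 2) * \<sigma> i (b 1)) + of_int y2 * (\<sigma> i (b 2) * \<sigma> i (b 2)) + of_int y3 * (\<sigma> i (b 2) * \<sigma> i (b 3)))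
      + of_int x3 * (of_int y1 * (\<sigma> i (b 3) * \<sigma> i (b 1)) + of_int y2 * (\<sigma> i (b 3) * \<sigma> i (b 2)) + of_int y3 * (\<sigma> i (b 3) * \<sigma> i (b 3)))"
        unfolding sigma_lc by (simp add: algebra_simps)
      then show ?thesis
        unfolding sigma_prod prod_coord_def by (simp add: algebra_simps)
    qed
    have "N = R.S ** cmat M"
    proof -
      have "N $ i $ j = (R.S ** cmat M) $ i $ j" for i j
        using exhaust_4_0[of j]
        by (elim disjE) (simp_all add: N_def M_def cmat_def emb_matrix_def matrix_matrix_mult_def sum_4_0 xy, simp_all add: sigma_lc mult.commute)
      then show ?thesis by (simp add: vec_eq_iff)
    qed
    then have dN: "det N = det R.S * of_int (prod_det p x1 x2 x3 y1 y2 y3)"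
      by (simp add: det_mul det_cmat) (simp add: M_def det_4_0 det4_def prod_det_def algebra_simps)
    obtain k :: int where k: "\<And>j. \<tau> j (\<phi> (lc x1 x2 x3)) = of_int k + of_int (A x1 x2 x3) * \<tau> j (c 1) + of_int (B x1 x2 x3) * \<tau> j (c 2)"
      using tau_phi_lc by blast
    obtain k' :: int where k': "\<And>j. \<tau> j (\<phi> (lc y1 y2 y3)) = of_int k' + of_int (A y1 y2 y3) * \<tau> j (c 1) + of_int (B y1 y2 y3) * \<tau> j (c 2)"
      using tau_phi_lc by blast
    define T :: "complex ^ 3 ^ 3" where
      "T = (\<chi> i j. if j = 0 then 1 else if j = 1 then \<tau> i (\<phi> (lc x1 x2 x3)) else \<tau> i (\<phi> (lc y1 y2 y3)))"
    define L :: "int ^ 3 ^ 3" where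
      "L = (\<chi> i j. if j = 0 then (if i = 0 then 1 else 0)
        else if j = 1 then (if i = 0 then k else if i = 1 then A x1 x2 x3 else B x1 x2 x3)
        else (if i = 0 then k' else if i = 1 then A y1 y2 y3 else B y1 y2 y3))"
    have "T = C.S ** cmat L"
    proof -
      have "T $ i $ j = (C.S ** cmat L) $ i $ j" for i j
        using exhaust_3_0[of j]
        by (elim disjE) (simp_all add: T_def L_def cmat_def emb_matrix_def matrix_matrix_mult_def sum_3_0 k k' mult.commute)
      then show ?thesis by (simp add: vec_eq_iff)
    qed
    then have dT: "det T = det C.S * of_int (A x1 x2 x3 * B y1 y2 y3 - A y1 y2 y3 * B x1 x2 x3)"
      by (simp add: det_mul det_cmat) (simp add: L_def det_3_0 algebra_simps)
    have "det N = - det T"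
    proof -
      have "det T = ((pair_sum ?x 1) * (pair_sum ?y 2) - pair_sum ?x 2 * pair_sum ?y 1)
         - (pair_sum ?x 0 * pair_sum ?y 2 - pair_sum ?x 2 * pair_sum ?y 0)
         + (pair_sum ?x 0 * pair_sum ?y 1 - pair_sum ?x 1 * pair_sum ?y 0)"
        by (simp add: T_def det_3_0 phi)
      moreover have "det N = det4 (1, ?x 0, ?y 0, ?x 0 * ?y 0) (1, ?x 1, ?y 1, ?x 1 * ?y 1)
          (1, ?x 2, ?y 2, ?x 2 * ?y 2) (1, ?x 3, ?y 3, ?x 3 * ?y 3)"
        by (simp add: N_def det_4_0)
      ultimately show ?thesis
        unfolding resolvent_det_identity by (simp add: pair_sum_def)
    qed
    then have "det R.S * of_int (prod_det p x1 x2 x3 y1 y2 y3) =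
      of_int s * det R.S * of_int (A x1 x2 x3 * B y1 y2 y3 - A y1 y2 y3 * B x1 x2 x3)"
      using dN dT s by simp
    then have "det R.S * of_int (prod_det p x1 x2 x3 y1 y2 y3) =
      det R.S * of_int (s * (A x1 x2 x3 * B y1 y2 y3 - A y1 y2 y3 * B x1 x2 x3))"
      by (simp add: mult.left_commute mult.assoc)
    then have "(of_int (prod_det p x1 x2 x3 y1 y2 y3) :: complex) =
      of_int (s * (A x1 x2 x3 * B y1 y2 y3 - A y1 y2 y3 * B x1 x2 x3))"
      using R.det_S by (metis mult_left_cancel)
    then have "prod_det p x1 x2 x3 y1 y2 y3 =
      s * (A x1 x2 x3 * B y1 y2 y3 - A y1 y2 y3 * B x1 x2 x3)"
      unfolding of_int_eq_iff .
    then show ?thesis by (auto simp: s_def)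
  qed
  moreover have "s = 1 \<or> s = - 1" by (simp add: s_def)
  ultimately show ?thesis by blast
qed

text \<open>Otherwise \<open>prod_det_kernel\<close> applies to the ring itself. After translation
  of the basis, a = b_1 - l_1 and d = b_2 - l_2 satisfy a a = m and a d = n with constants m, n.
  Then m d = n a, independence forces m = 0, and a vanishes in every embedding, which is
  impossible.\<close>

lemma forms_independent:
  "\<exists>x1 x2 x3 y1 y2 y3. A x1 x2 x3 * B y1 y2 y3 - A y1 y2 y3 * B x1 x2 x3 \<noteq> 0"
proof (rule ccontr)
  assume "\<not> ?thesis"
  then have z: "prod_det p x1 x2 x3 y1 y2 y3 = 0" for x1 x2 x3 y1 y2 y3
    using prod_det_eq by (metis mult_eq_0_iff one_neq_zero neg_equal_0_iff_equal)
  obtain l where l: "\<And>i j k. i \<noteq> 0 \<Longrightarrow> j \<noteq> 0 \<Longrightarrow> k \<noteq> 0 \<Longrightarrow>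
    p i j k = (if j = k then l i else 0) + (if i = k then l j else 0)"
    using prod_det_kernel[of p, OF p_sym z] by blast
  let ?a = "\<lambda>i. \<sigma> i (b 1) - of_int (l 1)" and ?d = "\<lambda>i. \<sigma> i (b 2) - of_int (l 2)"
  define m n :: complex where "m = of_int (p 1 1 0) + of_int (l 1 * l 1)"
    and "n = of_int (p 1 2 0) + of_int (l 1 * l 2)"
  have aa: "?a i * ?a i = m" and ad: "?a i * ?d i = n" for i
    using sigma_prod[of i 1 1] sigma_prod[of i 1 2] by (simp_all add: l m_def n_def algebra_simps)
  have "m * ?d i - n * ?a i = 0" for i
    unfolding aa[symmetric, of i] ad[symmetric, of i] by (simp add: algebra_simps)
  then have "(n * of_int (l 1) - m * of_int (l 2)) + (- n) * \<sigma> i (b 1) + m * \<sigma> i (b 2) + 0 * \<sigma> i (b 3) = 0" for i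
    by (simp add: algebra_simps)
  from lin_indep_R[OF this] have "m = 0" by simp
  then have "?a i = 0" for i using aa[of i] by simp
  then have "(- of_int (l 1)) + 1 * \<sigma> i (b 1) + 0 * \<sigma> i (b 2) + 0 * \<sigma> i (b 3) = 0" for i
    by (simp add: algebra_simps)
  from lin_indep_R[OF this] show False by simp
qed

end

section \<open>A pair is determined by its forms\<close>

lemma sum_rotate:
  "(\<Sum>j\<in>A. \<Sum>k\<in>B. \<Sum>m\<in>C. f j k m) = (\<Sum>m\<in>C. \<Sum>j\<in>A. \<Sum>k\<in>B. f j k m)"
  for f :: "_ \<Rightarrow> _ \<Rightarrow> _ \<Rightarrow> 'a::comm_monoid_add"
proof -
  have "(\<Sum>j\<in>A. \<Sum>k\<in>B. \<Sum>m\<in>C. f j k m) = (\<Sum>j\<in>A. \<Sum>m\<in>C. \<Sum>k\<in>B. f j k m)"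
    by (intro sum.cong refl sum.swap)
  also have "\<dots> = (\<Sum>m\<in>C. \<Sum>j\<in>A. \<Sum>k\<in>B. f j k m)"
    by (rule sum.swap)
  finally show ?thesis .
qed

locale two_rep_pairs = P: rep_pair R b \<sigma> C c \<tau> \<phi> A B + Q: rep_pair R' b' \<sigma>' C' c' \<tau>' \<phi>' A B
  for R :: "('a, 'm) ring_scheme" and b :: "4 \<Rightarrow> 'a" and \<sigma>
  and C :: "('b, 'k) ring_scheme" and c :: "3 \<Rightarrow> 'b" and \<tau> and \<phi>
  and R' :: "('c, 'n) ring_scheme" and b' :: "4 \<Rightarrow> 'c" and \<sigma>'
  and C' :: "('d, 'l) ring_scheme" and c' :: "3 \<Rightarrow> 'd" and \<tau>' and \<phi>'
  and A B
begin

text \<open>Both families of constants solve the same determinant identity up to signs, so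
  \<open>P.p - t * Q.p\<close> lies in the kernel described by \<open>prod_det_kernel\<close>. The
  sign \<open>t\<close> reflects that negating the basis elements other than 1 negates these
  constants.\<close>

lemma structure_constants:
  obtains t :: int and l :: "4 \<Rightarrow> int" where "t = 1 \<or> t = - 1"
    "\<And>i j k. i \<noteq> 0 \<Longrightarrow> j \<noteq> 0 \<Longrightarrow> k \<noteq> 0 \<Longrightarrow>
      P.p i j k = t * Q.p i j k + (if j = k then l i else 0) + (if i = k then l j else 0)"
proof -
  obtain s where s: "s = 1 \<or> s = - 1" "\<And>x1 x2 x3 y1 y2 y3.
     s * prod_det P.p x1 x2 x3 y1 y2 y3 = A x1 x2 x3 * B y1 y2 y3 - A y1 y2 y3 * B x1 x2 x3"
    using P.prod_det_eq by blast
  obtain s' where s': "s' = 1 \<or> s' = - 1" "\<And>x1 x2 x3 y1 y2 y3.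
     s' * prod_det Q.p x1 x2 x3 y1 y2 y3 = A x1 x2 x3 * B y1 y2 y3 - A y1 y2 y3 * B x1 x2 x3"
    using Q.prod_det_eq by blast
  let ?t = "s * s'"
  let ?q = "\<lambda>i j k. P.p i j k - ?t * Q.p i j k"
  have z: "prod_det ?q x1 x2 x3 y1 y2 y3 = 0" for x1 x2 x3 y1 y2 y3
  proof -
    have "s * prod_det P.p x1 x2 x3 y1 y2 y3 = s' * prod_det Q.p x1 x2 x3 y1 y2 y3"
      using s(2) s'(2) by simp
    then have "prod_det P.p x1 x2 x3 y1 y2 y3 = ?t * prod_det Q.p x1 x2 x3 y1 y2 y3"
      using s(1) s'(1) by auto
    then show ?thesis unfolding prod_det_diff by simp
  qed
  have sym: "?q i j k = ?q j i k" for i j k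
    using P.p_sym[of i j k] Q.p_sym[of i j k] by simp
  obtain l where l: "\<forall>i j k. i \<noteq> 0 \<longrightarrow> j \<noteq> 0 \<longrightarrow> k \<noteq> 0 \<longrightarrow>
    ?q i j k = (if j = k then l i else 0) + (if i = k then l j else 0)"
    using prod_det_kernel[of ?q, OF sym z] by blast
  show ?thesis
  proof (rule that)
    show "?t = 1 \<or> ?t = - 1" using s(1) s'(1) by auto
    fix i j k :: 4 assume "i \<noteq> 0" "j \<noteq> 0" "k \<noteq> 0"
    then have "?q i j k = (if j = k then l i else 0) + (if i = k then l j else 0)"
      using l by blast
    then show "P.p i j k = ?t * Q.p i j k + (if j = k then l i else 0) + (if i = k then l j else 0)"
      by linarith
  qed
qed

text \<open>The candidate sends b_j to \<open>b2 j\<close>, which is t b'_j + l_j. By the choice of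
  l the products agree up to scalar defects \<open>e j k\<close>, and it remains to show that these
  vanish.\<close>

lemma iso_R:
  obtains \<alpha> and t :: int and l :: "4 \<Rightarrow> int"
  where "\<alpha> \<in> ring_iso R R'" "t = 1 \<or> t = - 1"
    "\<And>i x y z. \<sigma>' i (\<alpha> (P.lc x y z)) =
       of_int t * \<sigma>' i (Q.lc x y z) + of_int (x * l 1 + y * l 2 + z * l 3)"
proof -
  obtain t :: int and l :: "4 \<Rightarrow> int" where t: "t = 1 \<or> t = - 1" and pq:
    "\<And>i j k. i \<noteq> 0 \<Longrightarrow> j \<noteq> 0 \<Longrightarrow> k \<noteq> 0 \<Longrightarrow>
      P.p i j k = t * Q.p i j k + (if j = k then l i else 0) + (if i = k then l j else 0)"
    using structure_constants by blast
  have tt: "t * t = 1" using t by auto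
  have ttc: "of_int t * of_int t = (1::complex)"
    using tt by (metis of_int_1 of_int_mult)
  define \<beta> :: "4 \<Rightarrow> int ^ 4" where
    "\<beta> j = (if j = 0 then axis 0 1 else t *s axis j 1 + l j *s axis 0 1)" for j
  define b2 where "b2 j = int_comb R' b' (\<beta> j)" for j
  have "\<exists>c. x = (\<Sum>j\<in>UNIV. c j *s \<beta> j)" for x
  proof -
    define c where "c j = (if j = 0 then x $ 0 - t * (x $ 1 * l 1 + x $ 2 * l 2 + x $ 3 * l 3) else t * x $ j)" for j
    have "x = (\<Sum>j\<in>UNIV. c j *s \<beta> j)"
      using t unfolding vec_eq_iff all_4_0 sum_4_0
      by (auto simp: c_def \<beta>_def axis_def algebra_simps)
    then show ?thesis by blast
  qed
  then have "is_int_basis R' b2"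
    unfolding b2_def by (rule Q.R.int_basis_of_generating)
  then interpret R2: emb_ring R' b2 \<sigma>' by (rule Q.R.change_basis)
  have sb2: "\<sigma>' i (b2 j) = (if j = 0 then 1 else of_int t * \<sigma>' i (b' j) + of_int (l j))" for i j
    using exhaust_4_0[of j] unfolding b2_def Q.R.sigma_int_comb sum_4_0
    by (elim disjE; hypsubst) (simp_all add: \<beta>_def axis_def)
  have tb': "\<sigma>' i (b' j) = of_int t * (\<sigma>' i (b2 j) - of_int (l j))" if "j \<noteq> 0" for i j
    using that ttc by (simp add: sb2 mult.assoc[symmetric])
  have ind: "z0 = 0 \<and> z1 = 0 \<and> z2 = 0 \<and> z3 = 0"
    if z: "\<And>i. z0 + z1 * \<sigma>' i (b2 1) + z2 * \<sigma>' i (b2 2) + z3 * \<sigma>' i (b2 3) = 0" for z0 z1 z2 z3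
  proof -
    define z where "z = (\<lambda>j::4. if j = 0 then z0 else if j = 1 then z1 else if j = 2 then z2 else z3)"
    have "z j = (\<lambda>_. 0) j" for j
      by (rule R2.lin_indep) (use z in \<open>simp add: z_def sum_4_0 sb2\<close>)
    then have "z 0 = 0" "z 1 = 0" "z 2 = 0" "z 3 = 0" by auto
    then show ?thesis by (simp add: z_def)
  qed
  define \<alpha> where "\<alpha> x = int_comb R' b2 (coords R b x)" for x
  define a where "a i x = \<sigma>' i (\<alpha> x)" for i x
  have a_eq: "a i x = (\<Sum>j\<in>UNIV. of_int (coords R b x $ j) * \<sigma>' i (b2 j))" for i x
    by (simp add: a_def \<alpha>_def R2.sigma_int_comb)
  have "\<exists>e::complex. \<forall>i. \<sigma>' i (b2 j) * \<sigma>' i (b2 k) = a i (b j \<otimes>\<^bsub>R\<^esub> b k) - e" for j k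
  proof -
    have ap: "a i (b j \<otimes>\<^bsub>R\<^esub> b k) = of_int (P.p j k 0) + of_int (P.p j k 1) * \<sigma>' i (b2 1) +
       of_int (P.p j k 2) * \<sigma>' i (b2 2) + of_int (P.p j k 3) * \<sigma>' i (b2 3)" for i
      by (simp add: a_eq P.p_def sum_4_0 sb2)
    consider "j = 0" | "k = 0" | "j \<noteq> 0" "k \<noteq> 0" by blast
    then show ?thesis
    proof cases
      case 1
      have "P.p j k m = (if k = m then 1 else 0)" for m
      proof -
        have "of_int (if k = m then 1 else 0) = (of_int (coords R b (b k) $ m) :: complex)"
          by (rule P.R.coords_unique) (auto simp: if_distrib[of of_int] if_distrib[of "\<lambda>a. a * _"] cong: if_cong)
        then show ?thesis using 1 by (simp add: P.p_def P.b0)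
      qed
      then show ?thesis using 1 exhaust_4_0[of k] unfolding ap
        by (intro exI[of _ 0]) (elim disjE; hypsubst; simp add: sb2)
    next
      case 2
      have "P.p j k m = (if j = m then 1 else 0)" for m
      proof -
        have "of_int (if j = m then 1 else 0) = (of_int (coords R b (b j) $ m) :: complex)"
          by (rule P.R.coords_unique) (auto simp: if_distrib[of of_int] if_distrib[of "\<lambda>a. a * _"] cong: if_cong)
        then show ?thesis using 2 by (simp add: P.p_def P.b0)
      qed
      then show ?thesis using 2 exhaust_4_0[of j] unfolding ap
        by (intro exI[of _ 0]) (elim disjE; hypsubst; simp add: sb2)
    next
      case 3
      \<comment> \<open>Substituting the definition of \<open>b2\<close> into the table of R', all
        terms in \<open>b2 1\<close>, \<open>b2 2\<close>, \<open>b2 3\<close> cancel by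
        \<open>pq\<close>. What is left is this constant, the same in every embedding.\<close>
      define E :: complex where "E = of_int (P.p j k 0) - of_int (Q.p j k 0) - of_int (l j * l k)
         + (of_int (P.p j k 1 * l 1) + of_int (P.p j k 2 * l 2) + of_int (P.p j k 3 * l 3))"
      have "a i (b j \<otimes>\<^bsub>R\<^esub> b k) - \<sigma>' i (b2 j) * \<sigma>' i (b2 k) = E" for i
      proof -
        have q: "of_int (Q.p j k m) = of_int t * (of_int (P.p j k m) - (if k = m then of_int (l j) else 0) - (if j = m then of_int (l k) else (0::complex)))" if "m \<noteq> 0" for m
          unfolding pq[OF 3 that] using ttc by (simp add: mult.assoc[symmetric])
        have prods: "\<sigma>' i (b2 j) * \<sigma>' i (b2 k) = \<sigma>' i (b' j) * \<sigma>' i (b' k) +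
           of_int (l k) * (of_int t * \<sigma>' i (b' j)) + of_int (l j) * (of_int t * \<sigma>' i (b' k)) + of_int (l j * l k)"
          using 3 ttc by (simp add: sb2 algebra_simps)
        have qp: "of_int (Q.p j k m) * \<sigma>' i (b' m) = (of_int (P.p j k m) - (if k = m then of_int (l j) else 0) - (if j = m then of_int (l k) else 0)) * (of_int t * \<sigma>' i (b' m))" if "m \<noteq> 0" for m
          unfolding q[OF that] by (simp add: mult_ac)
        have tb: "of_int t * \<sigma>' i (b' m) = \<sigma>' i (b2 m) - of_int (l m)" if "m \<noteq> 0" for m
          using that by (simp add: sb2)
        note j = exhaust_4_0[of j] and k = exhaust_4_0[of k]
        show ?thesis
          unfolding ap prods Q.sigma_prod[of i j k] qp[OF ne_4_0(4)] qp[OF ne_4_0(7)] qp[OF ne_4_0(10)] E_def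
          using 3 j k
          by (elim disjE; hypsubst) (simp_all add: tb algebra_simps)
      qed
      then show ?thesis by (intro exI[of _ E]) (simp add: algebra_simps)
    qed
  qed
  then obtain e where e: "\<And>i j k. \<sigma>' i (b2 j) * \<sigma>' i (b2 k) = a i (b j \<otimes>\<^bsub>R\<^esub> b k) - e j k"
    by metis
  define E where "E x y = (\<Sum>j\<in>UNIV. \<Sum>k\<in>UNIV. of_int (coords R b x $ j) * of_int (coords R b y $ k) * e j k)" for x y
  have mult: "a i x * a i y = a i (x \<otimes>\<^bsub>R\<^esub> y) - E x y" if xy: "x \<in> carrier R" "y \<in> carrier R" for i x y
  proof -
    have co: "coords R b (x \<otimes>\<^bsub>R\<^esub> y) $ m = (\<Sum>j\<in>UNIV. \<Sum>k\<in>UNIV. coords R b x $ j * coords R b y $ k * coords R b (b j \<otimes>\<^bsub>R\<^esub> b k) $ m)" (is "_ = ?r m") for m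
    proof -
      have "of_int (?r m) = (of_int (coords R b (x \<otimes>\<^bsub>R\<^esub> y) $ m) :: complex)"
      proof (rule P.R.coords_unique)
        fix i
        have "\<sigma> i (x \<otimes>\<^bsub>R\<^esub> y) = (\<Sum>j\<in>UNIV. of_int (coords R b x $ j) * \<sigma> i (b j)) * (\<Sum>k\<in>UNIV. of_int (coords R b y $ k) * \<sigma> i (b k))"
          using xy by (simp add: P.R.sigma_mult P.R.sigma_coords[of x] P.R.sigma_coords[of y])
        also have "\<dots> = (\<Sum>j\<in>UNIV. \<Sum>k\<in>UNIV. of_int (coords R b x $ j * coords R b y $ k) * \<sigma> i (b j \<otimes>\<^bsub>R\<^esub> b k))"
          by (simp add: sum_product P.R.sigma_mult algebra_simps)
        also have "\<dots> = (\<Sum>j\<in>UNIV. \<Sum>k\<in>UNIV. \<Sum>m\<in>UNIV. of_int (coords R b x $ j * coords R b y $ k * coords R b (b j \<otimes>\<^bsub>R\<^esub> b k) $ m) * \<sigma> i (b m))"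
          by (simp add: P.R.sigma_coords[of "b _ \<otimes>\<^bsub>R\<^esub> b _"] sum_distrib_left mult.assoc)
        also have "\<dots> = (\<Sum>m\<in>UNIV. of_int (?r m) * \<sigma> i (b m))"
          by (subst sum_rotate) (simp add: sum_distrib_right)
        finally show "\<sigma> i (x \<otimes>\<^bsub>R\<^esub> y) = (\<Sum>m\<in>UNIV. of_int (?r m) * \<sigma> i (b m))" .
      qed (use xy in auto)
      then show ?thesis by (simp only: of_int_eq_iff)
    qed
    have "a i (x \<otimes>\<^bsub>R\<^esub> y) = (\<Sum>m\<in>UNIV. \<Sum>j\<in>UNIV. \<Sum>k\<in>UNIV. of_int (coords R b x $ j) * of_int (coords R b y $ k) * (of_int (coords R b (b j \<otimes>\<^bsub>R\<^esub> b k) $ m) * \<sigma>' i (b2 m)))"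
      unfolding a_eq co by (simp add: sum_distrib_right mult.assoc)
    also have "\<dots> = (\<Sum>j\<in>UNIV. \<Sum>k\<in>UNIV. of_int (coords R b x $ j) * of_int (coords R b y $ k) * a i (b j \<otimes>\<^bsub>R\<^esub> b k))"
      unfolding a_eq by (subst sum_rotate[symmetric]) (simp add: sum_distrib_left)
    finally have "a i (x \<otimes>\<^bsub>R\<^esub> y) - E x y = (\<Sum>j\<in>UNIV. \<Sum>k\<in>UNIV. of_int (coords R b x $ j) * of_int (coords R b y $ k) * a i (b j \<otimes>\<^bsub>R\<^esub> b k)) - E x y"
      by simp
    also have "\<dots> = (\<Sum>j\<in>UNIV. \<Sum>k\<in>UNIV. of_int (coords R b x $ j) * of_int (coords R b y $ k) * (\<sigma>' i (b2 j) * \<sigma>' i (b2 k)))"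
      unfolding E_def e sum_subtractf[symmetric] right_diff_distrib ..
    also have "\<dots> = a i x * a i y"
      unfolding a_eq sum_product by (intro sum.cong refl) simp
    finally show ?thesis by simp
  qed
  have ab: "a i (b j) = \<sigma>' i (b2 j)" for i j
  proof -
    have "coords R b (b j) $ m = (if m = j then 1 else 0)" for m
    proof -
      have "of_int (if m = j then 1 else 0) = (of_int (coords R b (b j) $ m) :: complex)"
        by (rule P.R.coords_unique) (auto simp: if_distrib[of of_int] if_distrib[of "\<lambda>a. a * _"] cong: if_cong)
      then show ?thesis by simp
    qed
    then show ?thesis
      unfolding a_eq by (simp add: if_distrib[of of_int] if_distrib[of "\<lambda>a. a * _"] cong: if_cong)
  qed
  text \<open>Associativity forces the integers to vanish.\<close>
  have e0: "e j k = 0" for j k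
  proof (cases "j = 0")
    case True
    have "\<sigma>' i (b2 k) = a i (b k) - e 0 k" for i
      using e[of i 0 k] by (simp add: sb2 P.b0)
    then show ?thesis using True ab[of undefined k] by simp
  next
    case False
    \<comment> \<open>With m distinct from 0 and j, the elements 1, \<open>b2 j\<close>,
      \<open>b2 m\<close> are independent, so in the relation below the coefficient
      \<open>e j k\<close> of \<open>b2 m\<close> can be read off.\<close>
    obtain m where m: "m \<noteq> 0" "m \<noteq> j" using ne_4_0 by metis
    have aux: "e1 * am - e2 * aj + (E1 - E2) = 0"
      if "(U - e1) * am = aj * (Y - e2)" "U * am = W - E1" "aj * Y = W - E2"
      for U Y W E1 E2 e1 e2 am aj :: complex
    proof -
      have "U * am - e1 * am = aj * Y - aj * e2"
        using that(1) by (simp add: algebra_simps)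
      then show ?thesis unfolding that(2,3) by (simp add: algebra_simps)
    qed
    have "e j k * \<sigma>' i (b2 m) - e k m * \<sigma>' i (b2 j) +
        (E (b j \<otimes>\<^bsub>R\<^esub> b k) (b m) - E (b j) (b k \<otimes>\<^bsub>R\<^esub> b m)) = 0" for i
    proof -
      have "(\<sigma>' i (b2 j) * \<sigma>' i (b2 k)) * \<sigma>' i (b2 m) = \<sigma>' i (b2 j) * (\<sigma>' i (b2 k) * \<sigma>' i (b2 m))"
        by simp
      then have "(a i (b j \<otimes>\<^bsub>R\<^esub> b k) - e j k) * a i (b m) = a i (b j) * (a i (b k \<otimes>\<^bsub>R\<^esub> b m) - e k m)"
        unfolding e ab .
      moreover have "a i (b j \<otimes>\<^bsub>R\<^esub> b k) * a i (b m) = a i (b j \<otimes>\<^bsub>R\<^esub> b k \<otimes>\<^bsub>R\<^esub> b m) - E (b j \<otimes>\<^bsub>R\<^esub> b k) (b m)"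
        by (intro mult) auto
      moreover have "a i (b j) * a i (b k \<otimes>\<^bsub>R\<^esub> b m) = a i (b j \<otimes>\<^bsub>R\<^esub> (b k \<otimes>\<^bsub>R\<^esub> b m)) - E (b j) (b k \<otimes>\<^bsub>R\<^esub> b m)"
        by (intro mult) auto
      moreover have "b j \<otimes>\<^bsub>R\<^esub> b k \<otimes>\<^bsub>R\<^esub> b m = b j \<otimes>\<^bsub>R\<^esub> (b k \<otimes>\<^bsub>R\<^esub> b m)"
        by (intro P.R.m_assoc) auto
      ultimately show ?thesis
        unfolding ab by (intro aux[of "a i (b j \<otimes>\<^bsub>R\<^esub> b k)" _ _ _ "a i (b k \<otimes>\<^bsub>R\<^esub> b m)"]) simp_all
    qed
    note eq = this
    define z where "z i = (if i = m then e j k else 0) - (if i = j then e k m else (0::complex))" for i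
    have "(E (b j \<otimes>\<^bsub>R\<^esub> b k) (b m) - E (b j) (b k \<otimes>\<^bsub>R\<^esub> b m)) + z 1 * \<sigma>' i (b2 1) + z 2 * \<sigma>' i (b2 2) + z 3 * \<sigma>' i (b2 3) = 0" for i
      using eq[of i] m False exhaust_4_0[of j] exhaust_4_0[of m]
      by (elim disjE; hypsubst) (simp_all add: z_def algebra_simps)
    from ind[OF this] have "z m = 0"
      using exhaust_4_0[of m] m by (elim disjE) simp_all
    then show ?thesis using m by (simp add: z_def)
  qed
  have mult': "a i x * a i y = a i (x \<otimes>\<^bsub>R\<^esub> y)" if "x \<in> carrier R" "y \<in> carrier R" for i x y
    using mult[OF that, of i] by (simp add: E_def e0)
  have add': "a i x + a i y = a i (x \<oplus>\<^bsub>R\<^esub> y)" if xy: "x \<in> carrier R" "y \<in> carrier R" for i x y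
  proof -
    have "of_int (coords R b x $ m + coords R b y $ m) = (of_int (coords R b (x \<oplus>\<^bsub>R\<^esub> y) $ m) :: complex)" for m
      by (rule P.R.coords_unique)
         (use xy in \<open>auto simp: P.R.sigma_add P.R.sigma_coords[of x] P.R.sigma_coords[of y] sum.distrib algebra_simps\<close>)
    then have "coords R b (x \<oplus>\<^bsub>R\<^esub> y) $ m = coords R b x $ m + coords R b y $ m" for m
      by (metis of_int_eq_iff)
    then show ?thesis
      unfolding a_eq by (simp add: sum.distrib algebra_simps)
  qed
  have al: "\<alpha> x \<in> carrier R'" for x by (simp add: \<alpha>_def)
  have "\<alpha> \<in> ring_hom R R'"
  proof (rule ring_hom_memI)
    show "\<alpha> (x \<otimes>\<^bsub>R\<^esub> y) = \<alpha> x \<otimes>\<^bsub>R'\<^esub> \<alpha> y" if "x \<in> carrier R" "y \<in> carrier R" for x y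
      using mult'[OF that] al by (intro R2.sigma_eqI) (auto simp: a_def R2.sigma_mult)
    show "\<alpha> (x \<oplus>\<^bsub>R\<^esub> y) = \<alpha> x \<oplus>\<^bsub>R'\<^esub> \<alpha> y" if "x \<in> carrier R" "y \<in> carrier R" for x y
      using add'[OF that] al by (intro R2.sigma_eqI) (auto simp: a_def R2.sigma_add)
    show "\<alpha> \<one>\<^bsub>R\<^esub> = \<one>\<^bsub>R'\<^esub>"
      using ab[of _ 0] al by (intro R2.sigma_eqI) (auto simp: a_def sb2 P.b0 R2.sigma_one)
  qed (rule al)
  moreover have "bij_betw \<alpha> (carrier R) (carrier R')"
  proof -
    have "inj_on \<alpha> (carrier R)"
      by (rule inj_onI) (metis P.R.int_comb_coords R2.int_comb_inject \<alpha>_def)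
    moreover have "y \<in> \<alpha> ` carrier R" if "y \<in> carrier R'" for y
      using that by (intro image_eqI[of _ _ "int_comb R b (coords R' b2 y)"]) (auto simp: \<alpha>_def)
    ultimately show ?thesis using al by (auto simp: bij_betw_def)
  qed
  ultimately have "\<alpha> \<in> ring_iso R R'"
    by (simp add: ring_iso_def)
  moreover have "\<sigma>' i (\<alpha> (P.lc x y z)) =
       of_int t * \<sigma>' i (Q.lc x y z) + of_int (x * l 1 + y * l 2 + z * l 3)" for i x y z
  proof -
    define u where "u m = (if m = 0 then 0 else if m = 1 then x else if m = 2 then y else z)" for m :: 4
    have "of_int (u m) = (of_int (coords R b (P.lc x y z) $ m) :: complex)" for m
      by (rule P.R.coords_unique) (simp_all add: P.sigma_lc sum_4_0 u_def)
    then have "coords R b (P.lc x y z) $ m = u m" for m by (metis of_int_eq_iff)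
    then have "a i (P.lc x y z) = of_int x * \<sigma>' i (b2 1) + of_int y * \<sigma>' i (b2 2) + of_int z * \<sigma>' i (b2 3)"
      unfolding a_eq sum_4_0 by (simp add: u_def)
    then show ?thesis
      by (simp add: a_def sb2 Q.sigma_lc algebra_simps)
  qed
  ultimately show ?thesis using t that by blast
qed

text \<open>The isomorphism of the quartic rings permutes the embeddings by \<pi>, hence the
  pairings by \<rho>, and \<rho> has to be the permutation of the embeddings of the cubic rings. The
  basis of C, read through \<rho>, turns out to be that of C' translated by integers, and this
  defines \<beta>.\<close>

lemma iso_pair: "\<exists>\<alpha>\<in>ring_iso R R'. \<exists>\<beta>\<in>ring_iso C C'. \<forall>x\<in>carrier R. \<beta> (\<phi> x) = \<phi>' (\<alpha> x)"
proof -
  obtain \<alpha> and t :: int and l :: "4 \<Rightarrow> int" where al: "\<alpha> \<in> ring_iso R R'" and t: "t = 1 \<or> t = - 1" and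
    lc: "\<And>i x y z. \<sigma>' i (\<alpha> (P.lc x y z)) =
       of_int t * \<sigma>' i (Q.lc x y z) + of_int (x * l 1 + y * l 2 + z * l 3)"
    using iso_R by blast
  have alh: "\<alpha> \<in> ring_hom R R'" and alb: "bij_betw \<alpha> (carrier R) (carrier R')"
    using al by (auto simp: ring_iso_def)
  have alc: "\<alpha> x \<in> carrier R'" if "x \<in> carrier R" for x
    using alh that by (rule ring_hom_closed)
  define h where "h i = restrict (\<lambda>x. \<sigma>' i (\<alpha> x)) (carrier R)" for i
  have "h i \<in> complex_homs R" for i
    by (rule complex_homsI)
       (auto simp: h_def alc ring_hom_mult[OF alh] ring_hom_add[OF alh] ring_hom_one[OF alh]
          Q.R.sigma_mult Q.R.sigma_add Q.R.sigma_one)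
  then have "\<forall>i. \<exists>k. h i = \<sigma> k"
    using P.R.homs by (auto simp: bij_betw_def)
  then obtain \<pi> where "\<forall>i. h i = \<sigma> (\<pi> i)"
    unfolding choice_iff by blast
  then have pi: "\<sigma>' i (\<alpha> x) = \<sigma> (\<pi> i) x" if "x \<in> carrier R" for i x
    using that by (metis h_def restrict_apply')
  have "inj \<pi>"
  proof (rule injI)
    fix i j assume "\<pi> i = \<pi> j"
    then have "\<sigma>' i y = \<sigma>' j y" if "y \<in> carrier R'" for y
      using that pi alb by (metis bij_betw_imp_surj_on imageE)
    moreover have "\<sigma>' i \<in> extensional (carrier R')" "\<sigma>' j \<in> extensional (carrier R')"
      using Q.R.sigma_hom[of i] Q.R.sigma_hom[of j] by (simp_all add: complex_homs_def)
    ultimately have "\<sigma>' i = \<sigma>' j" by (intro extensionalityI)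
    then show "i = j" using Q.R.inj_sigma by (simp add: inj_eq)
  qed
  then obtain \<rho> where \<rho>: "inj \<rho>" "\<And>s j. pair_sum (s \<circ> \<pi>) j = pair_sum s (\<rho> j)"
    using pair_sum_permute by blast
  have res: "\<tau>' j (\<phi>' (\<alpha> x)) = \<tau> (\<rho> j) (\<phi> x)" if x: "x \<in> carrier R" for j x
  proof -
    have "\<tau>' j (\<phi>' (\<alpha> x)) = pair_sum (\<lambda>i. \<sigma>' i (\<alpha> x)) j"
      using alc[OF x] by (rule Q.phi)
    also have "(\<lambda>i. \<sigma>' i (\<alpha> x)) = (\<lambda>i. \<sigma> i x) \<circ> \<pi>"
      using pi[OF x] by auto
    also have "pair_sum ((\<lambda>i. \<sigma> i x) \<circ> \<pi>) j = pair_sum (\<lambda>i. \<sigma> i x) (\<rho> j)"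
      by (rule \<rho>(2))
    finally show ?thesis
      using P.phi[OF x] by simp
  qed
  \<comment> \<open>The discrepancies between the two cubic bases. Every value of (A, B) makes
    \<open>A * u j + B * w j\<close> independent of j, and two independent values make
    \<open>u\<close> and \<open>w\<close> themselves constant.\<close>
  define u w where "u j = \<tau> (\<rho> j) (c 1) - \<tau>' j (c' 1)" and "w j = \<tau> (\<rho> j) (c 2) - \<tau>' j (c' 2)" for j
  have const: "\<exists>\<kappa>. \<forall>j. of_int (A x y z) * u j + of_int (B x y z) * w j = \<kappa>" for x y z
  proof -
    have aux: "f * (r - r') + g * (s - s') = k' - k + G + H"
      if "k + f * r + g * s = k' + f * r' + g * s' + G + H" for f g r s r' s' k k' G H :: complex
    proof -
      have "f * (r - r') + g * (s - s') = (k + f * r + g * s) - (k' + f * r' + g * s' + G + H) + (k' - k + G + H)"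
        by (simp add: algebra_simps)
      then show ?thesis unfolding that by simp
    qed
    obtain k :: int where k: "\<And>j. \<tau> j (\<phi> (P.lc x y z)) = of_int k + of_int (A x y z) * \<tau> j (c 1) + of_int (B x y z) * \<tau> j (c 2)"
      using P.tau_phi_lc by blast
    obtain k' :: int where k': "\<And>j. \<tau>' j (\<phi>' (Q.lc x y z)) = of_int k' + of_int (A x y z) * \<tau>' j (c' 1) + of_int (B x y z) * \<tau>' j (c' 2)"
      using Q.tau_phi_lc by blast
    define L where "L = (of_int (x * l 1 + y * l 2 + z * l 3) :: complex)"
    have "(of_int t)\<^sup>2 = (1 :: complex)" using t by auto
    have "\<tau> (\<rho> j) (\<phi> (P.lc x y z)) = pair_sum (\<lambda>i. of_int t * \<sigma>' i (Q.lc x y z) + L) j" for j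
      unfolding res[OF P.lc_closed, symmetric] Q.phi[OF alc[OF P.lc_closed]] lc L_def ..
    also have "\<dots> j = \<tau>' j (\<phi>' (Q.lc x y z)) + of_int t * L * (\<sigma>' 0 (Q.lc x y z) + \<sigma>' 1 (Q.lc x y z)
      + \<sigma>' 2 (Q.lc x y z) + \<sigma>' 3 (Q.lc x y z)) + 2 * L\<^sup>2" for j
      by (subst pair_sum_shift[OF \<open>(of_int t)\<^sup>2 = 1\<close>]) (simp add: Q.phi[OF Q.lc_closed])
    finally have "of_int k + of_int (A x y z) * \<tau> (\<rho> j) (c 1) + of_int (B x y z) * \<tau> (\<rho> j) (c 2) =
      of_int k' + of_int (A x y z) * \<tau>' j (c' 1) + of_int (B x y z) * \<tau>' j (c' 2) + of_int t * L * (\<sigma>' 0 (Q.lc x y z) + \<sigma>' 1 (Q.lc x y z)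
      + \<sigma>' 2 (Q.lc x y z) + \<sigma>' 3 (Q.lc x y z)) + 2 * L\<^sup>2" for j
      unfolding k k' .
    then have "of_int (A x y z) * u j + of_int (B x y z) * w j = of_int k' - of_int k + of_int t * L * (\<sigma>' 0 (Q.lc x y z) + \<sigma>' 1 (Q.lc x y z)
      + \<sigma>' 2 (Q.lc x y z) + \<sigma>' 3 (Q.lc x y z)) + 2 * L\<^sup>2" for j
      unfolding u_def w_def by (intro aux)
    then show ?thesis by blast
  qed
  obtain x1 x2 x3 y1 y2 y3 where D: "A x1 x2 x3 * B y1 y2 y3 - A y1 y2 y3 * B x1 x2 x3 \<noteq> 0"
    using P.forms_independent by blast
  define a1 b1 a2 b2 :: complex where d: "a1 = of_int (A x1 x2 x3)" "b1 = of_int (B x1 x2 x3)"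
    "a2 = of_int (A y1 y2 y3)" "b2 = of_int (B y1 y2 y3)"
  obtain \<kappa>1 \<kappa>2 where \<kappa>: "\<And>j. a1 * u j + b1 * w j = \<kappa>1" "\<And>j. a2 * u j + b2 * w j = \<kappa>2"
    using const[of x1 x2 x3] const[of y1 y2 y3] unfolding d by blast
  have D': "a1 * b2 - a2 * b1 \<noteq> 0"
    using D unfolding d by (metis of_int_diff of_int_mult of_int_eq_0_iff)
  have "(a1 * b2 - a2 * b1) * u j = \<kappa>1 * b2 - \<kappa>2 * b1" "(a1 * b2 - a2 * b1) * w j = a1 * \<kappa>2 - a2 * \<kappa>1" for j
    unfolding \<kappa>(1)[of j, symmetric] \<kappa>(2)[of j, symmetric] by (simp_all add: algebra_simps)
  then have uw: "u j = (\<kappa>1 * b2 - \<kappa>2 * b1) / (a1 * b2 - a2 * b1)" "w j = (a1 * \<kappa>2 - a2 * \<kappa>1) / (a1 * b2 - a2 * b1)" for j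
    using D' by (simp_all add: eq_divide_eq mult.commute)
  define q1 q2 where "q1 = (\<kappa>1 * b2 - \<kappa>2 * b1) / (a1 * b2 - a2 * b1)" and "q2 = (a1 * \<kappa>2 - a2 * \<kappa>1) / (a1 * b2 - a2 * b1)"
  have c1: "\<tau> (\<rho> j) (c 1) = \<tau>' j (c' 1) + q1" and c2: "\<tau> (\<rho> j) (c 2) = \<tau>' j (c' 2) + q2" for j
    using uw[of j] by (simp_all add: u_def w_def q1_def q2_def diff_eq_eq add.commute)
  \<comment> \<open>The constants are integers: expanding c_1 c_2 in both rings, the coefficient of
    c'_1 determines \<open>q2\<close> and that of c'_2 determines \<open>q1\<close>.\<close>
  define n n' where "n m = coords C c (c 1 \<otimes>\<^bsub>C\<^esub> c 2) $ m" and "n' m = coords C' c' (c' 1 \<otimes>\<^bsub>C'\<^esub> c' 2) $ m" for m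
  have "\<tau> j (c 1) * \<tau> j (c 2) = of_int (n 0) + of_int (n 1) * \<tau> j (c 1) + of_int (n 2) * \<tau> j (c 2)" for j
    using P.C.sigma_coords[of "c 1 \<otimes>\<^bsub>C\<^esub> c 2" j] by (simp add: P.C.sigma_mult sum_3_0 n_def)
  from this[of "\<rho> _"] have pr: "(\<tau>' j (c' 1) + q1) * (\<tau>' j (c' 2) + q2) = of_int (n 0) + of_int (n 1) * (\<tau>' j (c' 1) + q1) + of_int (n 2) * (\<tau>' j (c' 2) + q2)" for j
    unfolding c1 c2 .
  have pr': "\<tau>' j (c' 1) * \<tau>' j (c' 2) = of_int (n' 0) + of_int (n' 1) * \<tau>' j (c' 1) + of_int (n' 2) * \<tau>' j (c' 2)" for j
    using Q.C.sigma_coords[of "c' 1 \<otimes>\<^bsub>C'\<^esub> c' 2" j] by (simp add: Q.C.sigma_mult sum_3_0 n'_def)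
  have "(of_int (n' 0) + q1 * q2 - of_int (n 0) - of_int (n 1) * q1 - of_int (n 2) * q2) +
    (of_int (n' 1) + q2 - of_int (n 1)) * \<tau>' j (c' 1) + (of_int (n' 2) + q1 - of_int (n 2)) * \<tau>' j (c' 2) = 0" for j
  proof -
    have "\<tau>' j (c' 1) * \<tau>' j (c' 2) + q2 * \<tau>' j (c' 1) + q1 * \<tau>' j (c' 2) + q1 * q2 = of_int (n 0) + of_int (n 1) * (\<tau>' j (c' 1) + q1) + of_int (n 2) * (\<tau>' j (c' 2) + q2)"
      using pr[of j] by (simp add: algebra_simps)
    then show ?thesis unfolding pr' by (simp add: algebra_simps)
  qed
  from Q.lin_indep_C[OF this] have q: "q2 = of_int (n 1 - n' 1)" "q1 = of_int (n 2 - n' 2)"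
    by (simp_all add: algebra_simps)
  define m1 m2 where "m1 = n 2 - n' 2" and "m2 = n 1 - n' 1"
  have "q1 = of_int m1" "q2 = of_int m2" using q by (simp_all add: m1_def m2_def)
  note c12 = c1[unfolded this(1)] c2[unfolded this(2)]
  define \<gamma> :: "3 \<Rightarrow> int ^ 3" where
    "\<gamma> j = axis j 1 + (if j = 0 then 0 else if j = 1 then m1 else m2) *s axis 0 1" for j
  define c3 where "c3 j = int_comb C' c' (\<gamma> j)" for j
  have "\<exists>e. x = (\<Sum>j\<in>UNIV. e j *s \<gamma> j)" for x
  proof -
    define e where "e j = (if j = 0 then x $ 0 - x $ 1 * m1 - x $ 2 * m2 else x $ j)" for j
    have "x = (\<Sum>j\<in>UNIV. e j *s \<gamma> j)"
      unfolding vec_eq_iff all_3_0 sum_3_0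
      by (auto simp: e_def \<gamma>_def axis_def algebra_simps)
    then show ?thesis by blast
  qed
  then have "is_int_basis C' c3"
    unfolding c3_def by (rule Q.C.int_basis_of_generating)
  then interpret C3: emb_ring C' c3 \<tau>' by (rule Q.C.change_basis)
  have tc3: "\<tau>' i (c3 j) = \<tau> (\<rho> i) (c j)" for i j
    using exhaust_3_0[of j] unfolding c3_def Q.C.sigma_int_comb sum_3_0
    by (elim disjE; hypsubst) (simp_all add: \<gamma>_def axis_def c12)
  define \<beta> where "\<beta> x = int_comb C' c3 (coords C c x)" for x
  have bc: "\<beta> x \<in> carrier C'" for x by (simp add: \<beta>_def)
  have tb: "\<tau>' j (\<beta> x) = \<tau> (\<rho> j) x" if "x \<in> carrier C" for j x
    using that unfolding \<beta>_def C3.sigma_int_comb tc3 by (subst P.C.sigma_coords[OF that]) simp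
  have "\<beta> \<in> ring_hom C C'"
  proof (rule ring_hom_memI)
    show "\<beta> (x \<otimes>\<^bsub>C\<^esub> y) = \<beta> x \<otimes>\<^bsub>C'\<^esub> \<beta> y" if "x \<in> carrier C" "y \<in> carrier C" for x y
      using that bc by (intro C3.sigma_eqI) (auto simp: tb C3.sigma_mult P.C.sigma_mult)
    show "\<beta> (x \<oplus>\<^bsub>C\<^esub> y) = \<beta> x \<oplus>\<^bsub>C'\<^esub> \<beta> y" if "x \<in> carrier C" "y \<in> carrier C" for x y
      using that bc by (intro C3.sigma_eqI) (auto simp: tb C3.sigma_add P.C.sigma_add)
    show "\<beta> \<one>\<^bsub>C\<^esub> = \<one>\<^bsub>C'\<^esub>"
      using bc by (intro C3.sigma_eqI) (auto simp: tb C3.sigma_one P.C.sigma_one)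
  qed (rule bc)
  moreover have "bij_betw \<beta> (carrier C) (carrier C')"
  proof -
    have "inj_on \<beta> (carrier C)"
      by (rule inj_onI) (metis P.C.int_comb_coords C3.int_comb_inject \<beta>_def)
    moreover have "y \<in> \<beta> ` carrier C" if "y \<in> carrier C'" for y
      using that by (intro image_eqI[of _ _ "int_comb C c (coords C' c3 y)"]) (auto simp: \<beta>_def)
    ultimately show ?thesis using bc by (auto simp: bij_betw_def)
  qed
  ultimately have be: "\<beta> \<in> ring_iso C C'"
    by (simp add: ring_iso_def)
  have "\<beta> (\<phi> x) = \<phi>' (\<alpha> x)" if x: "x \<in> carrier R" for x
    using x by (intro C3.sigma_eqI) (auto simp: tb P.phi_closed Q.phi_closed alc bc res)
  then show ?thesis using al be by blast
qed

end

section \<open>From resolvent pairs to bases with numbered embeddings\<close>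

lemma bij_nat_4: "bij_betw (\<lambda>n::nat. if n = 0 then 0 else if n = 1 then 1 else if n = 2 then 2 else 3 :: 4) {..<4} UNIV"
  unfolding bij_betw_def UNIV_4_0 by (auto simp: inj_on_def image_def lessThan_nat_numeral less_Suc_eq numeral_eq_Suc)

lemma bij_4_nat: "bij_betw (\<lambda>i::4. if i = 0 then 0 else if i = 1 then 1 else if i = 2 then 2 else 3 :: nat) UNIV {..<4}"
proof (rule bij_betw_byWitness[where f' = "\<lambda>n::nat. if n = 0 then 0 else if n = 1 then 1 else if n = 2 then 2 else 3"])
  show "\<forall>a'\<in>{..<4::nat}. (if (if a' = 0 then 0 else if a' = 1 then 1 else if a' = 2 then 2 else (3::4)) = 0 then 0
      else if (if a' = 0 then 0 else if a' = 1 then 1 else if a' = 2 then 2 else (3::4)) = 1 then 1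
      else if (if a' = 0 then 0 else if a' = 1 then 1 else if a' = 2 then 2 else (3::4)) = 2 then 2 else 3) = a'"
    by auto
qed (auto simp: all_4_0)

lemma bij_nat_3: "bij_betw (\<lambda>n::nat. if n = 0 then 0 else if n = 1 then 1 else 2 :: 3) {..<3} UNIV"
  unfolding bij_betw_def UNIV_3_0 by (auto simp: inj_on_def image_def lessThan_nat_numeral less_Suc_eq numeral_eq_Suc)

lemma bij_3_nat: "bij_betw (\<lambda>i::3. if i = 0 then 0 else if i = 1 then 1 else 2 :: nat) UNIV {..<3}"
proof (rule bij_betw_byWitness[where f' = "\<lambda>n::nat. if n = 0 then 0 else if n = 1 then 1 else 2"])
  show "\<forall>a'\<in>{..<3::nat}. (if (if a' = 0 then 0 else if a' = 1 then 1 else (2::3)) = 0 then 0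
      else if (if a' = 0 then 0 else if a' = 1 then 1 else (2::3)) = 1 then 1 else 2) = a'"
    by auto
qed (auto simp: all_3_0)

text \<open>The numbering of the homomorphisms is fixed by \<phi> alone. The bases stay free, so
  they can later be replaced by reduced ones without renumbering.\<close>

lemma resolvent_pair_embeddings:
  fixes R :: "('a, 'm) ring_scheme" and C :: "('b, 'k) ring_scheme"
  assumes "rank_ring TYPE(4) R" "is_cubic_resolvent R C \<phi>"
  obtains \<sigma> :: "4 \<Rightarrow> 'a \<Rightarrow> complex" and \<tau> :: "3 \<Rightarrow> 'b \<Rightarrow> complex" where
    "\<And>b c. is_int_basis R b \<Longrightarrow> b 0 = \<one>\<^bsub>R\<^esub> \<Longrightarrow> is_int_basis C c \<Longrightarrow> c 0 = \<one>\<^bsub>C\<^esub> \<Longrightarrow> res_pair R b \<sigma> C c \<tau> \<phi>"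
    "\<And>b. is_int_basis R b \<Longrightarrow> emb_ring R b \<sigma>" "\<And>c. is_int_basis C c \<Longrightarrow> emb_ring C c \<tau>"
proof -
  have cR: "cring R" and cC: "cring C" and rk: "rank_ring TYPE(3) C" and disc: "ring_disc TYPE(3) C = ring_disc TYPE(4) R"
    and res: "is_resolvent_map R C \<phi>"
    using assms by (auto simp: rank_ring_def is_cubic_resolvent_def)
  from res obtain s t where cl: "\<phi> \<in> carrier R \<rightarrow> carrier C" and s: "bij_betw s {..<4::nat} (complex_homs R)"
    and t: "bij_betw t {..<3::nat} (complex_homs C)"
    and st: "\<And>x. x \<in> carrier R \<Longrightarrow>
           t 0 (\<phi> x) = s 0 x * s 1 x + s 2 x * s 3 x \<and>
           t 1 (\<phi> x) = s 0 x * s 2 x + s 1 x * s 3 x \<and>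
           t 2 (\<phi> x) = s 0 x * s 3 x + s 1 x * s 2 x"
    unfolding is_resolvent_map_def by blast
  define \<sigma> where "\<sigma> i = s (if i = 0 then 0 else if i = 1 then 1 else if i = 2 then 2 else 3)" for i :: 4
  define \<tau> where "\<tau> i = t (if i = 0 then 0 else if i = 1 then 1 else 2)" for i :: 3
  have bs: "bij_betw \<sigma> UNIV (complex_homs R)"
    using bij_betw_trans[OF bij_4_nat s] by (simp add: \<sigma>_def[abs_def] comp_def)
  have bt: "bij_betw \<tau> UNIV (complex_homs C)"
    using bij_betw_trans[OF bij_3_nat t] by (simp add: \<tau>_def[abs_def] comp_def)
  have eR: "emb_ring R b \<sigma>" if "is_int_basis R b" for b
    using that bs cR by (simp add: emb_ring_def based_ring_def based_ring_axioms_def emb_ring_axioms_def)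
  have eC: "emb_ring C c \<tau>" if "is_int_basis C c" for c
    using that bt cC by (simp add: emb_ring_def based_ring_def based_ring_axioms_def emb_ring_axioms_def)
  show ?thesis
  proof (rule that[OF _ eR eC])
    fix b :: "4 \<Rightarrow> 'a" and c :: "3 \<Rightarrow> 'b" assume b: "is_int_basis R b" "b 0 = \<one>\<^bsub>R\<^esub>" and c: "is_int_basis C c" "c 0 = \<one>\<^bsub>C\<^esub>"
    interpret R: emb_ring R b \<sigma> by (rule eR[OF b(1)])
    interpret C: emb_ring C c \<tau> by (rule eC[OF c(1)])
    have "(det C.S)\<^sup>2 = (det R.S)\<^sup>2"
      using disc by (simp add: R.ring_disc_det[symmetric] C.ring_disc_det[symmetric])
    then have "det C.S = det R.S \<or> det C.S = - det R.S"
      by (simp add: power2_eq_iff)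
    moreover have "\<tau> j (\<phi> x) = pair_sum (\<lambda>i. \<sigma> i x) j" if "x \<in> carrier R" for x j
      using st[OF that] exhaust_3_0[of j] by (elim disjE; hypsubst) (simp_all add: \<tau>_def \<sigma>_def pair_sum_def)
    ultimately show "res_pair R b \<sigma> C c \<tau> \<phi>"
      using cl b(2) c(2) by unfold_locales auto
  qed
qed

lemma (in res_pair) is_cubic_resolvent: "is_cubic_resolvent R C \<phi>"
proof -
  let ?e = "\<lambda>n::nat. if n = 0 then 0 else if n = 1 then 1 else if n = 2 then 2 else 3 :: 4"
  let ?f = "\<lambda>n::nat. if n = 0 then 0 else if n = 1 then 1 else 2 :: 3"
  have "is_resolvent_map R C \<phi>"
    unfolding is_resolvent_map_def
    by (intro conjI exI[of _ "\<sigma> \<circ> ?e"] exI[of _ "\<tau> \<circ> ?f"] bij_betw_trans[OF bij_nat_4 R.homs]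
        bij_betw_trans[OF bij_nat_3 C.homs]) (auto simp: phi_closed phi pair_sum_def)
  moreover have "rank_ring TYPE(3) C"
    using C.basis C.is_cring by (auto simp: rank_ring_def)
  moreover have "of_int (ring_disc TYPE(3) C) = (of_int (ring_disc TYPE(4) R) :: complex)"
    using det_eq by (auto simp: R.ring_disc_det C.ring_disc_det)
  ultimately show ?thesis
    by (simp add: is_cubic_resolvent_def)
qed

lemma (in res_pair) rank_ring_R: "rank_ring TYPE(4) R"
  using R.basis R.is_cring by (auto simp: rank_ring_def)

lemma represented_by_rep_pair:
  assumes "rank_ring TYPE(4) R" "is_cubic_resolvent R C \<phi>" "represented_by R C \<phi> A B"
  obtains b \<sigma> c \<tau> where "rep_pair R b \<sigma> C c \<tau> \<phi> A B"
proof -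
  from assms(3) obtain b :: "4 \<Rightarrow> _" and c :: "3 \<Rightarrow> _" where bc: "is_int_basis R b" "b 0 = \<one>\<^bsub>R\<^esub>" "is_int_basis C c" "c 0 = \<one>\<^bsub>C\<^esub>"
    and rep: "\<And>x y z. \<exists>k :: int.
           \<phi> ([x] \<cdot>\<^bsub>R\<^esub> b 1 \<oplus>\<^bsub>R\<^esub> [y] \<cdot>\<^bsub>R\<^esub> b 2 \<oplus>\<^bsub>R\<^esub> [z] \<cdot>\<^bsub>R\<^esub> b 3) =
             [k] \<cdot>\<^bsub>C\<^esub> \<one>\<^bsub>C\<^esub> \<oplus>\<^bsub>C\<^esub> [(A x y z)] \<cdot>\<^bsub>C\<^esub> c 1 \<oplus>\<^bsub>C\<^esub> [(B x y z)] \<cdot>\<^bsub>C\<^esub> c 2"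
    unfolding represented_by_def by blast
  obtain \<sigma> \<tau> where "res_pair R b \<sigma> C c \<tau> \<phi>"
    using resolvent_pair_embeddings[OF assms(1,2)] bc by metis
  then interpret res_pair R b \<sigma> C c \<tau> \<phi> .
  have "rep_pair R b \<sigma> C c \<tau> \<phi> A B"
    using rep by unfold_locales (simp add: lc_def)
  then show ?thesis using that by blast
qed

lemma (in rep_pair) represented_by: "represented_by R C \<phi> A B"
  unfolding represented_by_def
  by (rule exI[of _ b], rule exI[of _ c])
     (use R.basis C.basis b0 c0 rep in \<open>simp add: lc_def\<close>)

section \<open>Transport of embeddings and bases along isomorphisms\<close>

context emb_ring
begin

lemma hom_comp:
  assumes "\<alpha> \<in> ring_hom Q R" "cring Q"
  shows "restrict (\<lambda>x. \<sigma> i (\<alpha> x)) (carrier Q) \<in> complex_homs Q"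
proof -
  interpret Q: cring Q by fact
  have "\<alpha> x \<in> carrier R" if "x \<in> carrier Q" for x
    using assms(1) that by (rule ring_hom_closed)
  then show ?thesis
    using sigma_mult sigma_add sigma_one
    by (intro complex_homsI)
      (auto simp: ring_hom_mult[OF assms(1)] ring_hom_add[OF assms(1)] ring_hom_one[OF assms(1)])
qed

lemma sigma_hom_int_pow:
  assumes "\<alpha> \<in> ring_hom Q R" "cring Q" "x \<in> carrier Q"
  shows "\<sigma> i (\<alpha> ([(k::int)] \<cdot>\<^bsub>Q\<^esub> x)) = of_int k * \<sigma> i (\<alpha> x)"
proof -
  interpret Q: cring Q by fact
  show ?thesis
    using Q.complex_homs_int_pow[OF hom_comp[OF assms(1,2)] assms(3), of i k] assms(3)
    by simp
qed

lemma sigma_hom_add: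
  assumes "\<alpha> \<in> ring_hom Q R" "x \<in> carrier Q" "y \<in> carrier Q"
  shows "\<sigma> i (\<alpha> (x \<oplus>\<^bsub>Q\<^esub> y)) = \<sigma> i (\<alpha> x) + \<sigma> i (\<alpha> y)"
  using assms ring_hom_closed[OF assms(1)] by (simp add: ring_hom_add[OF assms(1)] sigma_add)

lemma int_basis_iso:
  fixes b' :: "'n \<Rightarrow> 'c"
  assumes "\<alpha> \<in> ring_iso Q R" "cring Q" "is_int_basis Q b'"
  shows "is_int_basis R (\<lambda>j. \<alpha> (b' j))"
proof -
  interpret Q: based_ring Q b'
    using assms by (simp add: based_ring_def based_ring_axioms_def)
  have al: "\<alpha> \<in> ring_hom Q R" and bij: "bij_betw \<alpha> (carrier Q) (carrier R)"
    using assms(1) by (auto simp: ring_iso_def)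
  have cl: "\<alpha> x \<in> carrier R" if "x \<in> carrier Q" for x
    using al that by (rule ring_hom_closed)
  have "int_comb R (\<lambda>j. \<alpha> (b' j)) c = \<alpha> (int_comb Q b' c)" for c
  proof (rule sigma_eqI)
    show "int_comb R (\<lambda>j. \<alpha> (b' j)) c \<in> carrier R"
      unfolding int_comb_def by (intro finsum_closed) (auto simp: cl)
    show "\<alpha> (int_comb Q b' c) \<in> carrier R" by (intro cl) auto
    fix i
    have "\<sigma> i (\<alpha> (int_comb Q b' c)) = (\<Sum>j\<in>UNIV. of_int (c $ j) * \<sigma> i (\<alpha> (b' j)))"
      using Q.hom_int_comb[OF hom_comp[OF al assms(2)], of i c] by simp
    then show "\<sigma> i (int_comb R (\<lambda>j. \<alpha> (b' j)) c) = \<sigma> i (\<alpha> (int_comb Q b' c))"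
      unfolding int_comb_def[of R]
      by (subst complex_homs_finsum[OF sigma_hom]) (auto simp: cl sigma_int_pow)
  qed
  then have "int_comb R (\<lambda>j. \<alpha> (b' j)) = \<alpha> \<circ> int_comb Q b'" by auto
  moreover have "bij_betw (\<alpha> \<circ> int_comb Q b') UNIV (carrier R)"
    using assms(3) bij unfolding is_int_basis_def by (blast intro: bij_betw_trans)
  ultimately show ?thesis
    using cl by (auto simp: is_int_basis_def)
qed

end

lemma (in rep_pair) represented_by_iso:
  assumes R': "rank_ring TYPE(4) R'" and res: "is_cubic_resolvent R' C' \<phi>'"
    and al: "\<alpha> \<in> ring_iso R R'" and be: "\<beta> \<in> ring_iso C C'"
    and comm: "\<And>x. x \<in> carrier R \<Longrightarrow> \<beta> (\<phi> x) = \<phi>' (\<alpha> x)"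
  shows "represented_by R' C' \<phi>' A B"
proof -
  obtain b1 :: "4 \<Rightarrow> _" where b1: "is_int_basis R' b1" and cR': "cring R'"
    using R' by (auto simp: rank_ring_def)
  obtain c1 :: "3 \<Rightarrow> _" where c1: "is_int_basis C' c1" and cC': "cring C'"
    using res by (auto simp: rank_ring_def is_cubic_resolvent_def)
  obtain \<sigma>' \<tau>' where "emb_ring R' b1 \<sigma>'" "emb_ring C' c1 \<tau>'"
    using resolvent_pair_embeddings[OF R' res] b1 c1 by metis
  then interpret R': emb_ring R' b1 \<sigma>' + C': emb_ring C' c1 \<tau>' .
  have alh: "\<alpha> \<in> ring_hom R R'" and beh: "\<beta> \<in> ring_hom C C'"
    using al be by (auto simp: ring_iso_def)
  note cl = ring_hom_closed[OF alh] ring_hom_closed[OF beh]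
  have ic: "[(k::int)] \<cdot>\<^bsub>R\<^esub> x \<in> carrier R" if "x \<in> carrier R" for k x
    using that by simp
  have lc: "[x] \<cdot>\<^bsub>R'\<^esub> \<alpha> (b 1) \<oplus>\<^bsub>R'\<^esub> [y] \<cdot>\<^bsub>R'\<^esub> \<alpha> (b 2) \<oplus>\<^bsub>R'\<^esub> [z] \<cdot>\<^bsub>R'\<^esub> \<alpha> (b 3) = \<alpha> (lc x y z)" for x y z :: int
    using R'.sigma_hom_int_pow[OF alh R.is_cring]
    by (intro R'.sigma_eqI)
      (simp_all add: cl lc_def R'.sigma_add R'.sigma_int_pow R'.sigma_hom_add[OF alh])
  show ?thesis
    unfolding represented_by_def
  proof (rule exI[of _ "\<lambda>j. \<alpha> (b j)"], rule exI[of _ "\<lambda>j. \<beta> (c j)"], intro conjI allI)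
    show "is_int_basis R' (\<lambda>j. \<alpha> (b j))" by (rule R'.int_basis_iso[OF al R.is_cring R.basis])
    show "is_int_basis C' (\<lambda>j. \<beta> (c j))" by (rule C'.int_basis_iso[OF be C.is_cring C.basis])
    show "\<alpha> (b 0) = \<one>\<^bsub>R'\<^esub>" "\<beta> (c 0) = \<one>\<^bsub>C'\<^esub>"
      using alh beh by (simp_all add: b0 c0 ring_hom_one)
    fix x y z
    obtain k :: int where k: "\<phi> (lc x y z) =
     [k] \<cdot>\<^bsub>C\<^esub> \<one>\<^bsub>C\<^esub> \<oplus>\<^bsub>C\<^esub> [(A x y z)] \<cdot>\<^bsub>C\<^esub> c 1 \<oplus>\<^bsub>C\<^esub> [(B x y z)] \<cdot>\<^bsub>C\<^esub> c 2"
      using rep by blast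
    have "\<phi>' (\<alpha> (lc x y z)) = [k] \<cdot>\<^bsub>C'\<^esub> \<one>\<^bsub>C'\<^esub> \<oplus>\<^bsub>C'\<^esub> [(A x y z)] \<cdot>\<^bsub>C'\<^esub> \<beta> (c 1) \<oplus>\<^bsub>C'\<^esub> [(B x y z)] \<cdot>\<^bsub>C'\<^esub> \<beta> (c 2)"
      unfolding comm[OF lc_closed, symmetric] k
      using C'.sigma_hom_int_pow[OF beh C.is_cring]
      by (intro C'.sigma_eqI)
        (simp_all add: cl C'.sigma_add C'.sigma_int_pow C'.sigma_hom_add[OF beh] ring_hom_one[OF beh])
    then show "\<exists>k::int. \<phi>' ([x] \<cdot>\<^bsub>R'\<^esub> \<alpha> (b 1) \<oplus>\<^bsub>R'\<^esub> [y] \<cdot>\<^bsub>R'\<^esub> \<alpha> (b 2) \<oplus>\<^bsub>R'\<^esub> [z] \<cdot>\<^bsub>R'\<^esub> \<alpha> (b 3)) =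
        [k] \<cdot>\<^bsub>C'\<^esub> \<one>\<^bsub>C'\<^esub> \<oplus>\<^bsub>C'\<^esub> [(A x y z)] \<cdot>\<^bsub>C'\<^esub> \<beta> (c 1) \<oplus>\<^bsub>C'\<^esub> [(B x y z)] \<cdot>\<^bsub>C'\<^esub> \<beta> (c 2)"
      unfolding lc by (rule exI)
  qed
qed

text \<open>Two members are isomorphic by \<open>iso_pair\<close>, and representability by the same
  forms passes along isomorphisms. Thus a nonempty value of \<open>quartic_psi\<close> is an element
  of the quotient by \<open>pair_iso\<close>.\<close>

lemma bhargava_class_eq:
  assumes "P \<in> bhargava_class A B"
  shows "bhargava_class A B = pair_iso `` {P}"
proof -
  obtain R C \<phi> where P: "P = (R, C, \<phi>)" by (cases P)
  have rP: "(R, C, \<phi>) \<in> resolvent_pairs" "represented_by R C \<phi> A B"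
    using assms unfolding P bhargava_class_def by auto
  obtain b \<sigma> c \<tau> where rep: "rep_pair R b \<sigma> C c \<tau> \<phi> A B"
    using represented_by_rep_pair rP unfolding resolvent_pairs_def by blast
  show ?thesis
  proof (intro Set.set_eqI iffI)
    fix Q assume Q: "Q \<in> bhargava_class A B"
    obtain R' C' \<phi>' where Qe: "Q = (R', C', \<phi>')" by (cases Q)
    have rQ: "(R', C', \<phi>') \<in> resolvent_pairs" "represented_by R' C' \<phi>' A B"
      using Q unfolding Qe bhargava_class_def by auto
    obtain b' \<sigma>' c' \<tau>' where rep': "rep_pair R' b' \<sigma>' C' c' \<tau>' \<phi>' A B"
      using represented_by_rep_pair rQ unfolding resolvent_pairs_def by blast
    interpret two_rep_pairs R b \<sigma> C c \<tau> \<phi> R' b' \<sigma>' C' c' \<tau>' \<phi>' A B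
      using rep rep' by (simp add: two_rep_pairs_def)
    show "Q \<in> pair_iso `` {P}"
      using iso_pair rP(1) rQ(1) unfolding Qe P pair_iso_def by blast
  next
    fix Q assume Q: "Q \<in> pair_iso `` {P}"
    obtain R' C' \<phi>' where Qe: "Q = (R', C', \<phi>')" by (cases Q)
    obtain \<alpha> \<beta> where rQ: "(R', C', \<phi>') \<in> resolvent_pairs" and
      iso: "\<alpha> \<in> ring_iso R R'" "\<beta> \<in> ring_iso C C'" "\<And>x. x \<in> carrier R \<Longrightarrow> \<beta> (\<phi> x) = \<phi>' (\<alpha> x)"
      using Q unfolding Qe P pair_iso_def by blast
    have "represented_by R' C' \<phi>' A B"
      using rQ unfolding resolvent_pairs_def
      by (intro rep_pair.represented_by_iso[OF rep _ _ iso]) auto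
    then show "Q \<in> bhargava_class A B"
      using rQ unfolding Qe bhargava_class_def by blast
  qed
qed

section \<open>The pair attached to a binary quartic form\<close>

lemma quartic_roots:
  fixes a b c d e :: complex
  assumes "a \<noteq> 0"
  obtains t0 t1 t2 t3 where "b = - a * (t0 + t1 + t2 + t3)"
    "c = a * (t0*t1 + t0*t2 + t0*t3 + t1*t2 + t1*t3 + t2*t3)"
    "d = - a * (t0*t1*t2 + t0*t1*t3 + t0*t2*t3 + t1*t2*t3)" "e = a * (t0*t1*t2*t3)"
proof -
  let ?p = "[:e, d, c, b, a:]"
  obtain M where M: "size M = Polynomial.degree ?p" "?p = Polynomial.smult (poly.coeff ?p (Polynomial.degree ?p)) (\<Prod>x\<in>#M. [:-x, 1:])"
    using alg_closed_imp_factorization[of ?p] assms by auto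
  have "size M = Suc (Suc (Suc (Suc 0)))" using M(1) assms by simp
  moreover obtain xs where xs: "mset xs = M" using ex_mset by blast
  ultimately have "length xs = Suc (Suc (Suc (Suc 0)))" by (metis size_mset)
  then obtain t0 t1 t2 t3 where "xs = [t0, t1, t2, t3]"
    by (auto simp: length_Suc_conv)
  then have "M = {#t0, t1, t2, t3#}" using xs by simp
  then have "?p = Polynomial.smult a ([:-t0, 1:] * ([:-t1, 1:] * ([:-t2, 1:] * [:-t3, 1:])))"
    using M(2) assms by (simp add: ac_simps)
  then have "b = - a * (t0 + t1 + t2 + t3)"
    "c = a * (t0*t1 + t0*t2 + t0*t3 + t1*t2 + t1*t3 + t2*t3)"
    "d = - a * (t0*t1*t2 + t0*t1*t3 + t0*t2*t3 + t1*t2*t3)" "e = a * (t0*t1*t2*t3)"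
    by (simp_all add: algebra_simps)
  then show ?thesis by (rule that)
qed

section \<open>Rings on the additive group of integer vectors\<close>

lemma int_pow_vec:
  fixes R :: "(int ^ 'n::finite) ring"
  assumes "cring R" "carrier R = UNIV" "add R = (+)" "zero R = 0"
  shows "[(k::int)] \<cdot>\<^bsub>R\<^esub> x = k *s x"
proof -
  interpret cring R by fact
  have x: "x \<in> carrier R" by (simp add: assms)
  show ?thesis
  proof (induction k rule: int_induct[where k = 0])
    case base
    have "[(0::int)] \<cdot>\<^bsub>R\<^esub> x = zero R"
      by (simp add: add_pow_def int_pow_def)
    then show ?case by (simp add: assms vec_eq_iff)
  next
    case (step1 i)
    then show ?case
      using add.int_pow_mult[OF x, of i 1] x by (simp add: assms vec_eq_iff algebra_simps)
  next
    case (step2 i)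
    then show ?case
      using add.int_pow_mult[OF x, of "i - 1" 1] x by (simp add: assms vec_eq_iff algebra_simps)
  qed
qed

lemma int_comb_axis:
  fixes R :: "(int ^ 'n::finite) ring"
  assumes "cring R" "carrier R = UNIV" "add R = (+)" "zero R = 0"
  shows "int_comb R (\<lambda>j. axis j 1) v = v"
proof -
  interpret cring R by fact
  have "(\<Oplus>\<^bsub>R\<^esub>i\<in>I. g i) = (\<Sum>i\<in>I. g i)" if "finite I" for I and g :: "'n \<Rightarrow> int ^ 'n"
    using that
  proof (induction I rule: finite_induct)
    case (insert i I)
    then show ?case by (subst finsum_insert) (auto simp: assms)
  qed (simp add: assms)
  then have "int_comb R (\<lambda>j. axis j 1) v = (\<Sum>i\<in>UNIV. v $ i *s axis i 1)"
    unfolding int_comb_def by (simp add: int_pow_vec[OF assms])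
  also have "\<dots> = v"
    by (simp add: vec_eq_iff axis_def if_distrib[of "\<lambda>a. _ * a"] cong: if_cong)
  finally show ?thesis .
qed

lemma int_basis_axis:
  fixes R :: "(int ^ 'n::finite) ring"
  assumes "cring R" "carrier R = UNIV" "add R = (+)" "zero R = 0"
  shows "is_int_basis R (\<lambda>j. axis j 1)"
proof -
  have "int_comb R (\<lambda>j. axis j 1) = id" using int_comb_axis[OF assms] by auto
  then show ?thesis by (simp add: is_int_basis_def assms)
qed

definition v4 :: "'a \<Rightarrow> 'a \<Rightarrow> 'a \<Rightarrow> 'a \<Rightarrow> 'a ^ 4" where
  "v4 x0 x1 x2 x3 = (\<chi> i. if i = 0 then x0 else if i = 1 then x1 else if i = 2 then x2 else x3)"

definition v3 :: "'a \<Rightarrow> 'a \<Rightarrow> 'a \<Rightarrow> 'a ^ 3" where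
  "v3 x0 x1 x2 = (\<chi> i. if i = 0 then x0 else if i = 1 then x1 else x2)"

lemma v4_nth [simp]: "v4 x0 x1 x2 x3 $ 0 = x0" "v4 x0 x1 x2 x3 $ 1 = x1" "v4 x0 x1 x2 x3 $ 2 = x2" "v4 x0 x1 x2 x3 $ 3 = x3"
  by (simp_all add: v4_def)

lemma v3_nth [simp]: "v3 x0 x1 x2 $ 0 = x0" "v3 x0 x1 x2 $ 1 = x1" "v3 x0 x1 x2 $ 2 = x2"
  by (simp_all add: v3_def)

lemma axis_nth_4 [simp]: "axis j x $ i = (if i = j then x else 0)"
  by (simp add: axis_def)

text \<open>The rings are given by multiplication tables: \<open>qmul\<close> for the Birch--Merriman basis
  \<open>1, a\<theta>, a\<theta>\<^sup>2 + b\<theta>, - (a\<theta>\<^sup>3 + b\<theta>\<^sup>2 + c\<theta> + d)\<close> of the quartic ring of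
  \<open>a x\<^sup>4 + b x\<^sup>3 + c x\<^sup>2 + d x + e\<close>, and \<open>cmul\<close> for the basis \<open>1, u, u\<^sup>2 - c u\<close>
  of its resolvent, where \<open>u = a (\<theta>\<^sub>0 \<theta>\<^sub>1 + \<theta>\<^sub>2 \<theta>\<^sub>3)\<close> is a root of \<open>u\<^sup>3 - c u\<^sup>2 + m u - n\<close>.\<close>

locale quartic =
  fixes a b c d e :: int
begin

definition qmul :: "int ^ 4 \<Rightarrow> int ^ 4 \<Rightarrow> int ^ 4" where
  "qmul x y = v4
    (x$0 * y$0 - a*d * (x$1 * y$2 + x$2 * y$1) + a*e * (x$1 * y$3 + x$3 * y$1) - (a*e + b*d) * (x$2 * y$2)
      + b*e * (x$2 * y$3 + x$3 * y$2) - c*e * (x$3 * y$3))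
    (x$0 * y$1 + x$1 * y$0 - b * (x$1 * y$1) - c * (x$1 * y$2 + x$2 * y$1) - d * (x$2 * y$2) + e * (x$2 * y$3 + x$3 * y$2))
    (x$0 * y$2 + x$2 * y$0 + a * (x$1 * y$1) - c * (x$2 * y$2) - e * (x$3 * y$3))
    (x$0 * y$3 + x$3 * y$0 - a * (x$1 * y$2 + x$2 * y$1) - b * (x$2 * y$2) - d * (x$3 * y$3))"

definition m where "m = b*d - 4*a*e"
definition n where "n = a*d\<^sup>2 + b\<^sup>2*e - 4*a*c*e"

definition cmul :: "int ^ 3 \<Rightarrow> int ^ 3 \<Rightarrow> int ^ 3" where
  "cmul x y = v3
    (x$0 * y$0 + n * (x$1 * y$2 + x$2 * y$1) - c*n * (x$2 * y$2))
    (x$0 * y$1 + x$1 * y$0 + c * (x$1 * y$1) - m * (x$1 * y$2 + x$2 * y$1) + n * (x$2 * y$2))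
    (x$0 * y$2 + x$2 * y$0 + x$1 * y$1 - m * (x$2 * y$2))"

definition QR :: "(int ^ 4) ring" where
  "QR = \<lparr>carrier = UNIV, mult = qmul, one = axis 0 1, zero = 0, add = (+)\<rparr>"

definition CR :: "(int ^ 3) ring" where
  "CR = \<lparr>carrier = UNIV, mult = cmul, one = axis 0 1, zero = 0, add = (+)\<rparr>"

text \<open>The resolvent map expanded in the basis 1, u, u^2 - c u. Coordinates 1 and 2 are
  \<open>form_A (a, b, c, - d, e)\<close> and \<open>form_B\<close> at the last three coordinates of
  x; coordinate 0 is the remaining integral part.\<close>

definition res :: "int ^ 4 \<Rightarrow> int ^ 3" where
  "res x = v3
    (2 * (x$0)\<^sup>2 - x$0 * (b * x$1 + 2*c * x$2 + d * x$3) + (b*d - 2*a*e) * (x$2)\<^sup>2 + a*d * (x$1 * x$2)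
      + m * (x$1 * x$3) + (c*d - b*e) * (x$2 * x$3))
    (a * (x$1)\<^sup>2 + b * (x$1 * x$2) + c * (x$2)\<^sup>2 - d * (x$2 * x$3) + e * (x$3)\<^sup>2)
    ((x$2)\<^sup>2 + x$1 * x$3)"

lemma cring_QR: "cring QR"
proof (rule cringI)
  show "abelian_group QR"
    by (rule abelian_groupI) (auto simp: QR_def add_ac intro!: exI[of _ "- _"])
  show "comm_monoid QR"
  proof (rule comm_monoidI)
    show "x \<otimes>\<^bsub>QR\<^esub> y \<otimes>\<^bsub>QR\<^esub> z = x \<otimes>\<^bsub>QR\<^esub> (y \<otimes>\<^bsub>QR\<^esub> z)" for x y z
      unfolding vec_eq_iff all_4_0 by (simp add: QR_def qmul_def algebra_simps)
    show "x \<otimes>\<^bsub>QR\<^esub> y = y \<otimes>\<^bsub>QR\<^esub> x" for x y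
      unfolding vec_eq_iff all_4_0 by (simp add: QR_def qmul_def algebra_simps)
    show "\<one>\<^bsub>QR\<^esub> \<otimes>\<^bsub>QR\<^esub> x = x" for x
      unfolding vec_eq_iff all_4_0 by (simp add: QR_def qmul_def)
  qed (auto simp: QR_def)
  show "(x \<oplus>\<^bsub>QR\<^esub> y) \<otimes>\<^bsub>QR\<^esub> z = x \<otimes>\<^bsub>QR\<^esub> z \<oplus>\<^bsub>QR\<^esub> y \<otimes>\<^bsub>QR\<^esub> z" for x y z
    unfolding vec_eq_iff all_4_0 by (simp add: QR_def qmul_def algebra_simps)
qed

lemma cring_CR: "cring CR"
proof (rule cringI)
  show "abelian_group CR"
    by (rule abelian_groupI) (auto simp: CR_def add_ac intro!: exI[of _ "- _"])
  show "comm_monoid CR"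
  proof (rule comm_monoidI)
    show "x \<otimes>\<^bsub>CR\<^esub> y \<otimes>\<^bsub>CR\<^esub> z = x \<otimes>\<^bsub>CR\<^esub> (y \<otimes>\<^bsub>CR\<^esub> z)" for x y z
      unfolding vec_eq_iff all_3_0 by (simp add: CR_def cmul_def algebra_simps)
    show "x \<otimes>\<^bsub>CR\<^esub> y = y \<otimes>\<^bsub>CR\<^esub> x" for x y
      unfolding vec_eq_iff all_3_0 by (simp add: CR_def cmul_def algebra_simps)
    show "\<one>\<^bsub>CR\<^esub> \<otimes>\<^bsub>CR\<^esub> x = x" for x
      unfolding vec_eq_iff all_3_0 by (simp add: CR_def cmul_def)
  qed (auto simp: CR_def)
  show "(x \<oplus>\<^bsub>CR\<^esub> y) \<otimes>\<^bsub>CR\<^esub> z = x \<otimes>\<^bsub>CR\<^esub> z \<oplus>\<^bsub>CR\<^esub> y \<otimes>\<^bsub>CR\<^esub> z" for x y z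
    unfolding vec_eq_iff all_3_0 by (simp add: CR_def cmul_def algebra_simps)
qed

end

text \<open>A nonzero leading coefficient keeps all four roots finite; forms without it are counted
  among the exceptional ones later.\<close>

locale quartic_roots = quartic +
  fixes t0 t1 t2 t3 :: complex
  assumes a0: "a \<noteq> 0"
    and b_eq: "of_int b = - of_int a * (t0 + t1 + t2 + t3)"
    and c_eq: "of_int c = of_int a * (t0*t1 + t0*t2 + t0*t3 + t1*t2 + t1*t3 + t2*t3)"
    and d_eq: "of_int d = - of_int a * (t0*t1*t2 + t0*t1*t3 + t0*t2*t3 + t1*t2*t3)"
    and e_eq: "of_int e = of_int a * (t0*t1*t2*t3)"
    and disc_nz: "quartic_disc (a, b, c, d, e) \<noteq> 0"
begin

definition th :: "4 \<Rightarrow> complex" where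
  "th i = (if i = 0 then t0 else if i = 1 then t1 else if i = 2 then t2 else t3)"

definition E1 :: "complex \<Rightarrow> complex" where "E1 t = of_int a * t"
definition E2 :: "complex \<Rightarrow> complex" where "E2 t = of_int a * t^2 + of_int b * t"
definition E3 :: "complex \<Rightarrow> complex" where "E3 t = - (of_int a * t^3 + of_int b * t^2 + of_int c * t + of_int d)"

lemma th_root: "of_int a * th i^4 + of_int b * th i^3 + of_int c * th i^2 + of_int d * th i + of_int e = 0"
  using exhaust_4_0[of i] unfolding b_eq c_eq d_eq e_eq
  by (elim disjE; hypsubst) (simp_all add: th_def power2_eq_square power3_eq_cube power4_eq_xxxx algebra_simps)

lemma E_table:
  assumes "of_int a * t^4 + of_int b * t^3 + of_int c * t^2 + of_int d * t + of_int e = 0"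
  shows "E1 t * E1 t = of_int a * E2 t - of_int b * E1 t"
    "E1 t * E2 t = - of_int a * E3 t - of_int c * E1 t - of_int a * of_int d"
    "E1 t * E3 t = of_int a * of_int e"
    "E2 t * E2 t = - (of_int a * of_int e + of_int b * of_int d) - of_int d * E1 t - of_int c * E2 t - of_int b * E3 t"
    "E2 t * E3 t = of_int e * E1 t + of_int b * of_int e"
    "E3 t * E3 t = - of_int e * E2 t - of_int c * of_int e - of_int d * E3 t"
proof -
  have e: "of_int e = - (of_int a * t^4 + of_int b * t^3 + of_int c * t^2 + of_int d * t)"
    using assms by (simp only: add_eq_0_iff)
  note d = E1_def E2_def E3_def e power2_eq_square power3_eq_cube power4_eq_xxxx
  show "E1 t * E1 t = of_int a * E2 t - of_int b * E1 t"
    "E1 t * E2 t = - of_int a * E3 t - of_int c * E1 t - of_int a * of_int d"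
    "E1 t * E3 t = of_int a * of_int e"
    "E2 t * E2 t = - (of_int a * of_int e + of_int b * of_int d) - of_int d * E1 t - of_int c * E2 t - of_int b * E3 t"
    "E2 t * E3 t = of_int e * E1 t + of_int b * of_int e"
    "E3 t * E3 t = - of_int e * E2 t - of_int c * of_int e - of_int d * E3 t"
    unfolding d by (simp_all add: algebra_simps)
qed

definition sg :: "4 \<Rightarrow> int ^ 4 \<Rightarrow> complex" where
  "sg i x = of_int (x$0) + of_int (x$1) * E1 (th i) + of_int (x$2) * E2 (th i) + of_int (x$3) * E3 (th i)"

definition U :: "3 \<Rightarrow> complex" where "U j = of_int a * pair_sum th j"

definition tu :: "3 \<Rightarrow> int ^ 3 \<Rightarrow> complex" where
  "tu j x = of_int (x$0) + of_int (x$1) * U j + of_int (x$2) * ((U j)\<^sup>2 - of_int c * U j)"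

lemma U_cubic: "(U j)^3 = of_int c * (U j)^2 - of_int m * U j + of_int n"
  using exhaust_3_0[of j] unfolding m_def n_def of_int_add of_int_diff of_int_mult of_int_power b_eq c_eq d_eq e_eq
  by (elim disjE; hypsubst) (simp_all add: U_def pair_sum_def th_def power2_eq_square power3_eq_cube algebra_simps)

lemma sg_mult: "sg i (qmul x y) = sg i x * sg i y"
proof -
  let ?e1 = "E1 (th i)" and ?e2 = "E2 (th i)" and ?e3 = "E3 (th i)"
  note T = E_table[OF th_root[of i]]
  define x0 x1 x2 x3 y0 y1 y2 y3 :: complex where v: "x0 = of_int (x$0)" "x1 = of_int (x$1)" "x2 = of_int (x$2)" "x3 = of_int (x$3)"
    "y0 = of_int (y$0)" "y1 = of_int (y$1)" "y2 = of_int (y$2)" "y3 = of_int (y$3)"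
  have "sg i x * sg i y = x0*y0 + (x0*y1 + x1*y0) * ?e1 + (x0*y2 + x2*y0) * ?e2 + (x0*y3 + x3*y0) * ?e3
    + (x1*y1) * (?e1 * ?e1) + (x1*y2 + x2*y1) * (?e1 * ?e2) + (x1*y3 + x3*y1) * (?e1 * ?e3)
    + (x2*y2) * (?e2 * ?e2) + (x2*y3 + x3*y2) * (?e2 * ?e3) + (x3*y3) * (?e3 * ?e3)"
    unfolding sg_def v[symmetric] by (simp add: algebra_simps)
  then show ?thesis
    unfolding T by (simp add: sg_def qmul_def v[symmetric] algebra_simps)
qed

lemma tu_mult: "tu j (cmul x y) = tu j x * tu j y"
proof -
  let ?u = "U j"
  have u3: "?u * (?u * ?u) = of_int c * (?u * ?u) - of_int m * ?u + of_int n"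
    using U_cubic[of j] by (simp add: power2_eq_square power3_eq_cube mult.assoc)
  let ?w = "?u\<^sup>2 - of_int c * ?u"
  have T: "?u * ?u = ?w + of_int c * ?u" "?u * ?w = of_int n - of_int m * ?u"
    by (simp_all add: power2_eq_square right_diff_distrib u3 algebra_simps)
  have T3: "?w * ?w = - of_int m * ?w + of_int n * ?u - of_int c * of_int n"
  proof -
    have "?w * ?w = ?u * (?u * ?w) - of_int c * (?u * ?w)"
      by (simp add: power2_eq_square algebra_simps)
    also have "\<dots> = of_int n * ?u - of_int m * (?u * ?u) - of_int c * (of_int n - of_int m * ?u)"
      unfolding T(2) by (simp add: algebra_simps)
    finally show ?thesis by (simp add: power2_eq_square algebra_simps)
  qed
  define w where "w = ?w"
  define x0 x1 x2 y0 y1 y2 :: complex where v: "x0 = of_int (x$0)" "x1 = of_int (x$1)" "x2 = of_int (x$2)"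
    "y0 = of_int (y$0)" "y1 = of_int (y$1)" "y2 = of_int (y$2)"
  have "tu j x * tu j y = x0*y0 + (x0*y1 + x1*y0) * ?u + (x0*y2 + x2*y0) * w
    + (x1*y1) * (?u * ?u) + (x1*y2 + x2*y1) * (?u * w) + (x2*y2) * (w * w)"
    unfolding tu_def v[symmetric] w_def[symmetric] by (simp add: algebra_simps)
  also have "\<dots> = tu j (cmul x y)"
    unfolding T[folded w_def] T3[folded w_def] tu_def w_def[symmetric]
    by (simp add: cmul_def v[symmetric] algebra_simps)
  finally show ?thesis by simp
qed

text \<open>The basis is triangular in the powers of the root, with leading coefficients 1, a, a,
  -a, so the determinant is a Vandermonde determinant times - a^3.\<close>

lemma det_QR: "det (emb_matrix (\<lambda>j. axis j 1) sg) =
   - ((of_int a)^3 * ((t1-t0)*(t2-t0)*(t3-t0)*(t2-t1)*(t3-t1)*(t3-t2)))"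
  by (simp add: det_4_0 emb_matrix_def det4_def sg_def th_def E1_def E2_def E3_def
      power2_eq_square power3_eq_cube algebra_simps)

text \<open>A Vandermonde determinant in the roots of the resolvent. Their differences factor into
  differences of the t_i, which is why R and C have the same discriminant.\<close>

lemma det_CR: "det (emb_matrix (\<lambda>j. axis j 1) tu) =
   - ((of_int a)^3 * ((t1-t0)*(t2-t0)*(t3-t0)*(t2-t1)*(t3-t1)*(t3-t2)))"
proof -
  have "det (emb_matrix (\<lambda>j. axis j 1) tu) = (U 1 - U 0) * (U 2 - U 0) * (U 2 - U 1)"
    by (simp add: det_3_0 emb_matrix_def tu_def power2_eq_square algebra_simps)
  moreover have "U 1 - U 0 = of_int a * ((t0 - t3) * (t2 - t1))" "U 2 - U 0 = of_int a * ((t0 - t2) * (t3 - t1))"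
    "U 2 - U 1 = of_int a * ((t0 - t1) * (t3 - t2))"
    by (simp_all add: U_def pair_sum_def th_def algebra_simps)
  ultimately show ?thesis
    by (simp add: power3_eq_cube) (simp add: algebra_simps)
qed

lemma disc_eq: "of_int (quartic_disc (a, b, c, d, e)) = (det (emb_matrix (\<lambda>j. axis j 1) sg))\<^sup>2"
proof -
  have "of_int (quartic_disc (a, b, c, d, e)) = quartic_disc (of_int a, of_int b, of_int c, of_int d, of_int e :: complex)"
    by simp
  \<comment> \<open>The leading coefficient is put into the first linear factor: r_1 = a and s_1 = -
    a t_0, while the others are x - t_i y.\<close>
  also have "\<dots> = ((of_int a * (- t1) - 1 * (- of_int a * t0)) * (of_int a * (- t2) - 1 * (- of_int a * t0)) * (of_int a * (- t3) - 1 * (- of_int a * t0))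
       * (1 * (- t2) - 1 * (- t1)) * (1 * (- t3) - 1 * (- t1)) * (1 * (- t3) - 1 * (- t2)))\<^sup>2"
    by (rule quartic_disc_factors) (simp_all add: b_eq c_eq d_eq e_eq algebra_simps)
  also have "\<dots> = (det (emb_matrix (\<lambda>j. axis j 1) sg))\<^sup>2"
    unfolding det_QR power2_minus by (rule arg_cong2[where f = power]) (simp_all add: algebra_simps power3_eq_cube)
  finally show ?thesis .
qed

sublocale QR: emb_ring QR "\<lambda>j. axis j 1" sg
proof -
  have br: "based_ring QR (\<lambda>j. axis j 1)"
    by (intro based_ring.intro cring_QR based_ring_axioms.intro int_basis_axis) (simp_all add: QR_def)
  show "emb_ring QR (\<lambda>j. axis j 1) sg"
  proof (rule based_ring.emb_ringI[OF br])
    show "sg i \<in> complex_homs QR" for i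
      by (rule complex_homsI) (auto simp: QR_def sg_mult extensional_def, auto simp: sg_def algebra_simps)
    show "det (emb_matrix (\<lambda>j. axis j 1) sg) \<noteq> 0"
      using disc_eq disc_nz by (metis of_int_eq_0_iff zero_power2)
  qed
qed

sublocale CR: emb_ring CR "\<lambda>j. axis j 1" tu
proof -
  have br: "based_ring CR (\<lambda>j. axis j 1)"
    by (intro based_ring.intro cring_CR based_ring_axioms.intro int_basis_axis) (simp_all add: CR_def)
  show "emb_ring CR (\<lambda>j. axis j 1) tu"
  proof (rule based_ring.emb_ringI[OF br])
    show "tu i \<in> complex_homs CR" for i
      by (rule complex_homsI) (auto simp: CR_def tu_mult extensional_def, auto simp: tu_def algebra_simps)
    show "det (emb_matrix (\<lambda>j. axis j 1) tu) \<noteq> 0"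
      using disc_eq disc_nz det_QR det_CR by (metis of_int_eq_0_iff zero_power2)
  qed
qed

lemma tu_res: "tu j (res x) = pair_sum (\<lambda>i. sg i x) j"
  using exhaust_3_0[of j]
  apply (elim disjE; hypsubst)
  unfolding res_def sg_def tu_def v3_nth m_def of_int_add of_int_diff of_int_mult of_int_power E1_def E2_def E3_def b_eq c_eq d_eq e_eq
  by (simp_all add: pair_sum_def U_def th_def power2_eq_square power3_eq_cube algebra_simps)

sublocale rep_pair QR "\<lambda>j. axis j 1" sg CR "\<lambda>j. axis j 1" tu res "form_A (a, b, c, - d, e)" form_B
proof -
  have rp: "res_pair QR (\<lambda>j. axis j 1) sg CR (\<lambda>j. axis j 1) tu res"
    by unfold_locales (use tu_res det_QR det_CR in \<open>auto simp: QR_def CR_def\<close>)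
  interpret res_pair QR "\<lambda>j. axis j 1" sg CR "\<lambda>j. axis j 1" tu res by (rule rp)
  show "rep_pair QR (\<lambda>j. axis j 1) sg CR (\<lambda>j. axis j 1) tu res (form_A (a, b, c, - d, e)) form_B"
  proof
    fix x y z
    have Q: "[k] \<cdot>\<^bsub>QR\<^esub> u = k *s u" for k :: int and u
      by (rule int_pow_vec[OF cring_QR]) (simp_all add: QR_def)
    have C: "[k] \<cdot>\<^bsub>CR\<^esub> u = k *s u" for k :: int and u
      by (rule int_pow_vec[OF cring_CR]) (simp_all add: CR_def)
    have "lc x y z = v4 0 x y z"
      unfolding lc_def Q vec_eq_iff all_4_0 by (simp add: QR_def)
    then have "res (lc x y z) = [(res (v4 0 x y z) $ 0)] \<cdot>\<^bsub>CR\<^esub> \<one>\<^bsub>CR\<^esub>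
        \<oplus>\<^bsub>CR\<^esub> [(form_A (a, b, c, - d, e) x y z)] \<cdot>\<^bsub>CR\<^esub> axis 1 1 \<oplus>\<^bsub>CR\<^esub> [(form_B x y z)] \<cdot>\<^bsub>CR\<^esub> axis 2 1"
      unfolding C vec_eq_iff all_3_0 by (simp add: CR_def res_def form_B_def algebra_simps)
    then show "\<exists>k::int. res (lc x y z) = [k] \<cdot>\<^bsub>CR\<^esub> \<one>\<^bsub>CR\<^esub>
        \<oplus>\<^bsub>CR\<^esub> [(form_A (a, b, c, - d, e) x y z)] \<cdot>\<^bsub>CR\<^esub> axis 1 1 \<oplus>\<^bsub>CR\<^esub> [(form_B x y z)] \<cdot>\<^bsub>CR\<^esub> axis 2 1"
      by (rule exI)
  qed
qed

lemma pair_in_class: "(QR, CR, res) \<in> quartic_psi (a, b, c, - d, e)"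
  using QR.nondegenerate rank_ring_R is_cubic_resolvent represented_by
  unfolding quartic_psi_def bhargava_class_def resolvent_pairs_def by auto

lemma ring_disc_QR: "ring_disc TYPE(4) QR = quartic_disc (a, b, c, d, e)"
  using QR.ring_disc_det disc_eq by (metis of_int_eq_iff)

end

lemma quartic_roots_exist:
  assumes "a \<noteq> 0" "quartic_disc (a, b, c, d, e) \<noteq> (0::int)"
  obtains t0 t1 t2 t3 where "quartic_roots a b c d e t0 t1 t2 t3"
proof -
  have "complex_of_int a \<noteq> 0" using assms(1) by simp
  from quartic_roots[OF this, of "of_int b" "of_int c" "of_int d" "of_int e"]
  show ?thesis
    using assms that unfolding quartic_roots_def by metis
qed

section \<open>Successive minima of the pair attached to a form\<close>

lemma abs_ln_diff_le:
  fixes x y K :: real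
  assumes "x > 0" "y > 0" "x \<le> K * y" "y \<le> K * x"
  shows "\<bar>ln x - ln y\<bar> \<le> ln K"
proof -
  have "K > 0" using assms by (metis less_le_trans linorder_not_less mult_nonpos_nonneg order_less_imp_le)
  then have "ln x \<le> ln K + ln y" "ln y \<le> ln K + ln x"
    using assms by (simp_all add: ln_mult_pos[symmetric])
  then show ?thesis by simp
qed

lemma power_mult_le:
  fixes t :: complex
  assumes "cmod t \<le> 1" "\<bar>x\<bar> \<le> (Y::real)"
  shows "cmod (of_real x * t ^ k) \<le> Y"
proof -
  have "\<bar>x\<bar> * cmod t ^ k \<le> Y * 1"
    using assms by (intro mult_mono power_le_one) auto
  then show ?thesis by (simp add: norm_mult norm_power)
qed

locale bounded_quartic = quartic_roots +
  fixes Y :: real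
  assumes Y: "Y \<ge> 1" "real_of_int \<bar>a\<bar> \<le> Y" "real_of_int \<bar>b\<bar> \<le> Y" "real_of_int \<bar>c\<bar> \<le> Y"
    "real_of_int \<bar>d\<bar> \<le> Y" "real_of_int \<bar>e\<bar> \<le> Y"
begin

text \<open>Roots may be arbitrarily large when a is small, but the basis elements are not. If
  \<open>cmod t\<close> exceeds 1, the equation rewrites each of them as a polynomial in 1/t with
  coefficients among b, c, d, e.\<close>

lemma E_bounds:
  assumes root: "of_int a * t^4 + of_int b * t^3 + of_int c * t^2 + of_int d * t + of_int e = 0"
  shows "cmod (E1 t) \<le> 4 * Y \<and> cmod (E2 t) \<le> 4 * Y \<and> cmod (E3 t) \<le> 4 * Y"
proof (cases "cmod t \<le> 1")
  case True
  have p: "cmod (of_int x * t ^ k) \<le> Y" if "real_of_int \<bar>x\<bar> \<le> Y" for x k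
    using power_mult_le[OF True, of "real_of_int x" Y k] that by simp
  have "cmod (E1 t) \<le> Y" using p[OF Y(2), of 1] by (simp add: E1_def)
  moreover have "cmod (E2 t) \<le> Y + Y"
    using norm_triangle_mono[OF p[OF Y(2), of 2] p[OF Y(3), of 1]] by (simp add: E2_def)
  moreover have "cmod (E3 t) \<le> Y + Y + Y + Y"
    using norm_triangle_mono[OF norm_triangle_mono[OF norm_triangle_mono[OF p[OF Y(2), of 3] p[OF Y(3), of 2]] p[OF Y(4), of 1]] p[OF Y(5), of 0]]
    unfolding E3_def norm_minus_cancel by simp
  ultimately show ?thesis using Y(1) by linarith
next
  case False
  define r where "r = inverse t"
  have t: "t \<noteq> 0" using False by auto
  have tr: "t * r = 1" using t by (simp add: r_def)
  have r: "cmod r \<le> 1" using False by (simp add: r_def norm_inverse inverse_le_1_iff)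
  have p: "cmod (of_int x * r ^ k) \<le> Y" if "real_of_int \<bar>x\<bar> \<le> Y" for x k
    using power_mult_le[OF r, of "real_of_int x" Y k] that by simp
  have tk: "t ^ (k + l) * r ^ k = t ^ l" for k l
    by (simp add: power_add mult.left_commute mult.commute[of _ "r ^ k"] power_mult_distrib[symmetric] mult.assoc[symmetric] tr[unfolded mult.commute[of t]])
  have e1: "E1 t = - (of_int b * r ^ 0 + of_int c * r ^ 1 + of_int d * r ^ 2 + of_int e * r ^ 3)"
  proof -
    have "(of_int a * t^4 + of_int b * t^3 + of_int c * t^2 + of_int d * t + of_int e) * r ^ 3 = 0"
      unfolding root by simp
    moreover have "t^4 * r^3 = t" "t^3 * r^3 = 1" "t^2 * r^3 = r" "t * r^3 = r^2"
      using tr by (simp_all add: power2_eq_square power3_eq_cube power4_eq_xxxx mult.assoc mult.left_commute[of t r])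
    ultimately have "of_int a * t + of_int b + of_int c * r + of_int d * r^2 + of_int e * r ^ 3 = 0"
      by (simp add: distrib_right mult.assoc)
    then show ?thesis unfolding E1_def eq_neg_iff_add_eq_0 by (simp add: add_ac)
  qed
  have e2: "E2 t = - (of_int c * r ^ 0 + of_int d * r ^ 1 + of_int e * r ^ 2)"
  proof -
    have "E2 t = t * (E1 t + of_int b)" by (simp add: E1_def E2_def power2_eq_square algebra_simps)
    also have "\<dots> = - (of_int c * (t * r) + of_int d * (t * r) * r + of_int e * (t * r) * r ^ 2)"
      unfolding e1 by (simp add: power2_eq_square power3_eq_cube algebra_simps)
    finally show ?thesis unfolding tr by simp
  qed
  have e3: "E3 t = of_int e * r ^ 1"
  proof -
    have "E3 t = - (t * E2 t + of_int c * t + of_int d)"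
      by (simp add: E3_def E2_def power2_eq_square power3_eq_cube algebra_simps)
    also have "\<dots> = of_int d * (t * r) + of_int e * (t * r) * r - of_int d"
      unfolding e2 by (simp add: power2_eq_square algebra_simps)
    finally show ?thesis unfolding tr by simp
  qed
  have "cmod (E1 t) \<le> Y + Y + Y + Y"
    using norm_triangle_mono[OF norm_triangle_mono[OF norm_triangle_mono[OF p[OF Y(3), of 0] p[OF Y(4), of 1]] p[OF Y(5), of 2]] p[OF Y(6), of 3]]
    unfolding e1 norm_minus_cancel .
  moreover have "cmod (E2 t) \<le> Y + Y + Y"
    using norm_triangle_mono[OF norm_triangle_mono[OF p[OF Y(4), of 0] p[OF Y(5), of 1]] p[OF Y(6), of 2]]
    unfolding e2 norm_minus_cancel .
  moreover have "cmod (E3 t) \<le> Y"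
    using p[OF Y(6), of 1] unfolding e3 .
  ultimately show ?thesis using Y(1) by linarith
qed

text \<open>A Cauchy bound for the monic resolvent cubic, whose coefficients are at most Y, 5 Y^2
  and 6 Y^3: the constant 4 works since 4^3 exceeds 4^2 + 5 * 4 + 6.\<close>

lemma U_bound: "cmod (U j) \<le> 4 * Y"
proof (rule ccontr)
  assume nle: "\<not> cmod (U j) \<le> 4 * Y"
  define x where "x = cmod (U j)"
  have x: "x > 4 * Y" using nle by (simp add: x_def)
  have m: "real_of_int \<bar>m\<bar> \<le> 5 * Y\<^sup>2"
  proof -
    have "real_of_int \<bar>m\<bar> \<le> real_of_int \<bar>b\<bar> * real_of_int \<bar>d\<bar> + 4 * (real_of_int \<bar>a\<bar> * real_of_int \<bar>e\<bar>)"
      using abs_triangle_ineq4[of "real_of_int (b * d)" "real_of_int (4 * a * e)"]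
      by (simp add: m_def abs_mult)
    also have "\<dots> \<le> Y * Y + 4 * (Y * Y)"
      using Y by (intro add_mono mult_left_mono mult_mono) auto
    finally show ?thesis by (simp add: power2_eq_square)
  qed
  have n: "real_of_int \<bar>n\<bar> \<le> 6 * Y^3"
  proof -
    have "real_of_int \<bar>n\<bar> \<le> \<bar>real_of_int a * (real_of_int d)\<^sup>2\<bar> + \<bar>(real_of_int b)\<^sup>2 * real_of_int e\<bar> + \<bar>4 * real_of_int a * real_of_int c * real_of_int e\<bar>"
      by (simp add: n_def)
    also have "\<dots> = real_of_int \<bar>a\<bar> * (real_of_int \<bar>d\<bar>)\<^sup>2 + (real_of_int \<bar>b\<bar>)\<^sup>2 * real_of_int \<bar>e\<bar> + 4 * (real_of_int \<bar>a\<bar> * real_of_int \<bar>c\<bar> * real_of_int \<bar>e\<bar>)"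
      by (simp add: abs_mult)
    also have "\<dots> \<le> Y * Y\<^sup>2 + Y\<^sup>2 * Y + 4 * (Y * Y * Y)"
      using Y by (intro add_mono mult_left_mono mult_mono power_mono) auto
    finally show ?thesis by (simp add: power2_eq_square power3_eq_cube)
  qed
  have "x ^ 3 = cmod (of_int c * (U j)^2 - of_int m * U j + of_int n)"
    unfolding U_cubic[symmetric] by (simp add: x_def norm_power)
  also have "\<dots> \<le> cmod (of_int c * (U j)^2) + cmod (of_int m * U j) + cmod (of_int n)"
    by (intro order_trans[OF norm_triangle_ineq] add_mono norm_triangle_ineq4 order_refl)
  also have "\<dots> = real_of_int \<bar>c\<bar> * x^2 + real_of_int \<bar>m\<bar> * x + real_of_int \<bar>n\<bar>"
    by (simp add: x_def norm_mult norm_power)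
  also have "\<dots> \<le> Y * x^2 + (5 * Y\<^sup>2) * x + 6 * Y^3"
    using Y m n x by (intro add_mono mult_right_mono) auto
  also have "\<dots> < x ^ 3"
  proof -
    define s where "s = x - 4 * Y"
    have s: "s > 0" and xs: "x = s + 4 * Y" using x by (auto simp: s_def)
    have "x ^ 3 - (Y * x^2 + (5 * Y\<^sup>2) * x + 6 * Y^3) = s^3 + 11 * s^2 * Y + 35 * s * Y^2 + 22 * Y^3"
      unfolding xs by (simp add: power2_eq_square power3_eq_cube algebra_simps)
    also have "\<dots> > 0" using s Y(1) by (intro add_pos_pos mult_pos_pos zero_less_power) auto
    finally show ?thesis by simp
  qed
  finally show False by simp
qed

text \<open>Column bounds for the two matrices of embeddings. The 20 is 4^2 + 4, from u^2 and c
  u.\<close>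

definition Mq :: "4 \<Rightarrow> real" where "Mq k = (if k = 0 then 1 else 4 * Y)"
definition Mc :: "3 \<Rightarrow> real" where "Mc k = (if k = 0 then 1 else if k = 1 then 4 * Y else 20 * Y\<^sup>2)"

lemma sg_axis: "cmod (sg i (axis k 1)) \<le> Mq k"
  using E_bounds[OF th_root[of i]] exhaust_4_0[of k]
  by (elim disjE; hypsubst) (simp_all add: sg_def Mq_def)

lemma tu_axis: "cmod (tu j (axis k 1)) \<le> Mc k"
proof -
  have "cmod ((U j)\<^sup>2 - of_int c * U j) \<le> (cmod (U j))\<^sup>2 + real_of_int \<bar>c\<bar> * cmod (U j)"
    using norm_triangle_ineq4[of "(U j)\<^sup>2" "of_int c * U j"] by (simp add: norm_mult norm_power)
  also have "\<dots> \<le> (4 * Y)\<^sup>2 + Y * (4 * Y)"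
    using U_bound[of j] Y by (intro add_mono power_mono mult_mono) auto
  finally have "cmod ((U j)\<^sup>2 - of_int c * U j) \<le> 20 * Y\<^sup>2"
    by (simp add: power2_eq_square)
  then show ?thesis
    using U_bound[of j] exhaust_3_0[of k]
    by (elim disjE; hypsubst) (simp_all add: tu_def Mc_def)
qed

abbreviation "rd \<equiv> cmod (det QR.S)"

lemma det_CR_eq: "cmod (det CR.S) = rd"
  unfolding det_QR det_CR ..

text \<open>The constant is 4! * 4^3; the first column consists of ones.\<close>

lemma rd_upper: "rd \<le> 1536 * Y^3"
proof -
  have "rd \<le> fact CARD(4) * (\<Prod>k\<in>UNIV. Mq k)"
    by (rule norm_det_le) (simp add: emb_matrix_def sg_axis)
  also have "(\<Prod>k\<in>UNIV. Mq k) = 64 * Y^3"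
    unfolding UNIV_4_0 by (simp add: Mq_def power3_eq_cube)
  finally show ?thesis by (simp add: fact_numeral)
qed

lemma rd_pos: "rd > 0" using QR.det_S by simp

lemma prod_Mq: "j \<noteq> 0 \<Longrightarrow> (\<Prod>k\<in>UNIV - {j}. Mq k) = 16 * Y\<^sup>2"
proof -
  assume j: "j \<noteq> 0"
  have "(\<Prod>k\<in>UNIV. Mq k) = Mq j * (\<Prod>k\<in>UNIV - {j}. Mq k)"
    by (subst prod.remove[of _ j]) auto
  moreover have "(\<Prod>k\<in>UNIV. Mq k) = 4 * Y * (16 * Y\<^sup>2)"
    unfolding UNIV_4_0 by (simp add: Mq_def power2_eq_square)
  ultimately show ?thesis using j Y(1) by (simp add: Mq_def)
qed

lemma prod_Mc: "(\<Prod>k\<in>UNIV - {1}. Mc k) = 20 * Y\<^sup>2" "(\<Prod>k\<in>UNIV - {2}. Mc k) = 4 * Y"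
proof -
  have "(\<Prod>k\<in>UNIV. Mc k) = 80 * Y^3"
    unfolding UNIV_3_0 by (simp add: Mc_def power2_eq_square power3_eq_cube)
  moreover have "(\<Prod>k\<in>UNIV. Mc k) = Mc j * (\<Prod>k\<in>UNIV - {j}. Mc k)" for j
    by (subst prod.remove[of _ j]) auto
  ultimately have "Mc j * (\<Prod>k\<in>UNIV - {j}. Mc k) = 80 * Y^3" for j by metis
  from this[of 1] this[of 2] show "(\<Prod>k\<in>UNIV - {1}. Mc k) = 20 * Y\<^sup>2" "(\<Prod>k\<in>UNIV - {2}. Mc k) = 4 * Y"
    using Y(1) by (simp_all add: Mc_def power2_eq_square power3_eq_cube)
qed

lemma carrier_UNIV [simp]: "carrier QR = UNIV" "carrier CR = UNIV"
  by (simp_all add: QR_def CR_def)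

lemma coords_QR: "coords QR (\<lambda>j. axis j 1) x = x"
  using QR.coords_int_comb[of x] int_comb_axis[OF cring_QR] by (simp add: QR_def)

lemma coords_CR: "coords CR (\<lambda>j. axis j 1) x = x"
  using CR.coords_int_comb[of x] int_comb_axis[OF cring_CR] by (simp add: CR_def)

lemma QR_coord_bound:
  assumes "\<And>i. cmod (sg i x) \<le> r" "j \<noteq> 0"
  shows "real_of_int \<bar>x $ j\<bar> * rd \<le> 384 * r * Y\<^sup>2"
  using QR.coords_bound[of x Mq r j] assms sg_axis
  by (simp add: coords_QR prod_Mq fact_numeral)

lemma CR_coord_bound:
  assumes "\<And>i. cmod (tu i x) \<le> r"
  shows "real_of_int \<bar>x $ 1\<bar> * rd \<le> 120 * r * Y\<^sup>2" "real_of_int \<bar>x $ 2\<bar> * rd \<le> 24 * r * Y"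
proof -
  show "real_of_int \<bar>x $ 1\<bar> * rd \<le> 120 * r * Y\<^sup>2" "real_of_int \<bar>x $ 2\<bar> * rd \<le> 24 * r * Y"
    using CR.coords_bound[of x Mc r 1] CR.coords_bound[of x Mc r 2] assms tu_axis
    by (simp_all add: coords_CR prod_Mc fact_numeral det_CR_eq)
qed

lemma nonscalar:
  assumes "\<forall>k. x \<noteq> k *s axis 0 1"
  shows "\<exists>j. j \<noteq> 0 \<and> x $ j \<noteq> (0::int)"
proof (rule ccontr)
  assume "\<not> ?thesis"
  then have "x = x $ 0 *s axis 0 1" by (auto simp: vec_eq_iff axis_def)
  then show False using assms by blast
qed

lemma sg_le_length: "cmod (sg i x) \<le> 2 * ring_length TYPE(4) QR x"
  using QR.cmod_le_ring_length[of i x] by simp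

lemma tu_le_length: "cmod (tu i x) \<le> 2 * ring_length TYPE(3) CR x"
proof -
  have "sqrt 3 * ring_length TYPE(3) CR x \<le> 2 * ring_length TYPE(3) CR x"
    by (intro mult_right_mono CR.ring_length_nonneg) (simp add: real_le_lsqrt)
  then show ?thesis using CR.cmod_le_ring_length[of i x] by simp
qed

lemma one_le_abs: "x \<noteq> 0 \<Longrightarrow> rd \<le> real_of_int \<bar>x\<bar> * rd"
proof -
  assume "x \<noteq> 0"
  then have "1 \<le> real_of_int \<bar>x\<bar>" by linarith
  then show ?thesis using rd_pos by (simp add: mult_right_mono[of 1, simplified])
qed

text \<open>Some witness has a nonzero coordinate at an index other than 0, and an integer that is
  not 0 is at least 1 in absolute value. The constant is 2 * 4! * 4^2, with 2 the square root of the
  rank.\<close>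

lemma succ_min_QR_lower:
  assumes i: "1 \<le> i" "i \<le> 3"
  shows "rd \<le> 768 * Y\<^sup>2 * succ_min TYPE(4) QR i"
proof -
  obtain v where v: "QR.sm_witness i v (succ_min TYPE(4) QR i)"
    using QR.succ_min_witness[of i] i by auto
  obtain j where j: "j \<le> i" "\<forall>k. v j \<noteq> k *s axis 0 1"
    using QR.sm_witness_nonscalar[OF v i(1), of "axis 0 1"] unfolding coords_QR by blast
  obtain k where k: "k \<noteq> 0" "v j $ k \<noteq> 0" using nonscalar[OF j(2)] by blast
  have len: "ring_length TYPE(4) QR (v j) \<le> succ_min TYPE(4) QR i"
    using v j(1) by (auto simp: QR.sm_witness_def)
  have "rd \<le> real_of_int \<bar>v j $ k\<bar> * rd" by (rule one_le_abs[OF k(2)])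
  also have "\<dots> \<le> 384 * (2 * succ_min TYPE(4) QR i) * Y\<^sup>2"
    by (rule QR_coord_bound[OF order_trans[OF sg_le_length] k(1)]) (use len in simp)
  finally show ?thesis by (simp add: mult_ac)
qed

text \<open>For the first minimum the nonzero coordinate may be either one, and the weaker of the
  two bounds is used. For the second, three independent elements cannot all have coordinate 2 equal
  to zero, and the bound for that coordinate carries only one factor Y.\<close>

lemma succ_min_CR_lower:
  "rd \<le> 240 * Y\<^sup>2 * succ_min TYPE(3) CR 1" "rd \<le> 48 * Y * succ_min TYPE(3) CR 2"
proof -
  obtain v where v: "CR.sm_witness 1 v (succ_min TYPE(3) CR 1)"
    using CR.succ_min_witness[of 1] by auto
  obtain j where j: "j \<le> 1" "\<forall>k. v j \<noteq> k *s axis 0 1"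
    using CR.sm_witness_nonscalar[OF v, of "axis 0 1"] unfolding coords_CR by auto
  obtain k where k: "k \<noteq> 0" "v j $ k \<noteq> 0" using nonscalar[OF j(2)] by blast
  have len: "ring_length TYPE(3) CR (v j) \<le> succ_min TYPE(3) CR 1"
    using v j(1) by (auto simp: CR.sm_witness_def)
  have l0: "0 \<le> succ_min TYPE(3) CR 1" using len CR.ring_length_nonneg order_trans by blast
  note b = CR_coord_bound[OF order_trans[OF tu_le_length, of "v j" "2 * succ_min TYPE(3) CR 1"]]
  have "48 * (succ_min TYPE(3) CR 1 * Y) \<le> 240 * (succ_min TYPE(3) CR 1 * Y\<^sup>2)"
    using l0 Y(1) by (intro mult_mono mult_left_mono) (auto simp: power2_eq_square)
  then have "real_of_int \<bar>v j $ k\<bar> * rd \<le> 240 * Y\<^sup>2 * succ_min TYPE(3) CR 1"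
    using b len k(1) exhaust_3_0[of k] by (auto simp: mult_ac)
  then show "rd \<le> 240 * Y\<^sup>2 * succ_min TYPE(3) CR 1"
    using one_le_abs[OF k(2)] by linarith
next
  obtain v where v: "CR.sm_witness 2 v (succ_min TYPE(3) CR 2)"
    using CR.succ_min_witness[of 2] by auto
  have two: "{..2} = {..<3::nat}" by auto
  let ?e = "\<lambda>i::3. if i = 0 then 0 else if i = 1 then 1 else 2 :: nat"
  have "\<exists>j\<le>2. v j $ 2 \<noteq> 0"
  proof (rule ccontr)
    assume "\<not> ?thesis"
    then have "det (\<chi> k c. coords CR (\<lambda>j. axis j 1) (v (?e c)) $ k) = 0"
      unfolding coords_CR det_3_0 by simp
    then show False
      using CR.sm_witness_det[OF bij_3_nat[folded two] v] by simp
  qed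
  then obtain j where j: "j \<le> 2" "v j $ 2 \<noteq> 0" by blast
  have len: "ring_length TYPE(3) CR (v j) \<le> succ_min TYPE(3) CR 2"
    using v j(1) by (auto simp: CR.sm_witness_def)
  have "rd \<le> real_of_int \<bar>v j $ 2\<bar> * rd" by (rule one_le_abs[OF j(2)])
  also have "\<dots> \<le> 24 * (2 * succ_min TYPE(3) CR 2) * Y"
    by (rule CR_coord_bound(2)[OF order_trans[OF tu_le_length]]) (use len in simp)
  finally show "rd \<le> 48 * Y * succ_min TYPE(3) CR 2" by (simp add: mult_ac)
qed

lemma succ_min_QR_upper:
  assumes "i \<le> 3"
  shows "succ_min TYPE(4) QR i \<le> 4 * Y"
proof -
  let ?e = "\<lambda>n::nat. if n = 0 then 0 else if n = 1 then 1 else if n = 2 then 2 else 3 :: 4"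
  have "{..i} \<subseteq> {..<4}" using assms by auto
  then have "inj_on ?e {..i}"
    using bij_nat_4 by (auto simp: bij_betw_def intro: inj_on_subset)
  then have ind: "int_independent QR {..i} (\<lambda>j. axis (?e j) 1)"
    by (rule QR.basis_independent)
  have M: "Mq k \<le> 4 * Y" for k using Y(1) by (simp add: Mq_def)
  have len: "ring_length TYPE(4) QR (axis k 1) \<le> 4 * Y" for k
    by (rule QR.ring_length_le) (rule order_trans[OF sg_axis M])
  show ?thesis
    by (rule QR.succ_min_le[of i "\<lambda>j. axis (?e j) 1"]) (use ind len in \<open>simp add: QR.sm_witness_def\<close>)
qed

lemma succ_min_CR_upper: "succ_min TYPE(3) CR 1 \<le> 4 * Y" "succ_min TYPE(3) CR 2 \<le> 20 * Y\<^sup>2"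
proof -
  let ?e = "\<lambda>n::nat. if n = 0 then 0 else if n = 1 then 1 else 2 :: 3"
  have len: "ring_length TYPE(3) CR (axis k 1) \<le> Mc k" for k
    by (rule CR.ring_length_le) (rule tu_axis)
  have ind: "int_independent CR {..i} (\<lambda>j. axis (?e j) 1)" if "i \<le> 2" for i
  proof (rule CR.basis_independent)
    have "{..i} \<subseteq> {..<3}" using that by auto
    then show "inj_on ?e {..i}"
      using bij_nat_3 by (auto simp: bij_betw_def intro: inj_on_subset)
  qed
  have M1: "Mc (?e j) \<le> 4 * Y" if "j \<le> 1" for j using that Y(1) by (auto simp: Mc_def)
  show "succ_min TYPE(3) CR 1 \<le> 4 * Y"
    by (rule CR.succ_min_le[of 1 "\<lambda>j. axis (?e j) 1"])
      (use ind[of 1] order_trans[OF len M1] in \<open>auto simp: CR.sm_witness_def\<close>)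
  have "Y \<le> Y\<^sup>2" "1 \<le> Y\<^sup>2" using Y(1) by (simp_all add: power2_eq_square mult_left_mono[of 1 Y Y, simplified] one_le_power[of Y 2, unfolded power2_eq_square])
  then have M2: "Mc k \<le> 20 * Y\<^sup>2" for k by (simp add: Mc_def)
  show "succ_min TYPE(3) CR 2 \<le> 20 * Y\<^sup>2"
    by (rule CR.succ_min_le[of 2 "\<lambda>j. axis (?e j) 1"])
      (use ind[of 2] order_trans[OF len M2] in \<open>auto simp: CR.sm_witness_def\<close>)
qed

lemma abs_ln_succ_min:
  assumes \<kappa>: "0 < \<kappa>" "\<kappa> \<le> 1" "\<kappa> * Y^3 \<le> rd"
  shows "1 \<le> i \<Longrightarrow> i \<le> 3 \<Longrightarrow> \<bar>ln (succ_min TYPE(4) QR i) - ln Y\<bar> \<le> ln (1536 / \<kappa>)"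
    "\<bar>ln (succ_min TYPE(3) CR 1) - ln Y\<bar> \<le> ln (1536 / \<kappa>)"
    "\<bar>ln (succ_min TYPE(3) CR 2) - 2 * ln Y\<bar> \<le> ln (1536 / \<kappa>)"
    "\<bar>ln rd - 3 * ln Y\<bar> \<le> ln (1536 / \<kappa>)"
proof -
  have Yp: "Y > 0" using Y(1) by simp
  have lnY: "2 * ln Y = ln (Y\<^sup>2)" "3 * ln Y = ln (Y^3)"
    using Yp by (simp_all add: ln_realpow)
  \<comment> \<open>\<open>Y^k\<close> is the expected size and \<open>Y^l\<close> the complementary
    power in the lower bound. All constants are at most 1536, so one error term serves every
    quantity.\<close>
  have key: "\<bar>ln x - ln (Y^k)\<bar> \<le> ln (1536 / \<kappa>)"
    if "rd \<le> C * Y^l * x" "l + k = 3" "x \<le> C' * Y^k" "0 < C" "C \<le> 1536" "C' \<le> 1536" for x C C' k l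
  proof -
    have "\<kappa> * Y^k * Y^l \<le> C * x * Y^l"
    proof -
      have "Y^3 = Y^k * Y^l" unfolding that(2)[symmetric] by (simp add: power_add)
      then show ?thesis using that(1) \<kappa>(3) by (simp add: mult_ac)
    qed
    then have 1: "\<kappa> * Y^k \<le> C * x" using Yp by simp
    have Yk: "0 < Y^k" using Yp by simp
    have Cx: "0 < C * x" using 1 \<kappa>(1) Yk by (meson less_le_trans mult_pos_pos)
    have x: "0 < x" using Cx that(4) by (simp add: zero_less_mult_iff)
    have "\<kappa> * Y^k \<le> 1536 * x" using 1 that(5) x by (meson mult_right_mono order_trans less_imp_le)
    then have "Y^k \<le> 1536 / \<kappa> * x" using \<kappa>(1) by (simp add: field_simps)
    moreover have "x \<le> 1536 / \<kappa> * Y^k"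
    proof -
      have "1536 \<le> 1536 / \<kappa>" using \<kappa> by (simp add: field_simps)
      then have "C' * Y^k \<le> 1536 / \<kappa> * Y^k" using that(6) Yk by (intro mult_right_mono) auto
      then show ?thesis using that(3) by linarith
    qed
    ultimately show ?thesis using x Yk by (intro abs_ln_diff_le)
  qed
  show "1 \<le> i \<Longrightarrow> i \<le> 3 \<Longrightarrow> \<bar>ln (succ_min TYPE(4) QR i) - ln Y\<bar> \<le> ln (1536 / \<kappa>)"
    using key[of 768 2 "succ_min TYPE(4) QR i" 1 4] succ_min_QR_lower[of i] succ_min_QR_upper[of i] by simp
  show "\<bar>ln (succ_min TYPE(3) CR 1) - ln Y\<bar> \<le> ln (1536 / \<kappa>)"
    using key[of 240 2 "succ_min TYPE(3) CR 1" 1 4] succ_min_CR_lower succ_min_CR_upper by simp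
  show "\<bar>ln (succ_min TYPE(3) CR 2) - 2 * ln Y\<bar> \<le> ln (1536 / \<kappa>)"
    using key[of 48 1 "succ_min TYPE(3) CR 2" 2 20] succ_min_CR_lower succ_min_CR_upper by (simp add: lnY)
  show "\<bar>ln rd - 3 * ln Y\<bar> \<le> ln (1536 / \<kappa>)"
    using key[of 1 0 rd 3 1536] rd_upper by (simp add: lnY)
qed

text \<open>The base of the logarithm is \<open>rd\<^sup>2\<close>, so the deviations from 1/6 and
  1/3 have denominator \<open>6 * ln rd\<close>. Writing L for the common logarithmic error, the
  numerators are at most 4 L and 5 L, covered by 6 L.\<close>

lemma close_pair:
  assumes \<kappa>: "0 < \<kappa>" "\<kappa> \<le> 1" "\<kappa> * Y^3 \<le> rd" and rd: "ln rd > 0"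
    and \<epsilon>: "ln (1536 / \<kappa>) / ln rd \<le> \<epsilon> / ln T"
  shows "close (1/6, 1/6, 1/6, 1/6, 1/3) \<epsilon> T (QR, CR, res)"
proof -
  let ?L = "ln (1536 / \<kappa>)"
  note b = abs_ln_succ_min[OF \<kappa>]
  have \<Delta>: "real_of_int \<bar>ring_disc TYPE(4) QR\<bar> = rd\<^sup>2" by (rule QR.abs_ring_disc)
  have lg: "log (rd\<^sup>2) x = ln x / (2 * ln rd)" for x
    by (simp add: log_def ln_realpow rd_pos)
  have one: "\<bar>log (rd\<^sup>2) x - 1/6\<bar> \<le> \<epsilon> / ln T" if "\<bar>ln x - ln Y\<bar> \<le> ?L" for x
  proof -
    have "log (rd\<^sup>2) x - 1/6 = (3 * ln x - ln rd) / (6 * ln rd)"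
      unfolding lg using rd by (simp add: field_simps)
    then have "\<bar>log (rd\<^sup>2) x - 1/6\<bar> = \<bar>3 * ln x - ln rd\<bar> / (6 * ln rd)"
      using rd by (simp add: abs_divide)
    also have "\<dots> \<le> (6 * ?L) / (6 * ln rd)"
      using rd that b(4) by (intro divide_right_mono) linarith+
    finally show ?thesis using \<epsilon> by simp
  qed
  have two: "\<bar>log (rd\<^sup>2) x - 1/3\<bar> \<le> \<epsilon> / ln T" if "\<bar>ln x - 2 * ln Y\<bar> \<le> ?L" for x
  proof -
    have "log (rd\<^sup>2) x - 1/3 = (3 * ln x - 2 * ln rd) / (6 * ln rd)"
      unfolding lg using rd by (simp add: field_simps)
    then have "\<bar>log (rd\<^sup>2) x - 1/3\<bar> = \<bar>3 * ln x - 2 * ln rd\<bar> / (6 * ln rd)"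
      using rd by (simp add: abs_divide)
    also have "\<dots> \<le> (6 * ?L) / (6 * ln rd)"
      using rd that b(4) by (intro divide_right_mono) linarith+
    finally show ?thesis using \<epsilon> by simp
  qed
  show ?thesis
    unfolding close.simps Let_def \<Delta>
    using one[OF b(1)[of 1]] one[OF b(1)[of 2]] one[OF b(1)[of 3]] one[OF b(2)] two[OF b(3)] by simp
qed

end

section \<open>Forms of small discriminant\<close>

definition int_ball :: "real \<Rightarrow> real \<Rightarrow> int set" where
  "int_ball r h = {x. \<bar>real_of_int x - r\<bar> \<le> h}"

lemma int_ball_eq: "int_ball r h = {\<lceil>r - h\<rceil>..\<lfloor>r + h\<rfloor>}"
  by (auto simp: int_ball_def abs_le_iff ceiling_le_iff le_floor_iff)

lemma finite_int_ball [simp]: "finite (int_ball r h)"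
  by (simp add: int_ball_eq)

lemma card_int_ball_le:
  assumes "h \<ge> 0"
  shows "real (card (int_ball r h)) \<le> 2 * h + 1"
proof -
  have "real_of_int (\<lfloor>r + h\<rfloor> - \<lceil>r - h\<rceil> + 1) \<le> 2 * h + 1"
    using of_int_floor_le[of "r + h"] le_of_int_ceiling[of "r - h"] unfolding of_int_add of_int_diff of_int_1 by linarith
  then show ?thesis
    using assms unfolding int_ball_eq card_atLeastAtMost_int by (simp add: of_nat_nat)
qed

lemma card_int_ball_ge: "h \<le> real (card (int_ball 0 h))"
proof (cases "h \<ge> 0")
  case True
  have z: "0 \<le> \<lfloor>h\<rfloor>" using True by simp
  have "card (int_ball 0 h) = nat (2 * \<lfloor>h\<rfloor> + 1)"
    unfolding int_ball_eq card_atLeastAtMost_int by (simp add: ceiling_minus)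
  then have "real (card (int_ball 0 h)) = 2 * real_of_int \<lfloor>h\<rfloor> + 1"
    using z by (simp add: of_nat_nat)
  moreover have "0 \<le> real_of_int \<lfloor>h\<rfloor>" using z by simp
  ultimately show ?thesis by linarith
qed simp

text \<open>In the factorization over the complex numbers, a product at most h^3 has a factor at
  most h, so the integer lies within h of the real part of a root.\<close>

lemma cubic_small_values:
  fixes p0 p1 p2 p3 \<eta> h :: real
  assumes p3: "p3 \<noteq> 0" and h: "h \<ge> 0" and \<eta>: "\<eta> \<le> \<bar>p3\<bar> * h ^ 3"
  shows "finite {x::int. \<bar>p3 * x^3 + p2 * x^2 + p1 * x + p0\<bar> \<le> \<eta>}"
    "real (card {x::int. \<bar>p3 * x^3 + p2 * x^2 + p1 * x + p0\<bar> \<le> \<eta>}) \<le> 3 * (2 * h + 1)"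
proof -
  let ?p = "[:complex_of_real p0, complex_of_real p1, complex_of_real p2, complex_of_real p3:]"
  let ?A = "{x::int. \<bar>p3 * x^3 + p2 * x^2 + p1 * x + p0\<bar> \<le> \<eta>}"
  obtain M where M: "size M = Polynomial.degree ?p" "?p = Polynomial.smult (poly.coeff ?p (Polynomial.degree ?p)) (\<Prod>x\<in>#M. [:-x, 1:])"
    using alg_closed_imp_factorization[of ?p] p3 by auto
  obtain xs where xs: "mset xs = M" using ex_mset by blast
  have "length xs = Suc (Suc (Suc 0))" using M(1) p3 by (simp flip: xs)
  then obtain r1 r2 r3 where "xs = [r1, r2, r3]"
    by (auto simp: length_Suc_conv)
  then have "M = {#r1, r2, r3#}" using xs by simp
  then have fact: "?p = Polynomial.smult (complex_of_real p3) ([:-r1, 1:] * ([:-r2, 1:] * [:-r3, 1:]))"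
    using M(2) p3 by (simp add: ac_simps)
  have sub: "?A \<subseteq> int_ball (Re r1) h \<union> int_ball (Re r2) h \<union> int_ball (Re r3) h"
  proof
    fix x :: int assume x: "x \<in> ?A"
    define z where "z = complex_of_int x"
    have "complex_of_real (p3 * x^3 + p2 * x^2 + p1 * x + p0) = poly ?p z"
      by (simp add: z_def power2_eq_square power3_eq_cube algebra_simps)
    also have "\<dots> = complex_of_real p3 * ((z - r1) * ((z - r2) * (z - r3)))"
      unfolding fact by (simp add: algebra_simps)
    finally have "\<bar>p3 * x^3 + p2 * x^2 + p1 * x + p0\<bar> = \<bar>p3\<bar> * (cmod (z - r1) * (cmod (z - r2) * cmod (z - r3)))"
      by (metis norm_mult norm_of_real)
    then have "\<bar>p3\<bar> * (cmod (z - r1) * (cmod (z - r2) * cmod (z - r3))) \<le> \<bar>p3\<bar> * h ^ 3"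
      using x \<eta> by simp
    then have le: "cmod (z - r1) * (cmod (z - r2) * cmod (z - r3)) \<le> h ^ 3"
      using p3 by simp
    have "cmod (z - r1) \<le> h \<or> cmod (z - r2) \<le> h \<or> cmod (z - r3) \<le> h"
    proof (rule ccontr)
      assume "\<not> ?thesis"
      then have "h * (h * h) < cmod (z - r1) * (cmod (z - r2) * cmod (z - r3))"
        using h by (intro mult_strict_mono mult_nonneg_nonneg) auto
      then show False using le by (simp add: power3_eq_cube mult.assoc)
    qed
    moreover have R: "\<bar>real_of_int x - Re r\<bar> \<le> cmod (z - r)" for r
      using abs_Re_le_cmod[of "z - r"] by (simp add: z_def)
    ultimately have "\<bar>real_of_int x - Re r1\<bar> \<le> h \<or> \<bar>real_of_int x - Re r2\<bar> \<le> h \<or> \<bar>real_of_int x - Re r3\<bar> \<le> h"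
      using R[of r1] R[of r2] R[of r3] by linarith
    then show "x \<in> int_ball (Re r1) h \<union> int_ball (Re r2) h \<union> int_ball (Re r3) h"
      by (simp add: int_ball_def)
  qed
  show "finite ?A" by (rule finite_subset[OF sub]) simp
  have "card ?A \<le> card (int_ball (Re r1) h) + card (int_ball (Re r2) h) + card (int_ball (Re r3) h)"
    using card_mono[OF _ sub] card_Un_le[of "int_ball (Re r1) h \<union> int_ball (Re r2) h" "int_ball (Re r3) h"]
      card_Un_le[of "int_ball (Re r1) h" "int_ball (Re r2) h"] by simp
  then have "real (card ?A) \<le> real (card (int_ball (Re r1) h)) + real (card (int_ball (Re r2) h)) + real (card (int_ball (Re r3) h))"
    by simp
  also have "\<dots> \<le> (2 * h + 1) + (2 * h + 1) + (2 * h + 1)"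
    by (intro add_mono card_int_ball_le h)
  finally show "real (card ?A) \<le> 3 * (2 * h + 1)" by simp
qed

definition height_box :: "real \<Rightarrow> binary_quartic set" where
  "height_box Y = (let I = int_ball 0 Y in I \<times> I \<times> I \<times> I \<times> I)"

lemma finite_box [simp]: "finite (height_box Y)"
  by (simp add: height_box_def Let_def)

lemma card_box: "card (height_box Y) = card (int_ball 0 Y) ^ 5"
  by (simp add: height_box_def Let_def card_cartesian_product power_numeral_reduce)

lemma in_box_iff: "f \<in> height_box Y \<longleftrightarrow> coeff_height f \<le> Y"
proof -
  obtain a b c d e where f: "f = (a, b, c, d, e)" by (cases f)
  have i: "x \<in> int_ball 0 Y \<longleftrightarrow> \<bar>x\<bar> \<le> \<lfloor>Y\<rfloor>" for x
    by (simp add: int_ball_def le_floor_iff)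
  have "coeff_height f \<le> Y \<longleftrightarrow> Max {\<bar>a\<bar>, \<bar>b\<bar>, \<bar>c\<bar>, \<bar>d\<bar>, \<bar>e\<bar>} \<le> \<lfloor>Y\<rfloor>"
    unfolding f coeff_height.simps le_floor_iff ..
  also have "\<dots> \<longleftrightarrow> (\<forall>x\<in>{\<bar>a\<bar>, \<bar>b\<bar>, \<bar>c\<bar>, \<bar>d\<bar>, \<bar>e\<bar>}. x \<le> \<lfloor>Y\<rfloor>)"
    by (rule Max_le_iff) simp_all
  also have "\<dots> \<longleftrightarrow> f \<in> height_box Y"
    unfolding f height_box_def Let_def by (simp add: i)
  finally show ?thesis ..
qed

definition bad_forms :: "real \<Rightarrow> real \<Rightarrow> binary_quartic set" where
  "bad_forms \<delta> Y = {f \<in> height_box Y. fst f = 0 \<or> real_of_int \<bar>quartic_disc f\<bar> < \<delta> * Y ^ 6}"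

text \<open>Forms with e of size at most \<mu> Y make up \<open>B1\<close>. For the others,
  \<open>K\<close> is the fibre over (b, c, d, e): the discriminant is a cubic in a whose leading
  coefficient exceeds 256 (\<mu> Y)^3 in absolute value, so \<open>cubic_small_values\<close> with h
  = \<mu> Y applies. The fibre bound is 6 h + 3, plus one for a = 0.\<close>

lemma card_bad_le:
  assumes Y: "Y > 0" and \<mu>: "\<mu> > 0" and \<delta>: "\<delta> \<le> 256 * \<mu> ^ 6"
  shows "real (card (bad_forms \<delta> Y)) \<le> real (card (int_ball 0 Y)) ^ 4 * (8 * \<mu> * Y + 5)"
proof -
  let ?I = "int_ball 0 Y" and ?J = "int_ball 0 (\<mu> * Y)"
  define N where "N = real (card ?I)"
  define h where "h = \<mu> * Y"
  have h: "h \<ge> 0" using Y \<mu> by (simp add: h_def)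
  define B1 where "B1 = ?I \<times> ?I \<times> ?I \<times> ?I \<times> ?J"
  define K where "K = (\<lambda>(b, c, d, e). {a \<in> ?I. e \<notin> ?J \<and> (a = 0 \<or> real_of_int \<bar>quartic_disc (a, b, c, d, e)\<bar> < \<delta> * Y ^ 6)})"
  define B2 where "B2 = (SIGMA x:?I \<times> ?I \<times> ?I \<times> ?I. K x)"
  have sub: "bad_forms \<delta> Y \<subseteq> B1 \<union> (\<lambda>(x, a). (a, x)) ` B2"
  proof
    fix f assume f: "f \<in> bad_forms \<delta> Y"
    obtain a b c d e where fe: "f = (a, b, c, d, e)" by (cases f)
    show "f \<in> B1 \<union> (\<lambda>(x, a). (a, x)) ` B2"
    proof (cases "e \<in> ?J")
      case True
      then show ?thesis using f by (auto simp: fe bad_forms_def height_box_def Let_def B1_def)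
    next
      case False
      then have "((b, c, d, e), a) \<in> B2" using f by (auto simp: fe bad_forms_def height_box_def Let_def B2_def K_def)
      then have "(\<lambda>(x, a). (a, x)) ((b, c, d, e), a) \<in> (\<lambda>(x, a). (a, x)) ` B2" by (rule imageI)
      then show ?thesis by (simp add: fe)
    qed
  qed
  have finK: "finite (K x)" for x by (cases x) (simp add: K_def)
  have finB2: "finite B2" unfolding B2_def by (intro finite_SigmaI) (simp_all add: finK)
  have c1: "real (card B1) \<le> N ^ 4 * (2 * h + 1)"
  proof -
    have "real (card B1) = N ^ 4 * real (card ?J)"
      by (simp add: B1_def card_cartesian_product N_def power_numeral_reduce)
    also have "\<dots> \<le> N ^ 4 * (2 * h + 1)"
      unfolding h_def[symmetric] by (intro mult_left_mono card_int_ball_le h) (simp add: N_def)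
    finally show ?thesis .
  qed
  have cK: "real (card (K x)) \<le> 6 * h + 4" for x
  proof -
    obtain b c d e where x: "x = (b, c, d, e)" by (cases x)
    show ?thesis
    proof (cases "e \<in> ?J")
      case True
      then show ?thesis using h by (simp add: K_def x)
    next
      case False
      define p3 p2 p1 p0 :: real where p:
        "p3 = real_of_int (256 * e^3)" "p2 = real_of_int (144 * c * d^2 * e - 192 * b * d * e^2 - 128 * c^2 * e^2 - 27 * d^4)"
        "p1 = real_of_int (144 * b^2 * c * e^2 - 6 * b^2 * d^2 * e - 80 * b * c^2 * d * e + 18 * b * c * d^3 + 16 * c^4 * e - 4 * c^3 * d^2)"
        "p0 = real_of_int (18 * b^3 * c * d * e - 27 * b^4 * e^2 - 4 * b^3 * d^3 - 4 * b^2 * c^3 * e + b^2 * c^2 * d^2)"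
      have e: "\<bar>real_of_int e\<bar> > h" using False by (simp add: int_ball_def h_def)
      have "e \<noteq> 0" using e h by auto
      have dq: "real_of_int (quartic_disc (a, b, c, d, e)) = p3 * a^3 + p2 * a^2 + p1 * a + p0" for a
        unfolding p by (simp add: algebra_simps)
      have "\<delta> * Y ^ 6 \<le> 256 * \<mu> ^ 6 * Y ^ 6" using \<delta> Y by (intro mult_right_mono) auto
      also have "\<dots> = 256 * (h ^ 3 * h ^ 3)" 
        unfolding h_def power_add[symmetric] by (simp add: power_mult_distrib)
      also have "\<dots> \<le> \<bar>p3\<bar> * h ^ 3"
      proof -
        have "h ^ 3 \<le> \<bar>real_of_int e\<bar> ^ 3" using e h by (intro power_mono) auto
        then have "h ^ 3 * h ^ 3 \<le> \<bar>real_of_int e\<bar> ^ 3 * h ^ 3" using h by (intro mult_right_mono) auto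
        then show ?thesis by (simp add: p abs_mult power_abs)
      qed
      finally have le: "\<delta> * Y ^ 6 \<le> \<bar>p3\<bar> * h ^ 3" .
      let ?S = "{a::int. \<bar>p3 * a^3 + p2 * a^2 + p1 * a + p0\<bar> \<le> \<delta> * Y ^ 6}"
      have p3: "p3 \<noteq> 0" using \<open>e \<noteq> 0\<close> by (simp add: p)
      note cub = cubic_small_values[OF p3 h le, of p2 p1 p0]
      have "K x \<subseteq> insert 0 ?S"
      proof -
        have "real_of_int \<bar>quartic_disc (a, b, c, d, e)\<bar> = \<bar>p3 * a^3 + p2 * a^2 + p1 * a + p0\<bar>" for a
          by (simp only: of_int_abs dq)
        then show ?thesis
          unfolding K_def x by (auto simp del: of_int_abs quartic_disc.simps)
      qed
      then have "card (K x) \<le> card (insert 0 ?S)" using cub(1) by (intro card_mono) auto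
      also have "\<dots> \<le> Suc (card ?S)" by (simp add: card_insert_if cub(1))
      finally show ?thesis using cub(2) by simp
    qed
  qed
  have c2: "real (card B2) \<le> N ^ 4 * (6 * h + 4)"
  proof -
    have "real (card B2) = (\<Sum>x\<in>?I \<times> ?I \<times> ?I \<times> ?I. real (card (K x)))"
      unfolding B2_def by (subst card_SigmaI) (auto simp: finK)
    also have "\<dots> \<le> real (card (?I \<times> ?I \<times> ?I \<times> ?I)) * (6 * h + 4)"
      by (rule sum_bounded_above) (rule cK)
    finally show ?thesis by (simp add: card_cartesian_product N_def power_numeral_reduce)
  qed
  have "card (bad_forms \<delta> Y) \<le> card (B1 \<union> (\<lambda>(x, a). (a, x)) ` B2)"
    using sub finB2 by (intro card_mono) (simp_all add: B1_def)
  also have "\<dots> \<le> card B1 + card B2"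
    by (rule order_trans[OF card_Un_le]) (simp add: card_image_le finB2)
  finally have "real (card (bad_forms \<delta> Y)) \<le> N ^ 4 * (2 * h + 1) + N ^ 4 * (6 * h + 4)"
    using c1 c2 by linarith
  also have "\<dots> = N ^ 4 * (8 * \<mu> * Y + 5)" by (simp add: h_def algebra_simps)
  finally show ?thesis by (simp add: N_def)
qed

text \<open>The choice \<mu> \<le> \<theta> / 16 makes the linear term at most half of \<theta> Y,
  and Y \<ge> 10 / \<theta> does the same for the constant 5. The bound \<mu> \<le> 1/16 only serves
  to get \<delta> \<le> 1.\<close>

lemma bad_density:
  assumes "\<theta> > 0"
  obtains \<delta> Y0 :: real where "0 < \<delta>" "\<delta> \<le> 1" "1 \<le> Y0"
    "\<And>Y. Y \<ge> Y0 \<Longrightarrow> real (card (bad_forms \<delta> Y)) \<le> \<theta> * real (card (height_box Y))"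
proof -
  define \<mu> where "\<mu> = min (\<theta> / 16) (1 / 16)"
  define \<delta> where "\<delta> = 256 * \<mu> ^ 6"
  have \<mu>: "0 < \<mu>" "\<mu> \<le> \<theta> / 16" "\<mu> \<le> 1 / 16" using assms by (auto simp: \<mu>_def)
  have "\<mu> ^ 6 \<le> (1 / 16) ^ 6" using \<mu> by (intro power_mono) auto
  then have "256 * \<mu> ^ 6 \<le> 256 * (1 / 16) ^ 6" by simp
  also have "\<dots> \<le> (1::real)" by (simp add: power_divide)
  finally have \<delta>: "0 < \<delta>" "\<delta> \<le> 1" using \<mu>(1) by (simp_all add: \<delta>_def)
  define Y0 where "Y0 = max 1 (10 / \<theta>)"
  show ?thesis
  proof (rule that[OF \<delta>])
    show "1 \<le> Y0" by (simp add: Y0_def)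
    fix Y assume "Y \<ge> Y0"
    then have Y: "Y \<ge> 1" "10 / \<theta> \<le> Y" by (auto simp: Y0_def)
    define N where "N = real (card (int_ball 0 Y))"
    have N: "Y \<le> N" unfolding N_def by (rule card_int_ball_ge)
    have "8 * \<mu> * Y + 5 \<le> \<theta> * Y"
    proof -
      have "8 * \<mu> * Y \<le> \<theta> / 2 * Y" using \<mu>(2) Y(1) by (intro mult_right_mono) auto
      moreover have "5 \<le> \<theta> / 2 * Y" using Y(2) assms by (simp add: field_simps)
      ultimately show ?thesis by simp
    qed
    also have "\<dots> \<le> \<theta> * N" using N assms by simp
    finally have le: "8 * \<mu> * Y + 5 \<le> \<theta> * N" .
    have "real (card (bad_forms \<delta> Y)) \<le> N ^ 4 * (8 * \<mu> * Y + 5)"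
      unfolding N_def by (rule card_bad_le) (use Y \<mu> in \<open>simp_all add: \<delta>_def\<close>)
    also have "\<dots> \<le> N ^ 4 * (\<theta> * N)" using le by (intro mult_left_mono) (simp_all add: N_def)
    also have "\<dots> = \<theta> * real (card (height_box Y))"
      by (simp add: card_box N_def power_numeral_reduce)
    finally show "real (card (bad_forms \<delta> Y)) \<le> \<theta> * real (card (height_box Y))" .
  qed
qed

text \<open>The discriminant of the attached ring is that of the flipped form. Flipping permutes
  every height box, so densities of exceptional forms are unaffected.\<close>

fun flip :: "binary_quartic \<Rightarrow> binary_quartic" where
  "flip (a, b, c, d, e) = (a, b, c, - d, e)"

lemma flip_flip [simp]: "flip (flip f) = f"
  by (cases f) simp

lemma inj_flip: "inj flip"
  by (metis flip_flip injI)

lemma flip_box [simp]: "flip f \<in> height_box Y \<longleftrightarrow> f \<in> height_box Y"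
  by (cases f) (simp add: in_box_iff)

lemma fst_flip [simp]: "fst (flip f) = fst f"
  by (cases f) simp

lemma card_flip_bad: "card {f. flip f \<in> bad_forms \<delta> Y} = card (bad_forms \<delta> Y)"
proof -
  have "surj flip" by (rule surjI[of _ flip]) simp
  then have "card (flip -` bad_forms \<delta> Y) = card (bad_forms \<delta> Y)"
    by (intro card_vimage_inj inj_flip) simp
  then show ?thesis by (simp add: vimage_def)
qed

section \<open>The density statement\<close>

lemma good_form:
  assumes Y: "Y \<ge> 1" and \<delta>: "0 < \<delta>" and f: "f \<in> height_box Y" "flip f \<notin> bad_forms \<delta> Y"
  obtains a b c d e t0 t1 t2 t3 where "f = (a, b, c, - d, e)"
    "bounded_quartic a b c d e t0 t1 t2 t3 Y"
    "sqrt \<delta> * Y ^ 3 \<le> cmod (det (emb_matrix (\<lambda>j. axis j 1) (quartic_roots.sg a b c d t0 t1 t2 t3)))"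
proof -
  obtain a b c d' e where fe: "f = (a, b, c, d', e)" by (cases f)
  define d where "d = - d'"
  have fd: "f = (a, b, c, - d, e)" "flip f = (a, b, c, d, e)" by (simp_all add: fe d_def)
  have "flip f \<in> height_box Y" using f(1) by simp
  then have g: "a \<noteq> 0" "\<delta> * Y ^ 6 \<le> real_of_int \<bar>quartic_disc (a, b, c, d, e)\<bar>"
    using f(2) unfolding fd bad_forms_def by auto
  have "0 < \<delta> * Y ^ 6" using \<delta> Y by simp
  then have dn: "quartic_disc (a, b, c, d, e) \<noteq> 0" using g(2) by (metis abs_zero not_le of_int_0)
  obtain t0 t1 t2 t3 where qr: "quartic_roots a b c d e t0 t1 t2 t3"
    using quartic_roots_exist[OF g(1) dn] by blast
  interpret quartic_roots a b c d e t0 t1 t2 t3 by (rule qr)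
  have bq: "bounded_quartic a b c d e t0 t1 t2 t3 Y"
    using f(1) Y unfolding fd height_box_def Let_def by unfold_locales (auto simp: int_ball_def)
  have "real_of_int \<bar>quartic_disc (a, b, c, d, e)\<bar> = (cmod (det QR.S))\<^sup>2"
    using QR.abs_ring_disc ring_disc_QR by simp
  then have "(sqrt \<delta> * Y ^ 3)\<^sup>2 \<le> (cmod (det QR.S))\<^sup>2"
    using g(2) \<delta> by (simp add: power_mult_distrib)
  then have "sqrt \<delta> * Y ^ 3 \<le> cmod (det QR.S)"
    by (rule power2_le_imp_le) simp
  then show ?thesis using that[OF fd(1) bq] by blast
qed

text \<open>\<eta> compares \<open>ln rd\<close> with \<open>ln T\<close>. It is applied with T the
  height, where \<eta> = 1, and with T a bound for the discriminant, where \<eta> = 1/4.\<close>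

lemma (in bounded_quartic) pair_close:
  assumes \<kappa>: "0 < \<kappa>" "\<kappa> \<le> 1" "\<kappa> * Y^3 \<le> rd" and T: "T > 1"
    and \<eta>: "\<eta> > 0" "3 * ln Y - ln (1536 / \<kappa>) \<ge> \<eta> * ln T" and \<epsilon>: "ln (1536 / \<kappa>) / \<eta> \<le> \<epsilon>"
  shows "close (1/6, 1/6, 1/6, 1/6, 1/3) \<epsilon> T (QR, CR, res)"
proof (rule close_pair[OF \<kappa>])
  have lnT: "ln T > 0" using T by simp
  have ge: "ln rd \<ge> \<eta> * ln T"
    using abs_ln_succ_min(4)[OF \<kappa>] \<eta>(2) by linarith
  then show rd: "0 < ln rd" using \<eta>(1) lnT by (smt (verit) mult_pos_pos)
  have "1536 \<le> 1536 / \<kappa>" using \<kappa> by (simp add: field_simps)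
  then have L: "0 \<le> ln (1536 / \<kappa>)" by simp
  have "ln (1536 / \<kappa>) / ln rd \<le> ln (1536 / \<kappa>) / (\<eta> * ln T)"
    using ge L \<eta>(1) lnT by (intro divide_left_mono) (auto intro!: mult_pos_pos rd)
  also have "\<dots> = ln (1536 / \<kappa>) / \<eta> / ln T" by simp
  also have "\<dots> \<le> \<epsilon> / ln T" using \<epsilon> lnT by (intro divide_right_mono) auto
  finally show "ln (1536 / \<kappa>) / ln rd \<le> \<epsilon> / ln T" .
qed

lemma sqrt_le_one: "0 < \<delta> \<Longrightarrow> \<delta> \<le> 1 \<Longrightarrow> 0 < sqrt \<delta> \<and> sqrt \<delta> \<le> (1::real)"
  by simp

abbreviation "pt \<equiv> (1/6, 1/6, 1/6, 1/6, 1/3) :: point"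

lemma good_form_close:
  assumes Y: "Y \<ge> 1" and \<delta>: "0 < \<delta>" "\<delta> \<le> 1" and f: "f \<in> height_box Y" "flip f \<notin> bad_forms \<delta> Y"
    and T: "T > 1" and \<eta>: "\<eta> > 0" "3 * ln Y - ln (1536 / sqrt \<delta>) \<ge> \<eta> * ln T"
    and \<epsilon>: "ln (1536 / sqrt \<delta>) / \<eta> \<le> \<epsilon>"
  shows "\<exists>R C \<phi>. (R, C, \<phi>) \<in> quartic_psi f \<and> close pt \<epsilon> T (R, C, \<phi>) \<and> real_of_int \<bar>ring_disc TYPE(4) R\<bar> \<le> (1536 * Y ^ 3)\<^sup>2"
proof -
  obtain a b c d e t0 t1 t2 t3 where fe: "f = (a, b, c, - d, e)"
    and bq: "bounded_quartic a b c d e t0 t1 t2 t3 Y"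
    and det: "sqrt \<delta> * Y ^ 3 \<le> cmod (det (emb_matrix (\<lambda>j. axis j 1) (quartic_roots.sg a b c d t0 t1 t2 t3)))"
    using good_form[OF Y \<delta>(1) f] by blast
  interpret bounded_quartic a b c d e t0 t1 t2 t3 Y by (rule bq)
  have "close pt \<epsilon> T (QR, CR, res)"
    using pair_close[OF _ _ det T \<eta> \<epsilon>] sqrt_le_one[OF \<delta>] by simp
  moreover have "real_of_int \<bar>ring_disc TYPE(4) QR\<bar> \<le> (1536 * Y ^ 3)\<^sup>2"
    unfolding QR.abs_ring_disc using rd_upper by (intro power_mono) auto
  ultimately show ?thesis
    using pair_in_class unfolding fe by blast
qed

text \<open>A form in \<open>D\<close> outside \<open>N\<close> has an exceptional flip, so at most
  \<theta> times the box is lost. Since \<open>D\<close> fills at least half of the box, this is at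
  most 2 \<theta> times \<open>D\<close>.\<close>

lemma density_bound:
  assumes \<theta>: "0 < \<theta>" "\<theta> \<le> 1/2"
  shows "\<exists>\<epsilon>0. \<forall>\<epsilon>\<ge>\<epsilon>0. eventually (\<lambda>T. 1 - 2 * \<theta> \<le>
     real (card {f \<in> F4_bin. coeff_height f \<le> T \<and> (\<exists>P\<in>quartic_psi f. close pt \<epsilon> T P)}) /
     real (card {f \<in> F4_bin. coeff_height f \<le> T})) at_top"
proof -
  obtain \<delta> Y0 where \<delta>: "0 < \<delta>" "\<delta> \<le> 1" and Y0: "1 \<le> Y0" and
    bad: "\<And>Y. Y \<ge> Y0 \<Longrightarrow> real (card (bad_forms \<delta> Y)) \<le> \<theta> * real (card (height_box Y))"
    using bad_density[OF \<theta>(1)] by blast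
  define L where "L = ln (1536 / sqrt \<delta>)"
  show ?thesis
  proof (rule exI[of _ L], intro allI impI)
    fix \<epsilon> assume \<epsilon>: "L \<le> \<epsilon>"
    \<comment> \<open>\<open>T \<ge> exp L\<close> gives 3 ln T - L \<ge> ln T, which is what \<eta>
      = 1 asks for.\<close>
    have "eventually (\<lambda>T. T \<ge> max (max Y0 2) (exp L)) at_top"
      by (rule eventually_ge_at_top)
    then show "eventually (\<lambda>T. 1 - 2 * \<theta> \<le>
     real (card {f \<in> F4_bin. coeff_height f \<le> T \<and> (\<exists>P\<in>quartic_psi f. close pt \<epsilon> T P)}) /
     real (card {f \<in> F4_bin. coeff_height f \<le> T})) at_top"
    proof (rule eventually_mono)
      fix T :: real assume "T \<ge> max (max Y0 2) (exp L)"
      then have T: "T \<ge> Y0" "T \<ge> 2" "T \<ge> exp L" by auto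
      have lnT: "ln T \<ge> L" using T(2,3) by (simp add: ln_ge_iff)
      have "0 \<le> ln T" using T(2) by simp
      then have lnT2: "L \<le> 2 * ln T" using lnT by linarith
      define N where "N = {f \<in> F4_bin. coeff_height f \<le> T \<and> (\<exists>P\<in>quartic_psi f. close pt \<epsilon> T P)}"
      define D where "D = {f \<in> F4_bin. coeff_height f \<le> T}"
      have Dbox: "D \<subseteq> height_box T" unfolding D_def subset_eq in_box_iff by blast
      have finD: "finite D" by (rule finite_subset[OF Dbox]) simp
      have finb: "finite (bad_forms \<delta> T)"
        by (rule finite_subset[of _ "height_box T"]) (unfold bad_forms_def, blast, simp)
      have ND: "N \<subseteq> D" unfolding N_def D_def by blast
      have pos: "0 < real (card (height_box T))"
      proof -
        have "0 < real (card (int_ball 0 T))" using card_int_ball_ge[of T] T(2) by linarith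
        then show ?thesis by (simp add: card_box)
      qed
      have "D \<subseteq> N \<union> {f. flip f \<in> bad_forms \<delta> T}"
      proof
        fix f assume f: "f \<in> D"
        show "f \<in> N \<union> {f. flip f \<in> bad_forms \<delta> T}"
        proof (cases "flip f \<in> bad_forms \<delta> T")
          case False
          have "\<exists>R C \<phi>. (R, C, \<phi>) \<in> quartic_psi f \<and> close pt \<epsilon> T (R, C, \<phi>) \<and> real_of_int \<bar>ring_disc TYPE(4) R\<bar> \<le> (1536 * T ^ 3)\<^sup>2"
            by (rule good_form_close[OF _ \<delta> _ False, where \<eta> = 1])
              (use T(2) lnT lnT2 \<epsilon> f Dbox in \<open>auto simp: L_def[symmetric]\<close>)
          then show ?thesis using f unfolding N_def D_def by blast
        qed simp
      qed
      then have "card D \<le> card (N \<union> {f. flip f \<in> bad_forms \<delta> T})"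
        using finite_subset[OF ND finD] finite_vimageI[OF finb inj_flip]
        by (intro card_mono) (simp_all add: vimage_def)
      also have "\<dots> \<le> card N + card (bad_forms \<delta> T)"
        using card_Un_le[of N "{f. flip f \<in> bad_forms \<delta> T}"] by (simp add: card_flip_bad)
      finally have 1: "real (card D) \<le> real (card N) + \<theta> * real (card (height_box T))"
        using bad[OF T(1)] by linarith
      have "height_box T \<subseteq> D \<union> bad_forms \<delta> T"
      proof
        fix f assume f: "f \<in> height_box T"
        have "f \<in> bad_forms \<delta> T" if "quartic_disc f = 0"
          using f that \<delta>(1) T(2) by (auto simp: bad_forms_def)
        then show "f \<in> D \<union> bad_forms \<delta> T" using f by (auto simp: D_def F4_bin_def in_box_iff)
      qed
      then have "card (height_box T) \<le> card (D \<union> bad_forms \<delta> T)"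
        using finD finb by (intro card_mono) simp_all
      also have "\<dots> \<le> card D + card (bad_forms \<delta> T)" by (rule card_Un_le)
      finally have 2: "(1 - \<theta>) * real (card (height_box T)) \<le> real (card D)"
        using bad[OF T(1)] by (simp add: algebra_simps)
      have h: "1/2 * real (card (height_box T)) \<le> real (card D)"
      proof -
        have "1/2 * real (card (height_box T)) \<le> (1 - \<theta>) * real (card (height_box T))"
          using \<theta>(2) by (intro mult_right_mono) simp_all
        then show ?thesis using 2 by linarith
      qed
      then have Dpos: "0 < real (card D)" using pos by linarith
      have "\<theta> * real (card (height_box T)) \<le> 2 * \<theta> * real (card D)"
        using mult_left_mono[OF h, of "2 * \<theta>"] \<theta> by simp
      then have "(1 - 2 * \<theta>) * real (card D) \<le> real (card N)"
        using 1 by (simp add: algebra_simps)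
      then show "1 - 2 * \<theta> \<le> real (card {f \<in> F4_bin. coeff_height f \<le> T \<and> (\<exists>P\<in>quartic_psi f. close pt \<epsilon> T P)}) /
         real (card {f \<in> F4_bin. coeff_height f \<le> T})"
        using Dpos unfolding N_def[symmetric] D_def[symmetric] by (simp add: le_divide_eq)
    qed
  qed
qed

lemma density_limit:
  "((\<lambda>\<epsilon>. Liminf at_top (\<lambda>T::real. ereal
          (real (card {f \<in> F4_bin. coeff_height f \<le> T \<and> (\<exists>P\<in>quartic_psi f. close pt \<epsilon> T P)}) /
           real (card {f \<in> F4_bin. coeff_height f \<le> T})))) \<longlongrightarrow> 1) at_top"
  (is "((\<lambda>\<epsilon>. Liminf at_top (?r \<epsilon>)) \<longlongrightarrow> 1) at_top")
proof (rule order_tendstoI)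
  fix x :: ereal assume x: "x < 1"
  obtain y :: real where y: "x < ereal y" "y < 1"
    using ereal_dense2[OF x] by auto
  define \<theta> where "\<theta> = min (1/2) ((1 - y) / 2)"
  have \<theta>: "0 < \<theta>" "\<theta> \<le> 1/2" "y \<le> 1 - 2 * \<theta>" using y(2) by (auto simp: \<theta>_def min_def)
  obtain \<epsilon>0 where \<epsilon>0: "\<And>\<epsilon>. \<epsilon> \<ge> \<epsilon>0 \<Longrightarrow> eventually (\<lambda>T. 1 - 2 * \<theta> \<le>
     real (card {f \<in> F4_bin. coeff_height f \<le> T \<and> (\<exists>P\<in>quartic_psi f. close pt \<epsilon> T P)}) /
     real (card {f \<in> F4_bin. coeff_height f \<le> T})) at_top"
    using density_bound[OF \<theta>(1,2)] by blast
  have "x < Liminf at_top (?r \<epsilon>)" if "\<epsilon> \<ge> \<epsilon>0" for \<epsilon>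
  proof -
    have "ereal (1 - 2 * \<theta>) \<le> Liminf at_top (?r \<epsilon>)"
      by (rule Liminf_bounded) (use \<epsilon>0[OF that] in simp)
    moreover have "ereal y \<le> ereal (1 - 2 * \<theta>)" using \<theta>(3) by simp
    ultimately show ?thesis by (rule less_le_trans[OF y(1) order_trans, rotated])
  qed
  then show "\<forall>\<^sub>F \<epsilon> in at_top. x < Liminf at_top (?r \<epsilon>)"
    unfolding eventually_at_top_linorder by blast
next
  fix x :: ereal assume x: "1 < x"
  have "Liminf at_top (?r \<epsilon>) < x" for \<epsilon>
  proof -
    have "?r \<epsilon> T \<le> 1" for T
    proof -
      have "finite {f \<in> F4_bin. coeff_height f \<le> T}"
        by (rule finite_subset[of _ "height_box T"]) (unfold subset_eq in_box_iff, blast, simp)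
      then have "card {f \<in> F4_bin. coeff_height f \<le> T \<and> (\<exists>P\<in>quartic_psi f. close pt \<epsilon> T P)}
        \<le> card {f \<in> F4_bin. coeff_height f \<le> T}"
        by (rule card_mono) blast
      then show ?thesis by (simp add: divide_le_eq)
    qed
    then have 1: "Limsup at_top (?r \<epsilon>) \<le> 1"
      by (intro Limsup_bounded always_eventually allI)
    have "Liminf at_top (?r \<epsilon>) \<le> Limsup at_top (?r \<epsilon>)"
      by (rule Liminf_le_Limsup) simp
    then show ?thesis by (rule le_less_trans[OF order_trans[OF _ 1] x])
  qed
  then show "\<forall>\<^sub>F \<epsilon> in at_top. Liminf at_top (?r \<epsilon>) < x" by simp
qed

section \<open>Many classes come from forms\<close>

text \<open>A finite code for an isomorphism between the pairs of f and f': \<open>v1\<close>,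
  \<open>v2\<close>, \<open>v3\<close> are the images of the basis elements of R other than 1, and
  \<open>p\<close> is the coefficient of c'_1 in the image of c_1.\<close>

definition related :: "binary_quartic \<Rightarrow> (int ^ 4) \<times> (int ^ 4) \<times> (int ^ 4) \<times> int \<Rightarrow> binary_quartic \<Rightarrow> bool" where
  "related f' = (\<lambda>(v1, v2, v3, p) f. p \<noteq> 0 \<and> (\<exists>r. \<forall>x y z.
     form_A f' (x * v1 $ 1 + y * v2 $ 1 + z * v3 $ 1) (x * v1 $ 2 + y * v2 $ 2 + z * v3 $ 2) (x * v1 $ 3 + y * v2 $ 3 + z * v3 $ 3)
       = p * form_A f x y z + r * form_B x y z))"

text \<open>The multiple of \<open>form_B\<close> is determined because \<open>form_A f\<close> has no \<open>x z\<close> term.\<close>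

lemma related_unique:
  assumes "related f' w f1" "related f' w f2"
  shows "f1 = f2"
proof -
  obtain v1 v2 v3 p where w: "w = (v1, v2, v3, p)" by (cases w)
  define L where "L x y z = form_A f' (x * v1 $ 1 + y * v2 $ 1 + z * v3 $ 1) (x * v1 $ 2 + y * v2 $ 2 + z * v3 $ 2)
     (x * v1 $ 3 + y * v2 $ 3 + z * v3 $ 3)" for x y z
  have p: "p \<noteq> 0" and "\<exists>r. \<forall>x y z. L x y z = p * form_A f1 x y z + r * form_B x y z"
    and "\<exists>r. \<forall>x y z. L x y z = p * form_A f2 x y z + r * form_B x y z"
    using assms unfolding related_def w L_def prod.case by blast+
  then obtain r1 r2 where r1: "\<And>x y z. L x y z = p * form_A f1 x y z + r1 * form_B x y z"
    and r2: "\<And>x y z. L x y z = p * form_A f2 x y z + r2 * form_B x y z"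
    by blast
  have e: "p * form_A f1 x y z + r1 * form_B x y z = p * form_A f2 x y z + r2 * form_B x y z" for x y z
    unfolding r1[symmetric] r2[symmetric] ..
  obtain a1 b1 c1 d1 e1 where f1: "f1 = (a1, b1, c1, d1, e1)" by (cases f1)
  obtain a2 b2 c2 d2 e2 where f2: "f2 = (a2, b2, c2, d2, e2)" by (cases f2)
  note E = e[unfolded f1 f2 form_B_def form_A.simps]
  have a: "a1 = a2" using E[of 1 0 0] p by simp
  have ee: "e1 = e2" using E[of 0 0 1] p by simp
  have r: "r1 = r2" using E[of 1 0 1] p a ee by simp
  have c: "c1 = c2" using E[of 0 1 0] p r by simp
  have "p * b1 = p * b2" using E[of 1 1 0] a c r by (simp add: algebra_simps)
  moreover have "p * d1 = p * d2" using E[of 0 1 1] ee c r by (simp add: algebra_simps)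
  ultimately show ?thesis using p a c ee by (simp add: f1 f2)
qed

section \<open>Isomorphisms between the pairs of two forms of bounded height\<close>

locale two_bounded = F: bounded_quartic a b c d e t0 t1 t2 t3 Y + G: bounded_quartic a' b' c' d' e' t0' t1' t2' t3' Y
  for a b c d e t0 t1 t2 t3 a' b' c' d' e' t0' t1' t2' t3' Y +
  fixes \<alpha> \<beta> \<kappa>
  assumes al: "\<alpha> \<in> ring_iso F.QR G.QR" and be: "\<beta> \<in> ring_iso F.CR G.CR"
    and comm: "\<And>x. \<beta> (F.res x) = G.res (\<alpha> x)"
    and \<kappa>: "0 < \<kappa>" "\<kappa> * Y^3 \<le> G.rd" and Ybig: "96 < \<kappa> * Y"
begin

lemma alh: "\<alpha> \<in> ring_hom F.QR G.QR" and beh: "\<beta> \<in> ring_hom F.CR G.CR"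
  using al be by (auto simp: ring_iso_def)

lemma sg_alpha: "\<exists>k. \<forall>x. G.sg i (\<alpha> x) = F.sg k x"
proof -
  have "restrict (\<lambda>x. G.sg i (\<alpha> x)) (carrier F.QR) \<in> complex_homs F.QR"
    by (rule G.QR.hom_comp[OF alh F.cring_QR])
  then obtain k where "restrict (\<lambda>x. G.sg i (\<alpha> x)) (carrier F.QR) = F.sg k"
    using F.QR.homs unfolding bij_betw_def by (metis imageE)
  then show ?thesis by (intro exI[of _ k]) (auto simp: fun_eq_iff)
qed

lemma tu_beta: "\<exists>k. \<forall>x. G.tu i (\<beta> x) = F.tu k x"
proof -
  have "restrict (\<lambda>x. G.tu i (\<beta> x)) (carrier F.CR) \<in> complex_homs F.CR"
    by (rule G.CR.hom_comp[OF beh F.cring_CR])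
  then obtain k where "restrict (\<lambda>x. G.tu i (\<beta> x)) (carrier F.CR) = F.tu k"
    using F.CR.homs unfolding bij_betw_def by (metis imageE)
  then show ?thesis by (intro exI[of _ k]) (auto simp: fun_eq_iff)
qed

lemma bounded_by_kappa:
  assumes "real_of_int \<bar>x\<bar> * G.rd \<le> r * Y ^ 3"
  shows "real_of_int \<bar>x\<bar> \<le> r / \<kappa>"
proof -
  have Y3: "0 < Y ^ 3" using F.Y(1) by simp
  have "real_of_int \<bar>x\<bar> * (\<kappa> * Y ^ 3) \<le> real_of_int \<bar>x\<bar> * G.rd"
    using \<kappa>(2) by (intro mult_left_mono) auto
  then have "(real_of_int \<bar>x\<bar> * \<kappa>) * Y ^ 3 \<le> r * Y ^ 3" using assms by (simp add: mult.assoc)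
  then have "real_of_int \<bar>x\<bar> * \<kappa> \<le> r" using Y3 by simp
  then show ?thesis using \<kappa>(1) by (simp add: le_divide_eq)
qed

text \<open>Isomorphisms permute embeddings, so the image of a basis element still has embeddings at
  most 4 Y. Cramer's rule in the target ring bounds its coordinates by 384 * 4 / \<kappa>.\<close>

lemma alpha_bound:
  assumes "j \<noteq> 0"
  shows "real_of_int \<bar>\<alpha> (axis k 1) $ j\<bar> \<le> 1536 / \<kappa>"
proof (rule bounded_by_kappa)
  have M: "F.Mq k \<le> 4 * Y" using F.Y(1) by (simp add: F.Mq_def)
  have "cmod (G.sg i (\<alpha> (axis k 1))) \<le> 4 * Y" for i
    using sg_alpha[of i] F.sg_axis[of _ k] M by (metis order_trans)
  from G.QR_coord_bound[OF this assms]
  show "real_of_int \<bar>\<alpha> (axis k 1) $ j\<bar> * G.rd \<le> 1536 * Y ^ 3"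
    by (simp add: power2_eq_square power3_eq_cube mult_ac)
qed

text \<open>The image of c_1 has embeddings O(Y), too small for a c'_2 component: that coordinate is
  at most 96 / (\<kappa> Y), which \<open>Ybig\<close> makes less than 1.\<close>

lemma beta_bounds:
  "real_of_int \<bar>\<beta> (axis 1 1) $ 1\<bar> \<le> 480 / \<kappa>" "\<beta> (axis 1 1) $ 2 = 0"
proof -
  have Y0: "0 < Y" using F.Y(1) by simp
  have "F.Mc 1 = 4 * Y" by (simp add: F.Mc_def)
  then have "cmod (G.tu i (\<beta> (axis 1 1))) \<le> 4 * Y" for i
    using tu_beta[of i] F.tu_axis[of _ 1] by metis
  note b = G.CR_coord_bound[OF this]
  show "real_of_int \<bar>\<beta> (axis 1 1) $ 1\<bar> \<le> 480 / \<kappa>"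
    by (rule bounded_by_kappa) (use b(1) in \<open>simp add: power2_eq_square power3_eq_cube mult_ac\<close>)
  have "real_of_int \<bar>\<beta> (axis 1 1) $ 2\<bar> \<le> (96 / Y) / \<kappa>"
    by (rule bounded_by_kappa) (use b(2) Y0 in \<open>simp add: power2_eq_square power3_eq_cube mult_ac\<close>)
  also have "\<dots> < 1" using Ybig \<kappa>(1) Y0 by (simp add: divide_less_eq mult.commute)
  finally show "\<beta> (axis 1 1) $ 2 = 0" by linarith
qed

lemma alpha_lc: "\<alpha> (F.lc x y z) = x *s \<alpha> (axis 1 1) + y *s \<alpha> (axis 2 1) + z *s \<alpha> (axis 3 1)"
proof (rule G.QR.sigma_eqI)
  fix i
  have "G.sg i (\<alpha> (F.lc x y z)) = of_int x * G.sg i (\<alpha> (axis 1 1)) + of_int y * G.sg i (\<alpha> (axis 2 1)) + of_int z * G.sg i (\<alpha> (axis 3 1))"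
    unfolding F.lc_def using G.QR.sigma_hom_int_pow[OF alh F.cring_QR]
    by (simp add: G.QR.sigma_hom_add[OF alh])
  then show "G.sg i (\<alpha> (F.lc x y z)) = G.sg i (x *s \<alpha> (axis 1 1) + y *s \<alpha> (axis 2 1) + z *s \<alpha> (axis 3 1))"
    by (simp add: G.sg_def algebra_simps)
qed simp_all

lemma form_relation:
  "\<exists>r. \<forall>x y z. G.res (\<alpha> (F.lc x y z)) $ 1 = \<beta> (axis 1 1) $ 1 * form_A (a, b, c, - d, e) x y z + r * form_B x y z"
proof (intro exI[of _ "\<beta> (axis 2 1) $ 1"] allI)
  fix x y z
  let ?A = "form_A (a, b, c, - d, e) x y z" and ?B = "form_B x y z"
  obtain k :: int where k: "F.res (F.lc x y z) =
     [k] \<cdot>\<^bsub>F.CR\<^esub> \<one>\<^bsub>F.CR\<^esub> \<oplus>\<^bsub>F.CR\<^esub> [?A] \<cdot>\<^bsub>F.CR\<^esub> axis 1 1 \<oplus>\<^bsub>F.CR\<^esub> [?B] \<cdot>\<^bsub>F.CR\<^esub> axis 2 1"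
    using F.rep by blast
  have "G.res (\<alpha> (F.lc x y z)) = k *s axis 0 1 + ?A *s \<beta> (axis 1 1) + ?B *s \<beta> (axis 2 1)"
  proof (rule G.CR.sigma_eqI)
    fix j
    have "G.tu j (G.res (\<alpha> (F.lc x y z))) = of_int k + of_int ?A * G.tu j (\<beta> (axis 1 1)) + of_int ?B * G.tu j (\<beta> (axis 2 1))"
      unfolding comm[symmetric] k using G.CR.sigma_hom_int_pow[OF beh F.cring_CR]
      by (simp add: G.CR.sigma_hom_add[OF beh] ring_hom_one[OF beh] G.CR.sigma_one)
    then show "G.tu j (G.res (\<alpha> (F.lc x y z))) = G.tu j (k *s axis 0 1 + ?A *s \<beta> (axis 1 1) + ?B *s \<beta> (axis 2 1))"
      by (simp add: G.tu_def algebra_simps)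
  qed simp_all
  then show "G.res (\<alpha> (F.lc x y z)) $ 1 = \<beta> (axis 1 1) $ 1 * ?A + \<beta> (axis 2 1) $ 1 * ?B"
    by (simp add: mult.commute del: form_A.simps)
qed

text \<open>Otherwise, its coordinate 2 being zero as well, the image of c_1 would be an integer,
  and by injectivity so would c_1.\<close>

lemma beta_axis_nonzero: "\<beta> (axis 1 1) $ 1 \<noteq> 0"
proof
  assume "\<beta> (axis 1 1) $ 1 = 0"
  then have "\<beta> (axis 1 1) = (\<beta> (axis 1 1) $ 0) *s axis 0 1"
    unfolding vec_eq_iff all_3_0 using beta_bounds(2) by simp
  then have "F.tu k (axis 1 1) = of_int (\<beta> (axis 1 1) $ 0)" if "\<forall>x. G.tu i (\<beta> x) = F.tu k x" for i k
    using that by (metis G.tu_def \<open>\<beta> (axis 1 1) $ 1 = 0\<close> beta_bounds(2) mult_zero_left add_0_right of_int_0)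
  then have ex: "\<exists>k. F.tu k (axis 1 1) = of_int (\<beta> (axis 1 1) $ 0) \<and> (\<forall>x. G.tu i (\<beta> x) = F.tu k x)" for i
    using tu_beta[of i] by blast
  have "\<beta> (axis 1 1) = \<beta> ((\<beta> (axis 1 1) $ 0) *s axis 0 1)"
  proof (rule G.CR.sigma_eqI)
    fix i
    obtain k where k: "F.tu k (axis 1 1) = of_int (\<beta> (axis 1 1) $ 0)" "\<forall>x. G.tu i (\<beta> x) = F.tu k x"
      using ex by blast
    show "G.tu i (\<beta> (axis 1 1)) = G.tu i (\<beta> ((\<beta> (axis 1 1) $ 0) *s axis 0 1))"
      using k by (simp add: F.tu_def)
  qed simp_all
  moreover have "inj \<beta>"
    using be by (simp add: ring_iso_def bij_betw_def)
  ultimately have "axis 1 1 = (\<beta> (axis 1 1) $ 0) *s (axis 0 1 :: int ^ 3)" by (simp add: inj_eq)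
  from arg_cong[OF this, of "\<lambda>v. v $ 1"] show False by simp
qed

lemma related_code:
  "\<exists>w. related (a', b', c', - d', e') w (a, b, c, - d, e) \<and>
     w \<in> {v. \<forall>i. \<bar>v $ i\<bar> \<le> \<lceil>1536 / \<kappa>\<rceil>} \<times> {v. \<forall>i. \<bar>v $ i\<bar> \<le> \<lceil>1536 / \<kappa>\<rceil>} \<times> {v. \<forall>i. \<bar>v $ i\<bar> \<le> \<lceil>1536 / \<kappa>\<rceil>}
       \<times> {- \<lceil>1536 / \<kappa>\<rceil>..\<lceil>1536 / \<kappa>\<rceil>}"
proof -
  \<comment> \<open>Coordinate 0 is discarded: the forms live on the quotient by \<int>, and
    \<open>alpha_bound\<close> controls only the other coordinates.\<close>
  define v where "v k = (\<chi> j. if j = 0 then 0 else \<alpha> (axis k 1) $ j)" for k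
  let ?p = "\<beta> (axis 1 1) $ 1"
  obtain r where r: "\<And>x y z. G.res (\<alpha> (F.lc x y z)) $ 1 = ?p * form_A (a, b, c, - d, e) x y z + r * form_B x y z"
    using form_relation by blast
  have res1: "G.res w $ 1 = form_A (a', b', c', - d', e') (w $ 1) (w $ 2) (w $ 3)" for w
    by (simp add: G.res_def algebra_simps)
  have "related (a', b', c', - d', e') (v 1, v 2, v 3, ?p) (a, b, c, - d, e)"
    unfolding related_def prod.case
  proof (intro conjI exI[of _ r] allI)
    show "?p \<noteq> 0" by (rule beta_axis_nonzero)
    fix x y z
    show "form_A (a', b', c', - d', e') (x * v 1 $ 1 + y * v 2 $ 1 + z * v 3 $ 1) (x * v 1 $ 2 + y * v 2 $ 2 + z * v 3 $ 2)
       (x * v 1 $ 3 + y * v 2 $ 3 + z * v 3 $ 3) = ?p * form_A (a, b, c, - d, e) x y z + r * form_B x y z"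
      unfolding r[symmetric] res1 alpha_lc by (simp add: v_def)
  qed
  moreover have "\<bar>v k $ j\<bar> \<le> \<lceil>1536 / \<kappa>\<rceil>" for k j
  proof (cases "j = 0")
    case True
    have "0 \<le> 1536 / \<kappa>" using \<kappa>(1) by simp
    then have "real_of_int 0 \<le> real_of_int \<lceil>1536 / \<kappa>\<rceil>"
      using le_of_int_ceiling[of "1536 / \<kappa>"] by linarith
    then have "0 \<le> \<lceil>1536 / \<kappa>\<rceil>" by (simp only: of_int_le_iff)
    then show ?thesis unfolding v_def True by (simp only: vec_lambda_beta simp_thms if_True abs_zero)
  next
    case False
    then show ?thesis
      using order_trans[OF alpha_bound[OF False, of k] le_of_int_ceiling] by (simp add: v_def)
  qed
  moreover have "\<bar>?p\<bar> \<le> \<lceil>1536 / \<kappa>\<rceil>"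
  proof -
    have "480 / \<kappa> \<le> 1536 / \<kappa>" using \<kappa>(1) by (intro divide_right_mono) auto
    then show ?thesis using beta_bounds(1) by linarith
  qed
  ultimately show ?thesis
    by (intro exI[of _ "(v 1, v 2, v 3, ?p)"]) (simp add: abs_le_iff minus_le_iff)
qed

end

definition good_forms :: "real \<Rightarrow> real \<Rightarrow> binary_quartic set" where
  "good_forms \<delta> Y = {f \<in> height_box Y. flip f \<notin> bad_forms \<delta> Y}"

lemma finite_good [simp]: "finite (good_forms \<delta> Y)"
  by (rule finite_subset[of _ "height_box Y"]) (unfold good_forms_def, blast, simp)

text \<open>The codes lie in a finite set depending only on \<delta>, and by
  \<open>related_unique\<close> a code together with f' determines f. The successor makes the bound
  positive.\<close>

lemma fibre_bound:
  assumes \<delta>: "0 < \<delta>" "\<delta> \<le> 1"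
  obtains N :: nat where "N > 0"
    "\<And>Y f'. Y \<ge> 1 \<Longrightarrow> 96 < sqrt \<delta> * Y \<Longrightarrow> f' \<in> good_forms \<delta> Y \<Longrightarrow> card {f \<in> good_forms \<delta> Y. quartic_psi f = quartic_psi f'} \<le> N"
proof -
  define \<kappa> where "\<kappa> = sqrt \<delta>"
  have \<kappa>: "0 < \<kappa>" using \<delta> by (simp add: \<kappa>_def)
  define W where "W = {v :: int ^ 4. \<forall>i. \<bar>v $ i\<bar> \<le> \<lceil>1536 / \<kappa>\<rceil>}"
  define codes where "codes = W \<times> W \<times> W \<times> {- \<lceil>1536 / \<kappa>\<rceil>..\<lceil>1536 / \<kappa>\<rceil>}"
  have "finite W" unfolding W_def by (rule finite_bounded_int_vec)
  then have fin: "finite codes" unfolding codes_def by (intro finite_cartesian_product) auto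
  show ?thesis
  proof (rule that[of "Suc (card codes)"])
    fix Y f' assume Y: "Y \<ge> 1" "96 < sqrt \<delta> * Y" and f': "f' \<in> good_forms \<delta> Y"
    have fb: "f' \<in> height_box Y" "flip f' \<notin> bad_forms \<delta> Y" using f' by (simp_all add: good_forms_def)
    obtain a' b' c' d' e' t0' t1' t2' t3' where fe': "f' = (a', b', c', - d', e')"
      and bq': "bounded_quartic a' b' c' d' e' t0' t1' t2' t3' Y"
      and det': "sqrt \<delta> * Y ^ 3 \<le> cmod (det (emb_matrix (\<lambda>j. axis j 1) (quartic_roots.sg a' b' c' d' t0' t1' t2' t3')))"
      using good_form[OF Y(1) \<delta>(1) fb] by blast
    interpret G: bounded_quartic a' b' c' d' e' t0' t1' t2' t3' Y by (rule bq')
    let ?Fib = "{f \<in> good_forms \<delta> Y. quartic_psi f = quartic_psi f'}"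
    have ex: "\<exists>w. related f' w f \<and> w \<in> codes" if f: "f \<in> ?Fib" for f
    proof -
      have fb: "f \<in> height_box Y" "flip f \<notin> bad_forms \<delta> Y" using f by (simp_all add: good_forms_def)
      obtain a b c d e t0 t1 t2 t3 where fe: "f = (a, b, c, - d, e)"
        and bq: "bounded_quartic a b c d e t0 t1 t2 t3 Y"
        using good_form[OF Y(1) \<delta>(1) fb] by metis
      interpret F: bounded_quartic a b c d e t0 t1 t2 t3 Y by (rule bq)
      have "(G.QR, G.CR, G.res) \<in> quartic_psi f'" unfolding fe' by (rule G.pair_in_class)
      also have "quartic_psi f' = quartic_psi f" using f by simp
      also have "\<dots> = pair_iso `` {(F.QR, F.CR, F.res)}"
        using F.pair_in_class unfolding fe quartic_psi_def by (rule bhargava_class_eq)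
      finally obtain \<alpha> \<beta> where iso: "\<alpha> \<in> ring_iso F.QR G.QR" "\<beta> \<in> ring_iso F.CR G.CR" "\<And>x. \<beta> (F.res x) = G.res (\<alpha> x)"
        unfolding pair_iso_def by auto
      interpret two_bounded a b c d e t0 t1 t2 t3 a' b' c' d' e' t0' t1' t2' t3' Y \<alpha> \<beta> \<kappa>
        by unfold_locales (use iso \<kappa> det' Y in \<open>auto simp: \<kappa>_def\<close>)
      show ?thesis
        using related_code unfolding fe fe' codes_def W_def .
    qed
    define code where "code f = (SOME w. related f' w f \<and> w \<in> codes)" for f
    have code: "related f' (code f) f \<and> code f \<in> codes" if "f \<in> ?Fib" for f
      unfolding code_def by (rule someI_ex[OF ex[OF that]])
    have "card ?Fib \<le> card codes"
    proof (rule card_inj_on_le[OF _ _ fin])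
      show "inj_on code ?Fib"
      proof (rule inj_onI)
        fix f1 f2 assume f12: "f1 \<in> ?Fib" "f2 \<in> ?Fib" "code f1 = code f2"
        have "related f' (code f1) f1" "related f' (code f1) f2"
          using code[OF f12(1)] code[OF f12(2)] f12(3) by simp_all
        then show "f1 = f2" by (rule related_unique)
      qed
      show "code ` ?Fib \<subseteq> codes" using code by blast
    qed
    then show "card ?Fib \<le> Suc (card codes)" by simp
  qed simp
qed

lemma many_classes:
  obtains M k :: real where "0 < k"
    "\<And>\<epsilon>. \<epsilon> > M \<Longrightarrow> eventually (\<lambda>T. \<exists>S. finite S \<and> S \<subseteq> {K \<in> F4 pt \<epsilon> T. K \<in> quartic_psi ` F4_bin} \<and>
       k * T powr (5/6) \<le> real (card S)) at_top"
proof -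
  obtain \<delta> Y0 where \<delta>: "0 < \<delta>" "\<delta> \<le> 1" and Y0: "1 \<le> Y0" and
    bad: "\<And>Y. Y \<ge> Y0 \<Longrightarrow> real (card (bad_forms \<delta> Y)) \<le> 1/4 * real (card (height_box Y))"
  proof -
    have "(0::real) < 1/4" by simp
    from bad_density[OF this] show ?thesis using that by blast
  qed
  obtain N where N: "N > 0"
    "\<And>Y f'. Y \<ge> 1 \<Longrightarrow> 96 < sqrt \<delta> * Y \<Longrightarrow> f' \<in> good_forms \<delta> Y \<Longrightarrow> card {f \<in> good_forms \<delta> Y. quartic_psi f = quartic_psi f'} \<le> N"
    using fibre_bound[OF \<delta>] by blast
  define L where "L = ln (1536 / sqrt \<delta>)"
  \<comment> \<open>The square of the constant in \<open>rd_upper\<close>: with q Y^6 = T, every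
    form of height at most Y has ring discriminant at most T.\<close>
  define q :: real where "q = 1536\<^sup>2"
  \<comment> \<open>At least half of the Y^5 forms are usable, at most N of them share a class, and
    Y^5 is (T / q)^(5/6).\<close>
  define k where "k = 1 / (2 * real N * q powr (5/6))"
  have q: "q > 0" by (simp add: q_def)
  \<comment> \<open>97 leaves room for the strict inequality with 96 required by
    \<open>fibre_bound\<close>.\<close>
  define Y1 where "Y1 = max Y0 (97 / sqrt \<delta>)"
  show ?thesis
  proof (rule that[of k "4 * L"])
    show "0 < k" using N(1) q by (simp add: k_def)
    fix \<epsilon> assume \<epsilon>: "\<epsilon> > 4 * L"
    have "eventually (\<lambda>T. T \<ge> max 2 (max (q * Y1 ^ 6) (exp (4 * (L + ln 1536))))) at_top"
      by (rule eventually_ge_at_top)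
    then show "eventually (\<lambda>T. \<exists>S. finite S \<and> S \<subseteq> {K \<in> F4 pt \<epsilon> T. K \<in> quartic_psi ` F4_bin} \<and>
       k * T powr (5/6) \<le> real (card S)) at_top"
    proof (rule eventually_mono)
      fix T :: real assume "T \<ge> max 2 (max (q * Y1 ^ 6) (exp (4 * (L + ln 1536))))"
      then have T: "T \<ge> 2" "q * Y1 ^ 6 \<le> T" "exp (4 * (L + ln 1536)) \<le> T" by auto
      define Y where "Y = (T / q) powr (1/6)"
      have Tq: "0 < T / q" using T(1) q by simp
      have Ypos: "0 < Y" using T(1) q by (simp add: Y_def)
      have Y6: "Y ^ 6 = T / q"
      proof -
        have "Y ^ 6 = Y powr 6" using Ypos by (simp add: powr_numeral)
        also have "\<dots> = (T / q) powr 1" by (simp add: Y_def powr_powr)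
        also have "\<dots> = T / q" by (rule powr_one[OF less_imp_le[OF Tq]])
        finally show ?thesis .
      qed
      have Y5: "Y ^ 5 = T powr (5/6) / q powr (5/6)"
      proof -
        have "Y ^ 5 = Y powr 5" using Ypos by (simp add: powr_numeral)
        then show ?thesis using Tq T(1) q by (simp add: Y_def powr_powr powr_divide)
      qed
      have "Y1 ^ 6 \<le> Y ^ 6" unfolding Y6 using T(2) q by (simp add: field_simps)
      then have YY1: "Y1 \<le> Y" using Ypos by (metis power_mono_iff le_cases less_imp_le power_less_imp_less_base not_le zero_less_numeral order_trans)
      then have YY0: "Y \<ge> Y0" "Y \<ge> 1" and Y97: "97 / sqrt \<delta> \<le> Y" using Y0 by (auto simp: Y1_def)
      have Ysq: "96 < sqrt \<delta> * Y" using Y97 \<delta> by (simp add: divide_le_eq mult.commute)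
      have lnY: "3 * ln Y = ln T / 2 - ln 1536"
      proof -
        have "6 * ln Y = ln (Y ^ 6)" using Ypos by (simp add: ln_realpow)
        also have "\<dots> = ln T - ln q" unfolding Y6 using T(1) q by (simp add: ln_div)
        also have "ln q = real 2 * ln 1536" unfolding q_def by (rule ln_realpow)
        finally show ?thesis by simp
      qed
      have lnT: "4 * (L + ln 1536) \<le> ln T" using T(1,3) by (simp add: ln_ge_iff)
      \<comment> \<open>Keeping \<open>flip f\<close> out of the exceptional set makes the pair
        close; keeping f out of it gives f nonzero discriminant. Each condition costs at most a
        quarter of the box.\<close>
      define G where "G = good_forms \<delta> Y - bad_forms \<delta> Y"
      have cls: "quartic_psi f \<in> {K \<in> F4 pt \<epsilon> T. K \<in> quartic_psi ` F4_bin}" if f: "f \<in> G" for f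
      proof -
        have fb: "f \<in> height_box Y" "flip f \<notin> bad_forms \<delta> Y" "f \<notin> bad_forms \<delta> Y" using f by (auto simp: G_def good_forms_def)
        have "f \<in> bad_forms \<delta> Y" if "quartic_disc f = 0"
          using fb(1) that \<delta>(1) Ypos by (auto simp: bad_forms_def)
        then have F: "f \<in> F4_bin" using fb(3) by (auto simp: F4_bin_def)
        have "\<exists>R C \<phi>. (R, C, \<phi>) \<in> quartic_psi f \<and> close pt \<epsilon> T (R, C, \<phi>) \<and> real_of_int \<bar>ring_disc TYPE(4) R\<bar> \<le> (1536 * Y ^ 3)\<^sup>2"
        proof (rule good_form_close[OF YY0(2) \<delta> fb(1,2), where \<eta> = "1/4"])
          \<comment> \<open>The left side of \<open>lnY\<close> is half of ln T up to ln 1536; the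
            lower bound on T absorbs this and L into the other quarter.\<close>
          show "1/4 * ln T \<le> 3 * ln Y - ln (1536 / sqrt \<delta>)"
            unfolding L_def[symmetric] lnY using lnT by simp
          show "ln (1536 / sqrt \<delta>) / (1/4) \<le> \<epsilon>"
            unfolding L_def[symmetric] using \<epsilon> by simp
        qed (use T(1) in auto)
        then obtain R C \<phi> where P: "(R, C, \<phi>) \<in> quartic_psi f" "close pt \<epsilon> T (R, C, \<phi>)"
          "real_of_int \<bar>ring_disc TYPE(4) R\<bar> \<le> (1536 * Y ^ 3)\<^sup>2" by blast
        have "(1536 * Y ^ 3)\<^sup>2 = q * Y ^ 6" by (simp add: q_def power_mult_distrib)
        then have "(1536 * Y ^ 3)\<^sup>2 = T" unfolding Y6 using q by simp
        then have "real_of_int \<bar>ring_disc TYPE(4) R\<bar> \<le> T" using P(3) by simp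
        moreover have "(R, C, \<phi>) \<in> resolvent_pairs"
          using P(1) unfolding quartic_psi_def bhargava_class_def by blast
        ultimately have mem: "(R, C, \<phi>) \<in> {(R, C, \<phi>) \<in> resolvent_pairs.
            real_of_int \<bar>ring_disc TYPE(4) R\<bar> \<le> T \<and> close pt \<epsilon> T (R, C, \<phi>)}"
          using P(2) by blast
        have "quartic_psi f = pair_iso `` {(R, C, \<phi>)}"
          using P(1) unfolding quartic_psi_def by (rule bhargava_class_eq)
        then have "quartic_psi f \<in> F4 pt \<epsilon> T"
          unfolding F4_def using quotientI[OF mem] by simp
        then show ?thesis using F by blast
      qed
      have finG: "finite G" by (simp add: G_def)
      have finb: "finite (bad_forms \<delta> Y)"
        by (rule finite_subset[of _ "height_box Y"]) (unfold bad_forms_def, blast, simp)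
      have half: "1/2 * real (card (height_box Y)) \<le> real (card G)"
      proof -
        have "height_box Y \<subseteq> G \<union> (bad_forms \<delta> Y \<union> {f. flip f \<in> bad_forms \<delta> Y})"
          unfolding G_def good_forms_def by blast
        then have "card (height_box Y) \<le> card (G \<union> (bad_forms \<delta> Y \<union> {f. flip f \<in> bad_forms \<delta> Y}))"
          using finG finb finite_vimageI[OF finb inj_flip] by (intro card_mono) (simp_all add: vimage_def)
        also have "\<dots> \<le> card G + (card (bad_forms \<delta> Y) + card {f. flip f \<in> bad_forms \<delta> Y})"
          by (rule order_trans[OF card_Un_le add_left_mono[OF card_Un_le]])
        finally have "real (card (height_box Y)) \<le> real (card G) + 2 * real (card (bad_forms \<delta> Y))"
          unfolding card_flip_bad by linarith
        then show ?thesis using bad[OF YY0(1)] by linarith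
      qed
      have "Y ^ 5 \<le> real (card (int_ball 0 Y)) ^ 5"
        using card_int_ball_ge[of Y] Ypos by (intro power_mono) auto
      then have "1/2 * Y ^ 5 \<le> real (card G)"
        using half by (simp add: card_box)
      also have "card G \<le> N * card (quartic_psi ` G)"
      proof -
        have "G = (\<Union>K\<in>quartic_psi ` G. {f \<in> G. quartic_psi f = K})" by blast
        then have "card G \<le> (\<Sum>K\<in>quartic_psi ` G. card {f \<in> G. quartic_psi f = K})"
          using card_UN_le[of "quartic_psi ` G" "\<lambda>K. {f \<in> G. quartic_psi f = K}"] finG by simp
        also have "\<dots> \<le> (\<Sum>K\<in>quartic_psi ` G. N)"
        proof (rule sum_mono)
          fix K assume "K \<in> quartic_psi ` G"
          then obtain f' where f': "f' \<in> G" "K = quartic_psi f'" by blast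
          have "card {f \<in> G. quartic_psi f = K} \<le> card {f \<in> good_forms \<delta> Y. quartic_psi f = quartic_psi f'}"
          proof (rule card_mono)
            show "finite {f \<in> good_forms \<delta> Y. quartic_psi f = quartic_psi f'}"
              by (rule finite_subset[of _ "good_forms \<delta> Y"]) (blast, simp)
            show "{f \<in> G. quartic_psi f = K} \<subseteq> {f \<in> good_forms \<delta> Y. quartic_psi f = quartic_psi f'}"
              unfolding G_def f'(2) by blast
          qed
          also have "\<dots> \<le> N"
            using f'(1) by (intro N(2) YY0 Ysq) (simp add: G_def)
          finally show "card {f \<in> G. quartic_psi f = K} \<le> N" .
        qed
        finally show ?thesis by (simp add: mult.commute)
      qed
      finally have fin1: "1/2 * Y ^ 5 \<le> real N * real (card (quartic_psi ` G))" by simp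
      have "k * T powr (5/6) = (1/2 * Y ^ 5) / real N"
        unfolding Y5 k_def by simp
      also have "\<dots> \<le> real (card (quartic_psi ` G))"
        using fin1 N(1) by (simp add: divide_le_eq mult_ac)
      finally show "\<exists>S. finite S \<and> S \<subseteq> {K \<in> F4 pt \<epsilon> T. K \<in> quartic_psi ` F4_bin} \<and>
        k * T powr (5/6) \<le> real (card S)"
        using cls finG by (intro exI[of _ "quartic_psi ` G"]) blast
    qed
  qed
qed

section \<open>Reduced bases\<close>

context emb_ring
begin

definition ev :: "'n \<Rightarrow> int ^ 'n \<Rightarrow> complex" where "ev i x = \<sigma> i (int_comb R b x)"

lemma ev_add: "ev i (x + y) = ev i x + ev i y"
  by (simp add: ev_def sigma_int_comb sum.distrib algebra_simps)

lemma ev_scale: "ev i (m *s x) = of_int m * ev i x"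
  by (simp add: ev_def sigma_int_comb sum_distrib_left algebra_simps)

lemma ev_sum: "ev i (\<Sum>a\<in>A. f a) = (\<Sum>a\<in>A. ev i (f a))"
proof (cases "finite A")
  case True
  then show ?thesis
    using ev_scale[of i 0 0] by (induction A rule: finite_induct) (auto simp: ev_add)
qed (use ev_scale[of i 0 0] in simp)

lemma ev_coords: "x \<in> carrier R \<Longrightarrow> ev i (coords R b x) = \<sigma> i x"
  by (simp add: ev_def)

lemma ev_eqI: "(\<And>i. ev i x = ev i y) \<Longrightarrow> x = y"
  using sigma_eqI[of "int_comb R b x" "int_comb R b y"] by (simp add: ev_def int_comb_inject)

definition e0 :: "int ^ 'n" where "e0 = coords R b \<one>"

lemma ev_e0: "ev i e0 = 1"
  by (simp add: e0_def ev_coords sigma_one)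

lemma e0_nonzero: "e0 \<noteq> 0"
  using ev_e0[of undefined] ev_scale[of undefined 0 0] by auto

text \<open>If \<open>x = u/w\<close> in lowest terms, then \<open>w\<^sup>k\<close> divides the coordinates of \<open>1\<close> for all \<open>k\<close>, since
  \<open>x\<^sup>k\<close> lies in the ring.\<close>

lemma rational_imp_integer:
  assumes w: "w \<noteq> 0" and eq: "\<And>i. of_int w * ev i x = of_int u"
  shows "\<exists>q. x = q *s e0"
proof -
  define g where "g = gcd u w"
  have g: "g \<noteq> 0" using w by (simp add: g_def)
  obtain u' w' where uw: "u = u' * g" "w = w' * g" and cop: "coprime u' w'"
    using gcd_coprime_exists[of u w] g unfolding g_def by blast
  have eq': "of_int w' * ev i x = of_int u'" for i
    using eq[of i] g unfolding uw by simp
  let ?X = "int_comb R b x"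
  have pw: "\<sigma> i (?X [^] (k::nat)) = (ev i x) ^ k" for i k
    by (induction k) (simp_all add: sigma_one sigma_mult ev_def mult.commute)
  have dv: "w' ^ k dvd e0 $ j" for k j
  proof -
    have "w' ^ k *s coords R b (?X [^] k) = u' ^ k *s e0"
      by (rule ev_eqI) (simp add: ev_scale ev_coords pw ev_e0 power_mult_distrib[symmetric] eq')
    then have "w' ^ k * coords R b (?X [^] k) $ j = u' ^ k * e0 $ j"
      by (metis vector_smult_component)
    then have "w' ^ k dvd u' ^ k * e0 $ j" by (metis dvd_triv_left)
    moreover have "coprime (w' ^ k) (u' ^ k)" using cop by (simp add: coprime_commute)
    ultimately show ?thesis by (simp add: coprime_dvd_mult_right_iff)
  qed
  obtain j where j: "e0 $ j \<noteq> 0" using e0_nonzero by (auto simp: vec_eq_iff)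
  have "\<bar>w'\<bar> = 1"
  proof (rule ccontr)
    assume "\<bar>w'\<bar> \<noteq> 1"
    moreover have "w' \<noteq> 0" using w uw by auto
    ultimately have w2: "2 \<le> \<bar>w'\<bar>" by linarith
    \<comment> \<open>With this exponent a divisor of absolute value at least 2^k, hence greater
      than k, would divide a nonzero number of absolute value k.\<close>
    define k where "k = nat \<bar>e0 $ j\<bar>"
    have "\<bar>w' ^ k\<bar> \<le> \<bar>e0 $ j\<bar>"
      using dv[of k j] j by (intro dvd_imp_le_int)
    moreover have "2 ^ k \<le> \<bar>w'\<bar> ^ k" using w2 by (intro power_mono) auto
    moreover have "\<bar>e0 $ j\<bar> = int k" by (simp add: k_def)
    moreover have "int k < 2 ^ k" by (metis of_nat_less_two_power)
    ultimately show False by (simp add: power_abs)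
  qed
  then have ww: "w' * w' = 1" by (metis abs_mult_self_eq mult_1)
  have "x = (w' * u') *s e0"
  proof (rule ev_eqI)
    fix i
    have "ev i x = of_int (w' * w') * ev i x" unfolding ww by simp
    also have "\<dots> = of_int w' * (of_int w' * ev i x)" by simp
    also have "\<dots> = ev i ((w' * u') *s e0)" unfolding eq' by (simp add: ev_scale ev_e0)
    finally show "ev i x = ev i ((w' * u') *s e0)" .
  qed
  then show ?thesis by blast
qed

end

section \<open>Integral coordinates by Cramer's rule\<close>

definition row_matrix :: "('n \<Rightarrow> nat) \<Rightarrow> (nat \<Rightarrow> int ^ 'n) \<Rightarrow> int ^ 'n ^ 'n::finite" where
  "row_matrix e v = (\<chi> r. v (e r))"

text \<open>The numerator in Cramer's rule, with x in place of \<open>v k\<close>. It is an integral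
  linear functional of x, in contrast to the coordinate itself.\<close>

definition row_det :: "('n::finite \<Rightarrow> nat) \<Rightarrow> (nat \<Rightarrow> int ^ 'n) \<Rightarrow> nat \<Rightarrow> int ^ 'n \<Rightarrow> int" where
  "row_det e v k x = det (\<chi> r. if r = inv_into UNIV e k then x else v (e r))"

context
  fixes e :: "'n::finite \<Rightarrow> nat" and m :: nat
  assumes e: "bij_betw e UNIV {..m}"
begin

lemma row_det_add: "row_det e v k (x + y) = row_det e v k x + row_det e v k y"
  unfolding row_det_def by (rule det_row_add)

lemma row_det_scale: "row_det e v k (c *s x) = c * row_det e v k x"
  unfolding row_det_def by (rule det_row_mul)

lemma inv_e: "k \<le> m \<Longrightarrow> e (inv_into UNIV e k) = k"
  using e by (intro f_inv_into_f) (auto simp: bij_betw_def)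

lemma row_det_dual:
  assumes "k \<le> m" "j \<le> m"
  shows "row_det e v k (v j) = (if k = j then det (row_matrix e v) else 0)"
proof (cases "k = j")
  case True
  have "(\<chi> r. if r = inv_into UNIV e k then v j else v (e r)) = row_matrix e v"
    using inv_e[OF assms(1)] True by (auto simp: row_matrix_def vec_eq_iff)
  then show ?thesis using True by (simp add: row_det_def)
next
  case False
  have ne: "inv_into UNIV e k \<noteq> inv_into UNIV e j"
    using inv_e[OF assms(1)] inv_e[OF assms(2)] False by metis
  have "row_det e v k (v j) = 0"
    unfolding row_det_def
    by (rule det_identical_rows[OF ne]) (use ne inv_e[OF assms(2)] in \<open>auto simp: row_def vec_eq_iff\<close>)
  then show ?thesis using False by simp
qed

lemma row_det_cramer:
  assumes "det (row_matrix e v) \<noteq> 0"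
  shows "det (row_matrix e v) *s x = (\<Sum>k\<le>m. row_det e v k x *s v k)"
proof -
  let ?A = "cmat (row_matrix e v)"
  have dA: "det ?A = of_int (det (row_matrix e v))" by (rule det_cmat)
  have "det (transpose ?A) \<noteq> 0" using assms by (simp add: det_transpose dA)
  then obtain y where y: "transpose ?A *v y = cvec x" by (rule det_nz_surj)
  have ys: "(\<Sum>i\<in>UNIV. y $ i *s row i ?A) = cvec x"
    unfolding y[symmetric] by (simp add: vec_eq_iff matrix_vector_mult_def transpose_def row_def mult.commute)
  have rd: "of_int (row_det e v k x) = y $ inv_into UNIV e k * det ?A" for k
  proof -
    have "of_int (row_det e v k x) = det (\<chi> i. if i = inv_into UNIV e k then cvec x else row i ?A)"
      unfolding row_det_def of_int_det
      by (rule arg_cong[of _ _ det]) (auto simp: vec_eq_iff cvec_def row_def cmat_def row_matrix_def)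
    also have "\<dots> = y $ inv_into UNIV e k * det ?A"
      unfolding ys[symmetric] by (rule cramer_lemma_transpose)
    finally show ?thesis .
  qed
  have "of_int ((\<Sum>k\<le>m. row_det e v k x *s v k) $ j) = (of_int ((det (row_matrix e v) *s x) $ j) :: complex)" for j
  proof -
    have "of_int ((\<Sum>k\<le>m. row_det e v k x *s v k) $ j) = (\<Sum>k\<le>m. y $ inv_into UNIV e k * det ?A * of_int (v k $ j))"
      by (simp add: rd)
    also have "\<dots> = (\<Sum>r\<in>UNIV. y $ inv_into UNIV e (e r) * det ?A * of_int (v (e r) $ j))"
      by (rule sum.reindex_bij_betw[OF e, symmetric])
    also have "\<dots> = (\<Sum>r\<in>UNIV. y $ r * det ?A * of_int (v (e r) $ j))"
      using e by (simp add: bij_betw_def)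
    also have "\<dots> = det ?A * (\<Sum>i\<in>UNIV. y $ i *s row i ?A) $ j"
      by (simp add: sum_distrib_left row_def cmat_def row_matrix_def mult_ac)
    also have "\<dots> = of_int ((det (row_matrix e v) *s x) $ j)"
      unfolding ys dA by (simp add: cvec_def)
    finally show ?thesis .
  qed
  then have eq: "(\<Sum>k\<le>m. row_det e v k x *s v k) $ j = (det (row_matrix e v) *s x) $ j" for j
    by (simp only: of_int_eq_iff)
  show ?thesis unfolding vec_eq_iff by (rule allI) (rule eq[symmetric])
qed

end

context emb_ring
begin

text \<open>The functionals \<open>row_det e v k\<close>, with a sign, are the scaled coordinates of
  \<open>adapted_basis\<close>.\<close>

lemma reduced_basis:
  fixes e :: "'n \<Rightarrow> nat"
  assumes e: "bij_betw e UNIV {..m}" and v0: "v 0 = e0" and det: "det (row_matrix e v) \<noteq> 0"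
  shows "\<exists>\<beta>. \<beta> 0 = e0 \<and> is_int_basis R (\<lambda>j. int_comb R b (\<beta> (e j))) \<and>
    (\<forall>j\<le>m. \<forall>i. cmod (ev i (\<beta> j)) \<le> (\<Sum>k\<le>j. cmod (ev i (v k))))"
proof -
  define s where "s = sgn (det (row_matrix e v))"
  define D where "D = \<bar>det (row_matrix e v)\<bar>"
  have sD: "s * det (row_matrix e v) = D" and s1: "\<bar>s\<bar> = 1" and D: "D > 0"
    using det by (auto simp: s_def D_def sgn_if)
  define t where "t k x = s * row_det e v k x" for k x
  have cram: "D *s x = (\<Sum>k\<le>m. t k x *s v k)" for x
  proof -
    have "D *s x = s *s (det (row_matrix e v) *s x)"
      unfolding sD[symmetric] by (simp add: vec_eq_iff)
    also have "\<dots> = (\<Sum>k\<le>m. t k x *s v k)"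
      unfolding row_det_cramer[OF e det] by (simp add: vec_eq_iff t_def sum_distrib_left mult.assoc)
    finally show ?thesis .
  qed
  \<comment> \<open>A rational multiple of 1 that lies in the ring is an integer, so 1 is primitive
    and can be kept as the first basis vector.\<close>
  have prim: "\<exists>c. x = c *s v 0" if "\<forall>i. 1 \<le> i \<and> i \<le> m \<longrightarrow> t i x = 0" for x
  proof -
    have "(\<Sum>k\<le>m. t k x *s v k) = (\<Sum>k\<in>{0}. t k x *s v k)"
      using that by (intro sum.mono_neutral_right) (auto simp: vec_eq_iff)
    then have "D *s x = t 0 x *s e0" using cram[of x] v0 by simp
    then have "ev i (D *s x) = ev i (t 0 x *s e0)" for i by simp
    then have "of_int D * ev i x = of_int (t 0 x)" for i by (simp add: ev_scale ev_e0)
    then show ?thesis using rational_imp_integer[of D x "t 0 x"] D v0 by simp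
  qed
  obtain \<beta> where \<beta>: "\<beta> 0 = v 0"
    and tb: "\<And>j. j \<le> m \<Longrightarrow> t j (\<beta> j) \<noteq> 0 \<and> (\<forall>i\<le>m. j < i \<longrightarrow> t i (\<beta> j) = 0) \<and> (\<forall>i\<le>m. \<bar>t i (\<beta> j)\<bar> \<le> D)"
    and gen: "\<And>x. \<exists>c. x = (\<Sum>j\<le>m. c j *s \<beta> j)"
  proof -
    have "\<exists>\<beta>. \<beta> 0 = v 0 \<and> (\<forall>j\<le>m. t j (\<beta> j) \<noteq> 0 \<and> (\<forall>i\<le>m. j < i \<longrightarrow> t i (\<beta> j) = 0) \<and> (\<forall>i\<le>m. \<bar>t i (\<beta> j)\<bar> \<le> D)) \<and>
     (\<forall>x. (\<forall>i\<le>m. m < i \<longrightarrow> t i x = 0) \<longrightarrow> (\<exists>c. x = (\<Sum>j\<le>m. c j *s \<beta> j)))"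
    proof (rule adapted_basis[OF D])
      show "t i (x + y) = t i x + t i y" for i x y
        by (simp add: t_def row_det_add[OF e] distrib_left)
      show "t i (c *s x) = c * t i x" for i c x
        by (simp add: t_def row_det_scale[OF e])
      show "t i (v j) = (if i = j then D else 0)" if "i \<le> m" "j \<le> m" for i j
        using row_det_dual[OF e that, of v] sD by (simp add: t_def)
    qed (use prim in auto)
    then obtain \<beta> where "\<beta> 0 = v 0"
      "\<forall>j\<le>m. t j (\<beta> j) \<noteq> 0 \<and> (\<forall>i\<le>m. j < i \<longrightarrow> t i (\<beta> j) = 0) \<and> (\<forall>i\<le>m. \<bar>t i (\<beta> j)\<bar> \<le> D)"
      "\<forall>x. (\<forall>i\<le>m. m < i \<longrightarrow> t i x = 0) \<longrightarrow> (\<exists>c. x = (\<Sum>j\<le>m. c j *s \<beta> j))" by blast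
    then show ?thesis using that[of \<beta>] by simp
  qed
  have "is_int_basis R (\<lambda>j. int_comb R b (\<beta> (e j)))"
  proof (rule int_basis_of_generating)
    fix x
    obtain c where "x = (\<Sum>j\<le>m. c j *s \<beta> j)" using gen by blast
    also have "\<dots> = (\<Sum>j\<in>UNIV. c (e j) *s \<beta> (e j))"
      by (rule sum.reindex_bij_betw[OF e, symmetric])
    finally show "\<exists>c. x = (\<Sum>j\<in>UNIV. c j *s \<beta> (e j))" by (intro exI[of _ "\<lambda>j. c (e j)"])
  qed
  \<comment> \<open>The scaled coordinates of \<beta> j vanish beyond j and are at most D in
    absolute value, so after division by D every \<open>v k\<close> enters with a coefficient of
    absolute value at most 1.\<close>
  moreover have "cmod (ev i (\<beta> j)) \<le> (\<Sum>k\<le>j. cmod (ev i (v k)))" if j: "j \<le> m" for i j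
  proof -
    have "(\<Sum>k\<le>m. t k (\<beta> j) *s v k) = (\<Sum>k\<le>j. t k (\<beta> j) *s v k)"
      using j tb[OF j] by (intro sum.mono_neutral_right) (auto simp: vec_eq_iff)
    then have "of_int D * ev i (\<beta> j) = (\<Sum>k\<le>j. of_int (t k (\<beta> j)) * ev i (v k))"
      using arg_cong[OF cram[of "\<beta> j"], of "ev i"] by (simp add: ev_scale ev_sum)
    then have "real_of_int D * cmod (ev i (\<beta> j)) = cmod (\<Sum>k\<le>j. of_int (t k (\<beta> j)) * ev i (v k))"
      using D by (metis abs_of_pos norm_mult norm_of_int of_int_0_less_iff)
    also have "\<dots> \<le> (\<Sum>k\<le>j. real_of_int D * cmod (ev i (v k)))"
    proof (rule sum_norm_le)
      fix k assume "k \<in> {..j}"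
      then have "\<bar>t k (\<beta> j)\<bar> \<le> D" using tb[OF j] j by auto
      then have "real_of_int \<bar>t k (\<beta> j)\<bar> \<le> real_of_int D" by (simp only: of_int_le_iff)
      then show "cmod (of_int (t k (\<beta> j)) * ev i (v k)) \<le> real_of_int D * cmod (ev i (v k))"
        by (simp add: norm_mult mult_right_mono)
    qed
    finally show ?thesis using D by (simp flip: sum_distrib_left)
  qed
  ultimately show ?thesis using \<beta> v0 by auto
qed

text \<open>Steinitz exchange. By Cramer's rule the coordinates of 1 cannot all vanish, so 1
  replaces some \<open>u k\<close> without making the determinant zero. All other entries remain
  members of the witness family and keep its length bound.\<close>

lemma exchange_one:
  fixes e :: "'n \<Rightarrow> nat"
  assumes e: "bij_betw e UNIV {..m}" and v: "sm_witness m v r"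
  shows "\<exists>v'. v' 0 = e0 \<and> det (row_matrix e v') \<noteq> 0 \<and> (\<forall>j. 1 \<le> j \<and> j \<le> m \<longrightarrow> (\<exists>k\<le>m. v' j = coords R b (v k)))"
proof -
  define u where "u k = coords R b (v k)" for k
  have "row_matrix e u = transpose (\<chi> k c. coords R b (v (e c)) $ k)"
    by (simp add: row_matrix_def transpose_def u_def vec_eq_iff)
  then have du: "det (row_matrix e u) \<noteq> 0"
    using sm_witness_det[OF e v] by (simp add: det_transpose)
  have "\<exists>k\<le>m. row_det e u k e0 \<noteq> 0"
  proof (rule ccontr)
    assume "\<not> ?thesis"
    then have "(\<Sum>k\<le>m. row_det e u k e0 *s u k) = 0" by (intro sum.neutral) (auto simp: vec_eq_iff)
    then have "det (row_matrix e u) *s e0 = 0" by (simp add: row_det_cramer[OF e du])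
    then show False using du e0_nonzero by (auto simp: vec_eq_iff)
  qed
  then obtain k where k: "k \<le> m" "row_det e u k e0 \<noteq> 0" by blast
  \<comment> \<open>Since 1 must stand in front, \<open>u 0\<close> moves to the vacated place k;
    this interchange of two rows affects only the sign of the determinant.\<close>
  define v' where "v' j = (if j = 0 then e0 else if j = k then u 0 else u j)" for j
  let ?i = "inv_into UNIV e"
  let ?p = "Transposition.transpose (?i 0) (?i k)"
  have inv: "?i (e r) = r" for r using e by (simp add: bij_betw_def)
  have ei: "e (?i j) = j" if "j \<le> m" for j by (rule inv_e[OF e that])
  have "row_matrix e v' = (\<chi> r. (\<chi> r. if r = ?i k then e0 else u (e r)) $ ?p r)"
  proof -
    have "v' (e r) = (if ?p r = ?i k then e0 else u (e (?p r)))" for r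
    proof -
      consider "r = ?i 0" | "r = ?i k" "r \<noteq> ?i 0" | "r \<noteq> ?i 0" "r \<noteq> ?i k" by blast
      then show ?thesis
      proof cases
        case 1
        then show ?thesis using ei[of 0] by (simp add: v'_def)
      next
        case 2
        then have "k \<noteq> 0" by metis
        then show ?thesis using 2 ei[of 0] ei[OF k(1)] by (auto simp: v'_def)
      next
        case 3
        then have "e r \<noteq> 0" "e r \<noteq> k" using inv[of r] by metis+
        then show ?thesis using 3 by (simp add: v'_def transpose_apply_other)
      qed
    qed
    then show ?thesis by (simp add: row_matrix_def)
  qed
  then have "det (row_matrix e v') = det (\<chi> r. (\<chi> r. if r = ?i k then e0 else u (e r)) $ ?p r)"
    by (rule arg_cong)
  also have "\<dots> = of_int (sign ?p) * det (\<chi> r. if r = ?i k then e0 else u (e r))"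
    by (rule det_permute_rows) (intro permutes_swap_id UNIV_I)
  finally have "det (row_matrix e v') = of_int (sign ?p) * row_det e u k e0"
    unfolding row_det_def .
  then have "det (row_matrix e v') \<noteq> 0"
    using k(2) by (simp add: sign_def)
  moreover have "\<exists>k\<le>m. v' j = coords R b (v k)" if "1 \<le> j" "j \<le> m" for j
    using that by (auto simp: v'_def u_def)
  ultimately show ?thesis by (intro exI[of _ v']) (auto simp: v'_def)
qed

end

lemma (in emb_ring) proportional_imp_scalar:
  assumes "\<And>i j. e0 $ i * u $ j = e0 $ j * u $ i"
  shows "\<exists>q. u = q *s e0"
proof -
  obtain i where i: "e0 $ i \<noteq> 0" using e0_nonzero by (auto simp: vec_eq_iff)
  have "e0 $ i *s u = u $ i *s e0"
    using assms by (simp add: vec_eq_iff mult.commute)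
  then have "ev k (e0 $ i *s u) = ev k (u $ i *s e0)" for k by simp
  then have "of_int (e0 $ i) * ev k u = of_int (u $ i)" for k by (simp add: ev_scale ev_e0)
  then show ?thesis by (rule rational_imp_integer[OF i])
qed

abbreviation ix4 :: "4 \<Rightarrow> nat" where
  "ix4 i \<equiv> if i = 0 then 0 else if i = 1 then 1 else if i = 2 then 2 else 3"

abbreviation ix3 :: "3 \<Rightarrow> nat" where
  "ix3 i \<equiv> if i = 0 then 0 else if i = 1 then 1 else 2"

lemma bij_ix4: "bij_betw (\<lambda>i. ix4 i) UNIV {..3}"
proof -
  have "{..3} = {..<4::nat}" by auto
  then show ?thesis using bij_4_nat by simp
qed

lemma bij_ix3: "bij_betw (\<lambda>i. ix3 i) UNIV {..2}"
proof -
  have "{..2} = {..<3::nat}" by auto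
  then show ?thesis using bij_3_nat by simp
qed

locale cubic_emb_ring = emb_ring R b \<sigma> for R :: "('a, 'm) ring_scheme" and b :: "3 \<Rightarrow> 'a" and \<sigma>
begin

text \<open>If no member completes 1 and u, then the functional det(1, u, -) vanishes on a family of
  full rank, hence everywhere, and u is proportional to 1.\<close>

lemma exchange_pair:
  assumes u: "\<forall>k. u \<noteq> k *s e0" and v: "sm_witness 2 v r"
  shows "\<exists>k\<le>2. det (row_matrix (\<lambda>i. ix3 i) (\<lambda>j. if j = 0 then e0 else if j = 1 then u else coords R b (v k))) \<noteq> 0"
proof (rule ccontr)
  assume z: "\<not> ?thesis"
  define L where "L x = det (row_matrix (\<lambda>i. ix3 i) (\<lambda>j. if j = 0 then e0 else if j = 1 then u else x))" for x
  define z where "z k = coords R b (v k)" for k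
  have L: "L x = e0$0 * u$1 * x$2 + e0$1 * u$2 * x$0 + e0$2 * u$0 * x$1
    - e0$0 * u$2 * x$1 - e0$1 * u$0 * x$2 - e0$2 * u$1 * x$0" for x
    unfolding L_def by (simp add: row_matrix_def det_3_0)
  have "row_matrix (\<lambda>i. ix3 i) z = transpose (\<chi> k c. coords R b (v (ix3 c)) $ k)"
    by (simp add: row_matrix_def transpose_def z_def vec_eq_iff)
  then have dz: "det (row_matrix (\<lambda>i. ix3 i) z) \<noteq> 0"
    using sm_witness_det[OF bij_ix3 v] by (simp add: det_transpose)
  have zero: "L (z k) = 0" if "k \<le> 2" for k
    using z that unfolding z_def L_def by blast
  have "L x = 0" for x
  proof -
    have "det (row_matrix (\<lambda>i. ix3 i) z) *s x = (\<Sum>k\<le>2. row_det (\<lambda>i. ix3 i) z k x *s z k)"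
      by (rule row_det_cramer[OF bij_ix3 dz])
    also have "\<dots> = row_det (\<lambda>i. ix3 i) z 0 x *s z 0 + row_det (\<lambda>i. ix3 i) z 1 x *s z 1 + row_det (\<lambda>i. ix3 i) z 2 x *s z 2"
      by (simp add: numeral_2_eq_2)
    finally have "L (det (row_matrix (\<lambda>i. ix3 i) z) *s x) = row_det (\<lambda>i. ix3 i) z 0 x * L (z 0)
      + row_det (\<lambda>i. ix3 i) z 1 x * L (z 1) + row_det (\<lambda>i. ix3 i) z 2 x * L (z 2)"
      by (simp only:) (simp add: L algebra_simps)
    moreover have "L (det (row_matrix (\<lambda>i. ix3 i) z) *s x) = det (row_matrix (\<lambda>i. ix3 i) z) * L x"
      by (simp add: L algebra_simps)
    ultimately show ?thesis using zero dz by simp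
  qed
  from this[of "axis 0 1"] this[of "axis 1 1"] this[of "axis 2 1"]
  have "e0$1 * u$2 = e0$2 * u$1" "e0$2 * u$0 = e0$0 * u$2" "e0$0 * u$1 = e0$1 * u$0"
    by (simp_all add: L)
  then have "e0 $ i * u $ j = e0 $ j * u $ i" for i j
    using exhaust_3_0[of i] exhaust_3_0[of j] by (elim disjE; hypsubst) simp_all
  then show False using proportional_imp_scalar u by blast
qed

end

section \<open>Counting all classes\<close>

type_synonym coeffs = "int \<times> int \<times> int \<times> int \<times> int \<times> int"

fun qform :: "coeffs \<Rightarrow> ternary_form" where
  "qform (q1, q2, q3, q4, q5, q6) x y z = q1 * x^2 + q2 * y^2 + q3 * z^2 + q4 * (x * y) + q5 * (x * z) + q6 * (y * z)"

fun coeff_comb :: "coeffs \<Rightarrow> int \<Rightarrow> coeffs \<Rightarrow> coeffs" where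
  "coeff_comb (q1, q2, q3, q4, q5, q6) k (r1, r2, r3, r4, r5, r6) =
     (q1 - k * r1, q2 - k * r2, q3 - k * r3, q4 - k * r4, q5 - k * r5, q6 - k * r6)"

lemma qform_comb: "qform (coeff_comb q k r) x y z = qform q x y z - k * qform r x y z"
  by (cases q; cases r) (simp add: algebra_simps)

context res_pair
begin

definition tc :: "int \<Rightarrow> int \<Rightarrow> int \<Rightarrow> int ^ 3" where
  "tc x y z = coords C c (\<phi> (lc x y z))"

definition form_coeffs :: "3 \<Rightarrow> coeffs" where
  "form_coeffs j = (tc 1 0 0 $ j, tc 0 1 0 $ j, tc 0 0 1 $ j, tc 1 1 0 $ j - tc 1 0 0 $ j - tc 0 1 0 $ j,
     tc 1 0 1 $ j - tc 1 0 0 $ j - tc 0 0 1 $ j, tc 0 1 1 $ j - tc 0 1 0 $ j - tc 0 0 1 $ j)"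

lemma ev_tc: "C.ev j (tc x y z) = pair_sum (\<lambda>i. \<sigma> i (lc x y z)) j"
  by (simp add: tc_def C.ev_coords phi phi_closed)

text \<open>In every embedding \<phi> is a quadratic form in (x, y, z), so polarization recovers it
  from six values.\<close>

lemma tc_qform: "tc x y z $ j = qform (form_coeffs j) x y z"
proof -
  have "tc x y z = x^2 *s tc 1 0 0 + y^2 *s tc 0 1 0 + z^2 *s tc 0 0 1
    + (x*y) *s (tc 1 1 0 + (-1) *s tc 1 0 0 + (-1) *s tc 0 1 0) + (x*z) *s (tc 1 0 1 + (-1) *s tc 1 0 0 + (-1) *s tc 0 0 1)
    + (y*z) *s (tc 0 1 1 + (-1) *s tc 0 1 0 + (-1) *s tc 0 0 1)" (is "_ = ?r")
  proof (rule C.ev_eqI)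
    fix i
    show "C.ev i (tc x y z) = C.ev i ?r"
      unfolding C.ev_add C.ev_scale ev_tc sigma_lc
      by (simp add: pair_sum_def power2_eq_square algebra_simps)
  qed
  from arg_cong[OF this, of "\<lambda>v. v $ j"] show ?thesis
    by (simp add: form_coeffs_def algebra_simps)
qed

lemma rep_pair_form_coeffs: "rep_pair R b \<sigma> C c \<tau> \<phi> (qform (form_coeffs 1)) (qform (form_coeffs 2))"
proof
  fix x y z
  have "\<phi> (lc x y z) = [(tc x y z $ 0)] \<cdot>\<^bsub>C\<^esub> \<one>\<^bsub>C\<^esub> \<oplus>\<^bsub>C\<^esub> [(qform (form_coeffs 1) x y z)] \<cdot>\<^bsub>C\<^esub> c 1 \<oplus>\<^bsub>C\<^esub> [(qform (form_coeffs 2) x y z)] \<cdot>\<^bsub>C\<^esub> c 2"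
    unfolding tc_qform[symmetric]
  proof (rule C.sigma_eqI)
    fix i
    show "\<tau> i (\<phi> (lc x y z)) = \<tau> i ([(tc x y z $ 0)] \<cdot>\<^bsub>C\<^esub> \<one>\<^bsub>C\<^esub> \<oplus>\<^bsub>C\<^esub> [(tc x y z $ 1)] \<cdot>\<^bsub>C\<^esub> c 1 \<oplus>\<^bsub>C\<^esub> [(tc x y z $ 2)] \<cdot>\<^bsub>C\<^esub> c 2)"
      using C.sigma_coords[of "\<phi> (lc x y z)" i]
      by (simp add: phi_closed sum_3_0 tc_def C.sigma_add C.sigma_int_pow C.sigma_one)
  qed (simp_all add: phi_closed)
  then show "\<exists>k::int. \<phi> (lc x y z) = [k] \<cdot>\<^bsub>C\<^esub> \<one>\<^bsub>C\<^esub> \<oplus>\<^bsub>C\<^esub> [(qform (form_coeffs 1) x y z)] \<cdot>\<^bsub>C\<^esub> c 1 \<oplus>\<^bsub>C\<^esub> [(qform (form_coeffs 2) x y z)] \<cdot>\<^bsub>C\<^esub> c 2"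
    by (rule exI)
qed

text \<open>The restriction on x, y, z covers the six vectors used for polarization. The conjugates
  are at most 2 \<mu>, so the sum of two products is at most 8 \<mu>^2; the factor 6 is 3!.\<close>

lemma tc_bound:
  assumes \<mu>: "\<And>i j. cmod (\<sigma> i (b j)) \<le> \<mu>" and M: "\<And>i j. cmod (\<tau> i (c j)) \<le> M j"
    and xyz: "\<bar>x\<bar> + \<bar>y\<bar> + \<bar>z\<bar> \<le> 2"
  shows "real_of_int \<bar>tc x y z $ j\<bar> * cmod (det C.S) \<le> 6 * (8 * \<mu>\<^sup>2 * (\<Prod>k\<in>UNIV - {j}. M k))"
proof -
  have \<mu>0: "0 \<le> \<mu>" using \<mu>[of 0 0] norm_ge_zero order_trans by blast
  have s: "cmod (\<sigma> i (lc x y z)) \<le> 2 * \<mu>" for i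
  proof -
    have "cmod (\<sigma> i (lc x y z)) \<le> real_of_int \<bar>x\<bar> * \<mu> + real_of_int \<bar>y\<bar> * \<mu> + real_of_int \<bar>z\<bar> * \<mu>"
      unfolding sigma_lc by (intro order_trans[OF norm_triangle_ineq] add_mono)
        (simp_all add: norm_mult mult_left_mono \<mu>)
    also have "\<dots> = real_of_int (\<bar>x\<bar> + \<bar>y\<bar> + \<bar>z\<bar>) * \<mu>" by (simp add: algebra_simps)
    also have "\<dots> \<le> real_of_int 2 * \<mu>" using xyz \<mu>0 by (intro mult_right_mono) (simp_all only: of_int_le_iff)
    finally show ?thesis by simp
  qed
  have p: "cmod (\<sigma> i (lc x y z) * \<sigma> k (lc x y z)) \<le> 4 * \<mu>\<^sup>2" for i k
  proof -
    have "cmod (\<sigma> i (lc x y z)) * cmod (\<sigma> k (lc x y z)) \<le> (2 * \<mu>) * (2 * \<mu>)"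
      by (intro mult_mono s) (simp_all add: \<mu>0)
    then show ?thesis by (simp add: norm_mult power2_eq_square)
  qed
  have "cmod (\<tau> i (\<phi> (lc x y z))) \<le> 8 * \<mu>\<^sup>2" for i
  proof -
    have "cmod (u * v + w * t) \<le> 8 * \<mu>\<^sup>2" if "cmod (u * v) \<le> 4 * \<mu>\<^sup>2" "cmod (w * t) \<le> 4 * \<mu>\<^sup>2" for u v w t
      using norm_triangle_ineq[of "u * v" "w * t"] that by linarith
    then show ?thesis
      unfolding phi[OF lc_closed] pair_sum_def using p by simp
  qed
  from C.coords_bound[OF phi_closed[OF lc_closed] M this]
  show ?thesis by (simp add: tc_def fact_numeral)
qed

end

text \<open>Changing the basis \<open>1, c\<^sub>1, c\<^sub>2\<close> to \<open>1, c\<^sub>1, c\<^sub>2 + k c\<^sub>1\<close>.\<close>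

lemma (in rep_pair) represented_by_shift:
  "represented_by R C \<phi> (\<lambda>x y z. A x y z - k * B x y z) B"
proof -
  define \<gamma> :: "3 \<Rightarrow> int ^ 3" where "\<gamma> j = axis j 1 + (if j = 2 then k else 0) *s axis 1 1" for j
  define c2 where "c2 j = int_comb C c (\<gamma> j)" for j
  have tc2: "\<tau> i (c2 j) = \<tau> i (c j) + (if j = 2 then of_int k * \<tau> i (c 1) else 0)" for i j
    unfolding c2_def C.sigma_int_comb sum_3_0 using exhaust_3_0[of j]
    by (elim disjE; hypsubst) (simp_all add: \<gamma>_def axis_def)
  have basis: "is_int_basis C c2"
    unfolding c2_def
  proof (rule C.int_basis_of_generating)
    fix x
    define e :: "3 \<Rightarrow> int" where "e j = (if j = 1 then x $ 1 - k * x $ 2 else x $ j)" for j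
    have "x = (\<Sum>j\<in>UNIV. e j *s \<gamma> j)"
      unfolding vec_eq_iff all_3_0 sum_3_0 by (simp add: \<gamma>_def axis_def e_def)
    then show "\<exists>e. x = (\<Sum>j\<in>UNIV. e j *s \<gamma> j)" by (rule exI[of _ e])
  qed
  have c20: "c2 0 = \<one>\<^bsub>C\<^esub>"
    unfolding c0[symmetric] by (rule C.sigma_eqI) (simp_all add: tc2, simp add: c2_def)
  have cl: "c2 j \<in> carrier C" for j by (simp add: c2_def)
  have "rep_pair R b \<sigma> C c2 \<tau> \<phi> (\<lambda>x y z. A x y z - k * B x y z) B"
  proof -
    have eC: "emb_ring C c2 \<tau>" by (rule C.change_basis[OF basis])
    interpret C2: emb_ring C c2 \<tau> by (rule eC)
    have d: "det C2.S = det R.S \<or> det C2.S = - det R.S"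
      using C.det_emb_matrix_basis[OF basis] det_eq by auto
    interpret N: res_pair R b \<sigma> C c2 \<tau> \<phi>
      by unfold_locales (auto simp: phi_closed phi b0 c20 d)
    show ?thesis
    proof
      fix x y z
      obtain l :: int where l: "\<And>j. \<tau> j (\<phi> (lc x y z)) = of_int l + of_int (A x y z) * \<tau> j (c 1) + of_int (B x y z) * \<tau> j (c 2)"
        using tau_phi_lc by blast
      have "\<phi> (lc x y z) = [l] \<cdot>\<^bsub>C\<^esub> \<one>\<^bsub>C\<^esub> \<oplus>\<^bsub>C\<^esub> [(A x y z - k * B x y z)] \<cdot>\<^bsub>C\<^esub> c2 1 \<oplus>\<^bsub>C\<^esub> [(B x y z)] \<cdot>\<^bsub>C\<^esub> c2 2"
        by (rule C.sigma_eqI)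
          (simp_all add: l tc2 phi_closed cl C.sigma_add C.sigma_int_pow C.sigma_one algebra_simps)
      then show "\<exists>l::int. \<phi> (lc x y z) = [l] \<cdot>\<^bsub>C\<^esub> \<one>\<^bsub>C\<^esub> \<oplus>\<^bsub>C\<^esub> [(A x y z - k * B x y z)] \<cdot>\<^bsub>C\<^esub> c2 1 \<oplus>\<^bsub>C\<^esub> [(B x y z)] \<cdot>\<^bsub>C\<^esub> c2 2"
        by (rule exI)
    qed
  qed
  then show ?thesis by (rule rep_pair.represented_by)
qed

text \<open>The union over which of the six coefficients is the one bounded by s, so that the count
  is of fifth order in r.\<close>

definition big_small :: "real \<Rightarrow> real \<Rightarrow> coeffs set" where
  "big_small r s = (let I = int_ball 0 r; J = int_ball 0 s in
     J \<times> I \<times> I \<times> I \<times> I \<times> I \<union> I \<times> J \<times> I \<times> I \<times> I \<times> I \<union> I \<times> I \<times> J \<times> I \<times> I \<times> I \<union>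
     I \<times> I \<times> I \<times> J \<times> I \<times> I \<union> I \<times> I \<times> I \<times> I \<times> J \<times> I \<union> I \<times> I \<times> I \<times> I \<times> I \<times> J)"

definition small :: "real \<Rightarrow> coeffs set" where
  "small s = (let J = int_ball 0 s in J \<times> J \<times> J \<times> J \<times> J \<times> J)"

lemma finite_big_small: "finite (big_small r s)" and finite_small: "finite (small s)"
  by (simp_all add: big_small_def small_def Let_def)

lemma card_big_small: "card (big_small r s) \<le> 6 * (card (int_ball 0 s) * card (int_ball 0 r) ^ 5)"
proof -
  have u: "card (A \<union> B) \<le> p + q" if "card A \<le> p" "card B \<le> q" for A B :: "coeffs set" and p q
    using card_Un_le[of A B] that by linarith
  let ?n = "card (int_ball 0 s) * card (int_ball 0 r) ^ 5"
  have "card (big_small r s) \<le> ?n + ?n + ?n + ?n + ?n + ?n"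
    unfolding big_small_def Let_def
    by (intro u) (simp_all add: card_cartesian_product power_numeral_reduce mult_ac)
  then show ?thesis by simp
qed

lemma card_small: "card (small s) = card (int_ball 0 s) ^ 6"
  by (simp add: small_def Let_def card_cartesian_product power_numeral_reduce)

lemma div_step:
  fixes A B :: int
  assumes "B \<noteq> 0"
  shows "\<bar>A - (A div B) * B\<bar> \<le> \<bar>B\<bar>" "\<bar>A div B\<bar> \<le> \<bar>A\<bar> + \<bar>B\<bar>"
proof -
  have m: "A - (A div B) * B = A mod B" by (simp add: minus_div_mult_eq_mod)
  show 1: "\<bar>A - (A div B) * B\<bar> \<le> \<bar>B\<bar>"
    unfolding m using abs_mod_less[OF assms, of A] by linarith
  have "\<bar>A div B\<bar> * 1 \<le> \<bar>A div B\<bar> * \<bar>B\<bar>" using assms by (intro mult_left_mono) auto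
  also have "\<dots> = \<bar>(A div B) * B\<bar>" by (simp add: abs_mult)
  also have "\<dots> \<le> \<bar>A\<bar> + \<bar>B\<bar>" using 1 by linarith
  finally show "\<bar>A div B\<bar> \<le> \<bar>A\<bar> + \<bar>B\<bar>" by simp
qed

text \<open>For a nonzero coefficient B of t and the matching coefficient A of q, the multiplier A
  div B leaves a remainder bounded by s. It is itself at most r + s, so the other coefficients grow
  by at most (r + s) s.\<close>

lemma normalise:
  assumes q: "q \<in> int_ball 0 r \<times> int_ball 0 r \<times> int_ball 0 r \<times> int_ball 0 r \<times> int_ball 0 r \<times> int_ball 0 r"
    and t: "t \<in> small s" "t \<noteq> (0,0,0,0,0,0)"
  shows "\<exists>k. coeff_comb q k t \<in> big_small (r + (r + s) * s) s"
proof -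
  obtain q1 q2 q3 q4 q5 q6 where qe: "q = (q1, q2, q3, q4, q5, q6)" by (cases q)
  obtain t1 t2 t3 t4 t5 t6 where te: "t = (t1, t2, t3, t4, t5, t6)" by (cases t)
  have b: "\<bar>real_of_int x\<bar> \<le> r" if "x \<in> {q1,q2,q3,q4,q5,q6}" for x
    using q that by (auto simp: qe int_ball_def)
  have bt: "\<bar>real_of_int x\<bar> \<le> s" if "x \<in> {t1,t2,t3,t4,t5,t6}" for x
    using t(1) that by (auto simp: te small_def Let_def int_ball_def)
  have s0: "0 \<le> s" using bt[of t1] by simp
  have big: "x - (A div B) * y \<in> int_ball 0 (r + (r + s) * s)"
    if "x \<in> {q1,q2,q3,q4,q5,q6}" "y \<in> {t1,t2,t3,t4,t5,t6}" "A \<in> {q1,q2,q3,q4,q5,q6}" "B \<in> {t1,t2,t3,t4,t5,t6}" "B \<noteq> 0" for x y A B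
  proof -
    have "real_of_int \<bar>A div B\<bar> \<le> real_of_int (\<bar>A\<bar> + \<bar>B\<bar>)" using div_step(2)[OF that(5)] by (simp only: of_int_le_iff)
    also have "\<dots> \<le> r + s" using b[OF that(3)] bt[OF that(4)] by simp
    finally have k: "\<bar>real_of_int (A div B)\<bar> \<le> r + s" by simp
    have "\<bar>real_of_int (A div B)\<bar> * \<bar>real_of_int y\<bar> \<le> (r + s) * s"
      using k bt[OF that(2)] by (intro mult_mono) auto
    then have "\<bar>real_of_int x - real_of_int (A div B) * real_of_int y\<bar> \<le> r + (r + s) * s"
      using b[OF that(1)] abs_triangle_ineq4[of "real_of_int x" "real_of_int (A div B) * real_of_int y"]
      by (simp add: abs_mult)
    then show ?thesis by (simp add: int_ball_def)
  qed
  have sm: "A - (A div B) * B \<in> int_ball 0 s"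
    if "B \<in> {t1,t2,t3,t4,t5,t6}" "B \<noteq> 0" for A B
  proof -
    have "real_of_int \<bar>A - (A div B) * B\<bar> \<le> real_of_int \<bar>B\<bar>" using div_step(1)[OF that(2)] by (simp only: of_int_le_iff)
    then have "real_of_int \<bar>A - (A div B) * B\<bar> \<le> s" using bt[OF that(1)] by simp
    then show ?thesis by (simp add: int_ball_def)
  qed
  consider "t1 \<noteq> 0" | "t2 \<noteq> 0" | "t3 \<noteq> 0" | "t4 \<noteq> 0" | "t5 \<noteq> 0" | "t6 \<noteq> 0"
    using t(2) te by auto
  then show ?thesis
  proof cases
    case 1
    then show ?thesis
      by (intro exI[of _ "q1 div t1"]) (simp add: qe te big_small_def Let_def big sm)
  next
    case 2
    then show ?thesis
      by (intro exI[of _ "q2 div t2"]) (simp add: qe te big_small_def Let_def big sm)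
  next
    case 3
    then show ?thesis
      by (intro exI[of _ "q3 div t3"]) (simp add: qe te big_small_def Let_def big sm)
  next
    case 4
    then show ?thesis
      by (intro exI[of _ "q4 div t4"]) (simp add: qe te big_small_def Let_def big sm)
  next
    case 5
    then show ?thesis
      by (intro exI[of _ "q5 div t5"]) (simp add: qe te big_small_def Let_def big sm)
  next
    case 6
    then show ?thesis
      by (intro exI[of _ "q6 div t6"]) (simp add: qe te big_small_def Let_def big sm)
  qed
qed

text \<open>Multiplying the tolerance by ln \<Delta> \<le> ln T leaves at most \<epsilon>, whence
  the factor \<open>exp \<epsilon>\<close>.\<close>

lemma upper_from_log:
  fixes \<Delta> T x p \<epsilon> :: real
  assumes \<Delta>: "1 < \<Delta>" "\<Delta> \<le> T" and \<epsilon>: "0 \<le> \<epsilon>" and lg: "\<bar>log \<Delta> x - p\<bar> \<le> \<epsilon> / ln T"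
  shows "x \<le> exp \<epsilon> * \<Delta> powr p"
proof (cases "x > 0")
  case True
  have l: "0 < ln \<Delta>" "ln \<Delta> \<le> ln T" using \<Delta> by simp_all
  have "ln x / ln \<Delta> \<le> p + \<epsilon> / ln T" using lg by (simp add: log_def abs_le_iff)
  then have "ln x \<le> (p + \<epsilon> / ln T) * ln \<Delta>" using l(1) by (simp add: divide_le_eq)
  also have "\<dots> = p * ln \<Delta> + \<epsilon> * (ln \<Delta> / ln T)" by (simp add: algebra_simps)
  also have "\<dots> \<le> p * ln \<Delta> + \<epsilon> * 1"
    using l \<epsilon> by (intro add_left_mono mult_left_mono) (auto simp: divide_le_eq)
  finally have "exp (ln x) \<le> exp (\<epsilon> + p * ln \<Delta>)" by simp
  then show ?thesis using True \<Delta> by (simp add: powr_def exp_add)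
next
  case False
  have "0 \<le> exp \<epsilon> * \<Delta> powr p" by simp
  then show ?thesis using False by linarith
qed

text \<open>Write E for exp \<epsilon> and D for \<Delta>^(1/6). By \<open>tc_bound\<close> with
  \<mu> = 7 E D, the coordinates of \<phi> are at most 48 * 49 * 5 E^3 D and 48 * 49 * 3 E^3.
  Polarization triples these constants, which gives r and s.\<close>

lemma close_reduced:
  fixes T \<epsilon> :: real
  assumes P: "(R, C, \<phi>) \<in> resolvent_pairs" and \<Delta>T: "real_of_int \<bar>ring_disc TYPE(4) R\<bar> \<le> T"
    and close: "close pt \<epsilon> T (R, C, \<phi>)" and \<epsilon>: "0 \<le> \<epsilon>" and T: "6 * \<epsilon> < ln T" "1 < T"
  defines "s \<equiv> 21168 * exp \<epsilon> ^ 3" and "r \<equiv> 35280 * exp \<epsilon> ^ 3 * T powr (1/6)"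
  shows "\<exists>q t. q \<in> big_small (r + (r + s) * s) s \<and> t \<in> small s \<and> represented_by R C \<phi> (qform q) (qform t)"
proof -
  define E where "E = exp \<epsilon>"
  have E1: "1 \<le> E" using \<epsilon> by (simp add: E_def)
  have rR: "rank_ring TYPE(4) R" and res: "is_cubic_resolvent R C \<phi>" and nd: "nondegenerate TYPE(4) R"
    using P by (auto simp: resolvent_pairs_def)
  define \<Delta> where "\<Delta> = real_of_int \<bar>ring_disc TYPE(4) R\<bar>"
  have lnT: "0 < ln T" using T(2) by simp
  have cl: "\<bar>log \<Delta> (succ_min TYPE(4) R 3) - 1/6\<bar> \<le> \<epsilon> / ln T"
    "\<bar>log \<Delta> (succ_min TYPE(3) C 1) - 1/6\<bar> \<le> \<epsilon> / ln T" "\<bar>log \<Delta> (succ_min TYPE(3) C 2) - 1/3\<bar> \<le> \<epsilon> / ln T"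
    using close by (simp_all add: \<Delta>_def Let_def)
  have "1 \<le> \<bar>ring_disc TYPE(4) R\<bar>" using nd by (simp add: nondegenerate_def)
  then have "1 \<le> \<Delta>" unfolding \<Delta>_def by linarith
  \<comment> \<open>The logarithm to base 1 is 0 by convention, so discriminant 1 deviates by 1/6
    from the point; \<open>6 * \<epsilon> < ln T\<close> rules this out.\<close>
  moreover have "\<Delta> \<noteq> 1"
  proof
    assume "\<Delta> = 1"
    then have "1/6 \<le> \<epsilon> / ln T" using cl(1) by (simp add: log_def)
    then show False using T(1) lnT by (simp add: field_simps)
  qed
  ultimately have \<Delta>1: "1 < \<Delta>" by simp
  have \<Delta>le: "\<Delta> \<le> T" using \<Delta>T by (simp add: \<Delta>_def)
  define D where "D = \<Delta> powr (1/6)"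
  have D1: "1 \<le> D" using \<Delta>1 by (simp add: D_def ge_one_powr_ge_zero)
  have D2: "\<Delta> powr (1/3) = D\<^sup>2"
    unfolding D_def power2_eq_square powr_add[symmetric] by simp
  have D6: "(D ^ 3)\<^sup>2 = \<Delta>"
  proof -
    have "(D ^ 3)\<^sup>2 = D powr 6" using D1 by (simp add: powr_numeral flip: power_mult)
    also have "\<dots> = \<Delta> powr 1" by (simp add: D_def powr_powr)
    also have "\<dots> = \<Delta>" using \<Delta>1 by (intro powr_one) simp
    finally show ?thesis .
  qed
  have DT: "D \<le> T powr (1/6)" unfolding D_def using \<Delta>le \<Delta>1 by (intro powr_mono2) auto
  note up = upper_from_log[OF \<Delta>1 \<Delta>le \<epsilon>]
  have l3: "succ_min TYPE(4) R 3 \<le> E * D" using up[OF cl(1)] by (simp add: E_def D_def)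
  have m1: "succ_min TYPE(3) C 1 \<le> E * D" using up[OF cl(2)] by (simp add: E_def D_def)
  have m2: "succ_min TYPE(3) C 2 \<le> E * D\<^sup>2" using up[OF cl(3)] by (simp add: E_def D2)
  obtain b0 :: "4 \<Rightarrow> _" where b0: "is_int_basis R b0" using rR by (auto simp: rank_ring_def)
  obtain c0 :: "3 \<Rightarrow> _" where c0: "is_int_basis C c0" using res by (auto simp: rank_ring_def is_cubic_resolvent_def)
  obtain \<sigma> :: "4 \<Rightarrow> int ^ 4 \<Rightarrow> complex" and \<tau> :: "3 \<Rightarrow> int ^ 3 \<Rightarrow> complex"
    where rp: "\<And>b c. is_int_basis R b \<Longrightarrow> b 0 = \<one>\<^bsub>R\<^esub> \<Longrightarrow> is_int_basis C c \<Longrightarrow> c 0 = \<one>\<^bsub>C\<^esub> \<Longrightarrow> res_pair R b \<sigma> C c \<tau> \<phi>"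
      and eR: "\<And>b. is_int_basis R b \<Longrightarrow> emb_ring R b \<sigma>" and eC: "\<And>c. is_int_basis C c \<Longrightarrow> emb_ring C c \<tau>"
    using resolvent_pair_embeddings[OF rR res] by blast
  interpret R0: emb_ring R b0 \<sigma> by (rule eR[OF b0])
  interpret C0: emb_ring C c0 \<tau> by (rule eC[OF c0])
  interpret C0: cubic_emb_ring C c0 \<tau> by unfold_locales
  have ED: "1 \<le> E * D" "E * D \<le> E * D\<^sup>2" "1 \<le> E * D\<^sup>2"
  proof -
    show 1: "1 \<le> E * D" using mult_mono[of 1 E 1 D] E1 D1 by simp
    show "E * D \<le> E * D\<^sup>2" using E1 D1 by (intro mult_left_mono) (auto simp: power2_eq_square)
    then show "1 \<le> E * D\<^sup>2" using 1 by linarith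
  qed

  obtain b :: "4 \<Rightarrow> int ^ 4" where b: "is_int_basis R b" "b 0 = \<one>\<^bsub>R\<^esub>" and bb: "\<And>i j. cmod (\<sigma> i (b j)) \<le> 7 * (E * D)"
  proof -
    obtain v where v: "R0.sm_witness 3 v (succ_min TYPE(4) R 3)"
      using R0.succ_min_witness[of 3] by auto
    obtain v' where v': "v' 0 = R0.e0" "det (row_matrix (\<lambda>i. ix4 i) v') \<noteq> 0"
      "\<And>j. 1 \<le> j \<Longrightarrow> j \<le> 3 \<Longrightarrow> \<exists>k\<le>3. v' j = coords R b0 (v k)"
      using R0.exchange_one[OF bij_ix4 v] by blast
    obtain \<beta> where \<beta>: "\<beta> 0 = R0.e0" "is_int_basis R (\<lambda>j. int_comb R b0 (\<beta> (ix4 j)))"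
      "\<And>j i. j \<le> 3 \<Longrightarrow> cmod (R0.ev i (\<beta> j)) \<le> (\<Sum>k\<le>j. cmod (R0.ev i (v' k)))"
      using R0.reduced_basis[OF bij_ix4 v'(1,2)] by blast
    have vb: "cmod (R0.ev i (v' k)) \<le> 2 * (E * D)" if kk: "1 \<le> k" "k \<le> 3" for i k
    proof -
      obtain l where l: "l \<le> 3" "v' k = coords R b0 (v l)" using v'(3)[OF kk] by blast
      have "v l \<in> carrier R" "ring_length TYPE(4) R (v l) \<le> succ_min TYPE(4) R 3"
        using v l(1) by (auto simp: R0.sm_witness_def)
      then show ?thesis
        using R0.cmod_le_ring_length[of i "v l"] l3 by (simp add: l(2) R0.ev_coords)
    qed
    show ?thesis
    proof (rule that[OF \<beta>(2)])
      show "int_comb R b0 (\<beta> (ix4 0)) = \<one>\<^bsub>R\<^esub>" by (simp add: \<beta>(1) R0.e0_def)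
      fix i j
      have j3: "ix4 j \<le> 3" by simp
      have "cmod (\<sigma> i (int_comb R b0 (\<beta> (ix4 j)))) \<le> (\<Sum>k\<le>ix4 j. cmod (R0.ev i (v' k)))"
        using \<beta>(3)[OF j3, of i] by (simp add: R0.ev_def)
      also have "\<dots> \<le> (\<Sum>k\<le>3. cmod (R0.ev i (v' k)))"
        using j3 by (intro sum_mono2) auto
      also have "\<dots> = cmod (R0.ev i (v' 0)) + cmod (R0.ev i (v' 1)) + cmod (R0.ev i (v' 2)) + cmod (R0.ev i (v' 3))"
        by (simp add: numeral_3_eq_3 numeral_2_eq_2)
      also have "\<dots> \<le> 1 + 2 * (E * D) + 2 * (E * D) + 2 * (E * D)"
      proof -
        have "cmod (R0.ev i (v' 0)) = 1" by (simp add: v'(1) R0.ev_e0)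
        moreover have "cmod (R0.ev i (v' 1)) \<le> 2 * (E * D)" "cmod (R0.ev i (v' 2)) \<le> 2 * (E * D)"
          "cmod (R0.ev i (v' 3)) \<le> 2 * (E * D)" by (rule vb, simp, simp)+
        ultimately show ?thesis by linarith
      qed
      also have "\<dots> \<le> 7 * (E * D)" using ED(1) by linarith
      finally show "cmod (\<sigma> i (int_comb R b0 (\<beta> (ix4 j)))) \<le> 7 * (E * D)" .
    qed
  qed

  \<comment> \<open>The second basis element has to be controlled by the first minimum alone:
    otherwise the bound for B, which involves the columns 0 and 1, would grow with D. The basis is
    therefore built on 1, a short element and a third one from \<open>exchange_pair\<close>.\<close>
  define M where "M j = (if j = 0 then 1 else if j = 1 then 3 * (E * D) else 5 * (E * D\<^sup>2))" for j :: 3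
  obtain c :: "3 \<Rightarrow> int ^ 3" where c: "is_int_basis C c" "c 0 = \<one>\<^bsub>C\<^esub>" and cb: "\<And>i j. cmod (\<tau> i (c j)) \<le> M j"
  proof -
    obtain w where w: "C0.sm_witness 1 w (succ_min TYPE(3) C 1)"
      using C0.succ_min_witness[of 1] by auto
    obtain j1 where j1: "j1 \<le> 1" "\<forall>k. coords C c0 (w j1) \<noteq> k *s C0.e0"
      using C0.sm_witness_nonscalar[OF w, of C0.e0] by auto
    obtain z where z: "C0.sm_witness 2 z (succ_min TYPE(3) C 2)"
      using C0.succ_min_witness[of 2] by auto
    obtain k2 where k2: "k2 \<le> 2" "det (row_matrix (\<lambda>i. ix3 i) (\<lambda>j. if j = 0 then C0.e0 else if j = 1 then coords C c0 (w j1) else coords C c0 (z k2))) \<noteq> 0"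
      using C0.exchange_pair[OF j1(2) z] by blast
    define v' where "v' j = (if j = 0 then C0.e0 else if j = 1 then coords C c0 (w j1) else coords C c0 (z k2))" for j :: nat
    have v': "v' 0 = C0.e0" "det (row_matrix (\<lambda>i. ix3 i) v') \<noteq> 0"
      using k2(2) by (simp_all add: v'_def[abs_def])
    obtain \<gamma> where \<gamma>: "\<gamma> 0 = C0.e0" "is_int_basis C (\<lambda>j. int_comb C c0 (\<gamma> (ix3 j)))"
      "\<And>j i. j \<le> 2 \<Longrightarrow> cmod (C0.ev i (\<gamma> j)) \<le> (\<Sum>k\<le>j. cmod (C0.ev i (v' k)))"
      using C0.reduced_basis[OF bij_ix3 v'] by blast
    have len: "cmod (\<tau> i x) \<le> 2 * y" if "ring_length TYPE(3) C x \<le> y" for i x y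
    proof -
      have "cmod (\<tau> i x) \<le> sqrt 3 * ring_length TYPE(3) C x"
        using C0.cmod_le_ring_length[of i x] by simp
      also have "\<dots> \<le> 2 * ring_length TYPE(3) C x"
        by (intro mult_right_mono C0.ring_length_nonneg) (simp add: real_le_lsqrt)
      finally show ?thesis using that by linarith
    qed
    have v0: "cmod (C0.ev i (v' 0)) = 1" for i by (simp add: v'(1) C0.ev_e0)
    have v1: "cmod (C0.ev i (v' 1)) \<le> 2 * (E * D)" for i
    proof -
      have "w j1 \<in> carrier C" "ring_length TYPE(3) C (w j1) \<le> E * D"
        using w j1(1) m1 by (auto simp: C0.sm_witness_def intro: order_trans)
      then show ?thesis using len by (simp add: v'_def C0.ev_coords)
    qed
    have v2: "cmod (C0.ev i (v' 2)) \<le> 2 * (E * D\<^sup>2)" for i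
    proof -
      have "z k2 \<in> carrier C" "ring_length TYPE(3) C (z k2) \<le> E * D\<^sup>2"
        using z k2(1) m2 by (auto simp: C0.sm_witness_def intro: order_trans)
      then show ?thesis using len by (simp add: v'_def C0.ev_coords)
    qed
    show ?thesis
    proof (rule that[OF \<gamma>(2)])
      show "int_comb C c0 (\<gamma> (ix3 0)) = \<one>\<^bsub>C\<^esub>" by (simp add: \<gamma>(1) C0.e0_def)
      fix i j
      have g: "cmod (C0.ev i (\<gamma> 0)) \<le> 1" "cmod (C0.ev i (\<gamma> 1)) \<le> 1 + 2 * (E * D)"
        "cmod (C0.ev i (\<gamma> 2)) \<le> 1 + 2 * (E * D) + 2 * (E * D\<^sup>2)"
        using \<gamma>(3)[of 0 i] \<gamma>(3)[of 1 i] \<gamma>(3)[of 2 i] v0[of i] v1[of i] v2[of i]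
        by (simp_all add: numeral_2_eq_2)
      have "cmod (C0.ev i (\<gamma> (ix3 j))) \<le> M j"
        using exhaust_3_0[of j] g ED by (elim disjE; hypsubst) (simp_all add: M_def)
      then show "cmod (\<tau> i (int_comb C c0 (\<gamma> (ix3 j)))) \<le> M j" by (simp add: C0.ev_def)
    qed
  qed

  interpret res_pair R b \<sigma> C c \<tau> \<phi> by (rule rp[OF b c])
  interpret rep_pair R b \<sigma> C c \<tau> \<phi> "qform (form_coeffs 1)" "qform (form_coeffs 2)"
    by (rule rep_pair_form_coeffs)
  have "(cmod (det R.S))\<^sup>2 = (D ^ 3)\<^sup>2" unfolding D6 \<Delta>_def R.abs_ring_disc ..
  then have "cmod (det R.S) = D ^ 3" by (rule power2_eq_imp_eq) (use D1 in simp_all)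
  then have dC: "cmod (det C.S) = D ^ 3" using det_eq by auto
  have D3: "0 < D ^ 3" using D1 by simp
  have pm: "(\<Prod>k\<in>UNIV - {1}. M k) = 5 * (E * D\<^sup>2)" "(\<Prod>k\<in>UNIV - {2}. M k) = 3 * (E * D)"
  proof -
    have "UNIV - {1} = {0, 2 :: 3}" "UNIV - {2} = {0, 1 :: 3}" unfolding UNIV_3_0 by auto
    then show "(\<Prod>k\<in>UNIV - {1}. M k) = 5 * (E * D\<^sup>2)" "(\<Prod>k\<in>UNIV - {2}. M k) = 3 * (E * D)"
      by (simp_all add: M_def)
  qed
  have t1: "real_of_int \<bar>tc x y z $ 1\<bar> \<le> 11760 * E ^ 3 * D" if "\<bar>x\<bar> + \<bar>y\<bar> + \<bar>z\<bar> \<le> 2" for x y z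
  proof -
    have "real_of_int \<bar>tc x y z $ 1\<bar> * D ^ 3 \<le> (11760 * E ^ 3 * D) * D ^ 3"
      using tc_bound[of "7 * (E * D)" M, OF bb cb that, of 1] unfolding pm dC
      by (simp add: power2_eq_square power3_eq_cube mult_ac)
    then show ?thesis using D3 by simp
  qed
  have t2: "real_of_int \<bar>tc x y z $ 2\<bar> \<le> 7056 * E ^ 3" if "\<bar>x\<bar> + \<bar>y\<bar> + \<bar>z\<bar> \<le> 2" for x y z
  proof -
    have "real_of_int \<bar>tc x y z $ 2\<bar> * D ^ 3 \<le> (7056 * E ^ 3) * D ^ 3"
      using tc_bound[of "7 * (E * D)" M, OF bb cb that, of 2] unfolding pm dC
      by (simp add: power2_eq_square power3_eq_cube mult_ac)
    then show ?thesis using D3 by simp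
  qed
  have mem: "form_coeffs j \<in> int_ball 0 (3 * K) \<times> int_ball 0 (3 * K) \<times> int_ball 0 (3 * K) \<times> int_ball 0 (3 * K) \<times> int_ball 0 (3 * K) \<times> int_ball 0 (3 * K)"
    if K: "\<And>x y z. \<bar>x\<bar> + \<bar>y\<bar> + \<bar>z\<bar> \<le> 2 \<Longrightarrow> real_of_int \<bar>tc x y z $ j\<bar> \<le> K" for j K
  proof -
    have K1: "real_of_int \<bar>tc 1 0 0 $ j\<bar> \<le> K" "real_of_int \<bar>tc 0 1 0 $ j\<bar> \<le> K" "real_of_int \<bar>tc 0 0 1 $ j\<bar> \<le> K"
      "real_of_int \<bar>tc 1 1 0 $ j\<bar> \<le> K" "real_of_int \<bar>tc 1 0 1 $ j\<bar> \<le> K" "real_of_int \<bar>tc 0 1 1 $ j\<bar> \<le> K"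
      by (rule K, simp)+
    have ib: "u \<in> int_ball 0 (3 * K)" if "real_of_int \<bar>u\<bar> \<le> 3 * K" for u
      using that by (simp add: int_ball_def)
    have d: "real_of_int \<bar>u - v - w\<bar> \<le> 3 * K"
      if "real_of_int \<bar>u\<bar> \<le> K" "real_of_int \<bar>v\<bar> \<le> K" "real_of_int \<bar>w\<bar> \<le> K" for u v w
      using that by linarith
    have i: "real_of_int \<bar>u\<bar> \<le> 3 * K" if "real_of_int \<bar>u\<bar> \<le> K" for u
      using that by linarith
    show ?thesis unfolding form_coeffs_def
      by (intro SigmaI ib d i K1)
  qed
  have q: "form_coeffs 1 \<in> int_ball 0 r \<times> int_ball 0 r \<times> int_ball 0 r \<times> int_ball 0 r \<times> int_ball 0 r \<times> int_ball 0 r"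
  proof -
    have "11760 * E ^ 3 * D \<le> 11760 * E ^ 3 * T powr (1/6)"
      using DT E1 by (intro mult_left_mono) auto
    then have "real_of_int \<bar>tc x y z $ 1\<bar> \<le> 11760 * E ^ 3 * T powr (1/6)" if "\<bar>x\<bar> + \<bar>y\<bar> + \<bar>z\<bar> \<le> 2" for x y z
      using t1[OF that] by linarith
    moreover have "r = 3 * (11760 * E ^ 3 * T powr (1/6))" by (simp add: r_def E_def)
    ultimately show ?thesis using mem by blast
  qed
  have t: "form_coeffs 2 \<in> small s"
  proof -
    have "s = 3 * (7056 * E ^ 3)" by (simp add: s_def E_def)
    then show ?thesis unfolding small_def Let_def using mem[OF t2] by blast
  qed
  have "form_coeffs 2 \<noteq> (0,0,0,0,0,0)"
  proof
    assume z: "form_coeffs 2 = (0,0,0,0,0,0)"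
    show False using forms_independent unfolding z by simp
  qed
  from normalise[OF q t this] obtain k where "coeff_comb (form_coeffs 1) k (form_coeffs 2) \<in> big_small (r + (r + s) * s) s"
    by blast
  moreover have "represented_by R C \<phi> (qform (coeff_comb (form_coeffs 1) k (form_coeffs 2))) (qform (form_coeffs 2))"
    using represented_by_shift[of k] by (simp add: qform_comb[abs_def])
  ultimately show ?thesis using t by blast
qed

lemma F4_count:
  assumes \<epsilon>: "0 \<le> \<epsilon>"
  obtains K where "0 < K"
    "eventually (\<lambda>T. finite (F4 pt \<epsilon> T) \<and> real (card (F4 pt \<epsilon> T)) \<le> K * T powr (5/6)) at_top"
proof -
  define s where "s = 21168 * exp \<epsilon> ^ 3"
  define r0 where "r0 = 35280 * exp \<epsilon> ^ 3"
  \<comment> \<open>Chosen so that 2 r' + 1 \<le> k x for x = T^(1/6), using x \<ge> 1 for the terms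
    free of x.\<close>
  define k where "k = 2 * (r0 + (r0 + s) * s) + 1"
  define K where "K = 6 * (2 * s + 1) * k ^ 5 * (2 * s + 1) ^ 6"
  have s0: "0 < s" "0 < r0" by (simp_all add: s_def r0_def)
  then have k0: "0 < k" by (simp add: k_def add_pos_pos)
  show ?thesis
  proof (rule that)
    show "0 < K" using s0 k0 by (simp add: K_def add_pos_pos)
    have "eventually (\<lambda>T. T \<ge> max 2 (exp (6 * \<epsilon> + 1))) at_top" by (rule eventually_ge_at_top)
    then show "eventually (\<lambda>T. finite (F4 pt \<epsilon> T) \<and> real (card (F4 pt \<epsilon> T)) \<le> K * T powr (5/6)) at_top"
    proof (rule eventually_mono)
      fix T :: real assume "max 2 (exp (6 * \<epsilon> + 1)) \<le> T"
      then have T: "2 \<le> T" "exp (6 * \<epsilon> + 1) \<le> T" by auto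
      have lnT: "6 * \<epsilon> < ln T"
      proof -
        have "6 * \<epsilon> + 1 \<le> ln T" using T by (simp add: ln_ge_iff)
        then show ?thesis by simp
      qed
      define x where "x = T powr (1/6)"
      have x1: "1 \<le> x" using T(1) by (simp add: x_def ge_one_powr_ge_zero)
      have x5: "x ^ 5 = T powr (5/6)"
      proof -
        have "x ^ 5 = x powr 5" using x1 by (simp add: powr_numeral)
        then show ?thesis by (simp add: x_def powr_powr)
      qed
      define r where "r = r0 * x"
      define r' where "r' = r + (r + s) * s"
      define S where "S = big_small r' s \<times> small s"
      have finS: "finite S" by (simp add: S_def finite_big_small finite_small)
      let ?cls = "\<lambda>(q, t). bhargava_class (qform q) (qform t)"
      have sub: "F4 pt \<epsilon> T \<subseteq> ?cls ` S"
      proof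
        fix Q assume "Q \<in> F4 pt \<epsilon> T"
        then obtain P where P: "P \<in> {(R, C, \<phi>) \<in> resolvent_pairs.
            real_of_int \<bar>ring_disc TYPE(4) R\<bar> \<le> T \<and> close pt \<epsilon> T (R, C, \<phi>)}" "Q = pair_iso `` {P}"
          unfolding F4_def by (rule quotientE)
        obtain R C \<phi> where Pe: "P = (R, C, \<phi>)" by (cases P)
        have P': "(R, C, \<phi>) \<in> resolvent_pairs" "real_of_int \<bar>ring_disc TYPE(4) R\<bar> \<le> T" "close pt \<epsilon> T (R, C, \<phi>)"
          using P(1) unfolding Pe by blast+
        obtain q t where qt: "q \<in> big_small r' s" "t \<in> small s" "represented_by R C \<phi> (qform q) (qform t)"
          using close_reduced[OF P' \<epsilon> lnT] T(1) unfolding r'_def r_def s_def r0_def x_def by auto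
        have "(R, C, \<phi>) \<in> bhargava_class (qform q) (qform t)"
          using P'(1) qt(3) unfolding bhargava_class_def by blast
        then have "Q = bhargava_class (qform q) (qform t)"
          using bhargava_class_eq P(2) unfolding Pe by simp
        then show "Q \<in> ?cls ` S" using qt(1,2) unfolding S_def by (intro image_eqI[of _ _ "(q, t)"]) auto
      qed
      have "card (F4 pt \<epsilon> T) \<le> card S"
        using surj_card_le[OF finS sub] .
      also have "card S \<le> 6 * (card (int_ball 0 s) * card (int_ball 0 r') ^ 5) * card (int_ball 0 s) ^ 6"
        unfolding S_def card_cartesian_product card_small by (intro mult_right_mono card_big_small) simp
      finally have "real (card (F4 pt \<epsilon> T)) \<le> 6 * (real (card (int_ball 0 s)) * real (card (int_ball 0 r')) ^ 5) * real (card (int_ball 0 s)) ^ 6"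
        by (metis (mono_tags) of_nat_le_iff of_nat_mult of_nat_numeral of_nat_power)
      also have "\<dots> \<le> 6 * ((2 * s + 1) * (k * x) ^ 5) * (2 * s + 1) ^ 6"
      proof -
        have r'0: "0 \<le> r'" using s0 x1 by (simp add: r'_def r_def)
        have "2 * r' + 1 \<le> k * x"
        proof -
          have "s * s \<le> s * s * x" using s0 x1 by (simp add: mult_le_cancel_left1)
          then show ?thesis using x1 by (simp add: r'_def r_def k_def algebra_simps)
        qed
        then have "real (card (int_ball 0 r')) \<le> k * x"
          using card_int_ball_le[OF r'0, of 0] by linarith
        moreover have "real (card (int_ball 0 s)) \<le> 2 * s + 1"
          using s0 by (intro card_int_ball_le) simp
        ultimately show ?thesis
          using s0 k0 x1 by (intro mult_mono power_mono mult_nonneg_nonneg zero_le_power) auto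
      qed
      also have "\<dots> = K * T powr (5/6)"
        unfolding x5[symmetric] K_def by (simp add: power_mult_distrib)
      finally show "finite (F4 pt \<epsilon> T) \<and> real (card (F4 pt \<epsilon> T)) \<le> K * T powr (5/6)"
        using finite_subset[OF sub finite_imageI[OF finS]] by blast
    qed
  qed
qed

theorem theorem5p7:
  shows "corresponds_to F4_bin coeff_height quartic_psi (1/6, 1/6, 1/6, 1/6, 1/3)"
  unfolding corresponds_to_def
proof (intro conjI)
  show "((\<lambda>\<epsilon>. Liminf at_top (\<lambda>T::real. ereal
          (real (card {f \<in> F4_bin. coeff_height f \<le> T \<and> (\<exists>P\<in>quartic_psi f. close pt \<epsilon> T P)}) /
           real (card {f \<in> F4_bin. coeff_height f \<le> T})))) \<longlongrightarrow> 1) at_top"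
    by (rule density_limit)
  obtain M k where k: "0 < k" and many: "\<And>\<epsilon>. \<epsilon> > M \<Longrightarrow> eventually (\<lambda>T. \<exists>S. finite S \<and>
      S \<subseteq> {K \<in> F4 pt \<epsilon> T. K \<in> quartic_psi ` F4_bin} \<and> k * T powr (5/6) \<le> real (card S)) at_top"
    using many_classes by blast
  show "\<exists>M. \<forall>\<epsilon>>M. Liminf at_top (\<lambda>T::real. ereal
          (real (card {K \<in> F4 pt \<epsilon> T. K \<in> quartic_psi ` F4_bin}) / real (card (F4 pt \<epsilon> T)))) > 0"
  \<comment> \<open>The upper bound for the number of classes is available for nonnegative
    \<epsilon>, hence the maximum with 0.\<close>
  proof (intro exI[of _ "max M 0"] allI impI)
    fix \<epsilon> assume \<epsilon>: "max M 0 < \<epsilon>"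
    obtain K where K: "0 < K"
      "eventually (\<lambda>T. finite (F4 pt \<epsilon> T) \<and> real (card (F4 pt \<epsilon> T)) \<le> K * T powr (5/6)) at_top"
      using F4_count[of \<epsilon>] \<epsilon> by auto
    have "M < \<epsilon>" using \<epsilon> by simp
    from eventually_conj[OF many[OF this] eventually_conj[OF K(2) eventually_gt_at_top[of 0]]]
    have "eventually (\<lambda>T. ereal (k / K) \<le> ereal
          (real (card {K \<in> F4 pt \<epsilon> T. K \<in> quartic_psi ` F4_bin}) / real (card (F4 pt \<epsilon> T)))) at_top"
    proof (rule eventually_mono)
      fix T :: real
      let ?N = "{K \<in> F4 pt \<epsilon> T. K \<in> quartic_psi ` F4_bin}"
      assume "(\<exists>S. finite S \<and> S \<subseteq> ?N \<and> k * T powr (5/6) \<le> real (card S)) \<and>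
        (finite (F4 pt \<epsilon> T) \<and> real (card (F4 pt \<epsilon> T)) \<le> K * T powr (5/6)) \<and> 0 < T"
      then obtain S where S: "S \<subseteq> ?N" "k * T powr (5/6) \<le> real (card S)"
        and fin: "finite (F4 pt \<epsilon> T)" and le: "real (card (F4 pt \<epsilon> T)) \<le> K * T powr (5/6)" and T: "0 < T" by blast
      have finN: "finite ?N" using fin by simp
      have N: "k * T powr (5/6) \<le> real (card ?N)"
        using card_mono[OF finN S(1)] S(2) by linarith
      have pos: "0 < k * T powr (5/6)" using k T by simp
      have "card ?N \<le> card (F4 pt \<epsilon> T)" by (rule card_mono[OF fin]) blast
      then have F: "0 < real (card (F4 pt \<epsilon> T))" using N pos by linarith
      have "k / K * real (card (F4 pt \<epsilon> T)) \<le> k / K * (K * T powr (5/6))"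
        using le k K(1) by (intro mult_left_mono) auto
      also have "\<dots> \<le> real (card ?N)" using N K(1) by simp
      finally show "ereal (k / K) \<le> ereal (real (card ?N) / real (card (F4 pt \<epsilon> T)))"
        using F by (simp add: le_divide_eq)
    qed
    then have "ereal (k / K) \<le> Liminf at_top (\<lambda>T::real. ereal
          (real (card {K \<in> F4 pt \<epsilon> T. K \<in> quartic_psi ` F4_bin}) / real (card (F4 pt \<epsilon> T))))"
      by (rule Liminf_bounded)
    moreover have "0 < ereal (k / K)" using k K(1) by simp
    ultimately show "0 < Liminf at_top (\<lambda>T::real. ereal
          (real (card {K \<in> F4 pt \<epsilon> T. K \<in> quartic_psi ` F4_bin}) / real (card (F4 pt \<epsilon> T))))"
      by (rule less_le_trans[rotated])
  qed
qed

end
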